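(* Let $\alpha\in(0,1)$, $T>0$, and let $0=t_0<t_1<\dots<t_M=T$ be a temporal mesh, with $\tau_j:=t_j-t_{j-1}$ and $\rho_j:=\tau_{j+1}/\tau_j$, such that either $0.4656\le\rho_j\le\rho_{j-1}$ for all $j\ge2$ or $\rho_j\ge4/7$ for all $j\ge2$, and which is quasi-graded with some parameter $r\ge1$. Let $u\in C[0,T]\cap C^3(0,T]$ satisfy $|\partial_t^lu(t)|\lesssim1+t^{\alpha-l}$ for $l=1,3$ and $t\in(0,T]$, and suppose that $u$ and $\{U^m\}_{m=0}^M$ satisfy $$D_t^\alpha u(t)=f(t)\ \ \text{for } t\in(0,T],\quad u(0)=u_0,\qquad\qquad \delta_t^{\alpha,*}U^m=f(t_m^* )\ \ \text{for } m=1,\dots,M,\quad U^0=u_0,$$ where $t_m^*:=t_m-\frac12\alpha\tau_m$ and $\delta_t^{\alpha,*}$ is the Alikhanov discrete fractional-derivative operator. Then for all $m\ge1$ $$|u(t_m)-U^m|\lesssim\mathcal E^{m,*}:=\begin{cases}M^{-r}\,t_m^{\alpha-1}&\text{if }1\le r<3-\alpha,\\ M^{\alpha-3}\,t_m^{\alpha-1}\,[1+\ln(t_m/t_1)]&\text{if } r=3-\alpha,\\ M^{\alpha-3}\,t_m^{\alpha-(3-\alpha)/r}&\text{if } r>3-\alpha.\end{cases}$$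
   Context: Caputo derivative: $D_t^\alpha v(t):=\frac1{\Gamma(1-\alpha)}\int_0^t(t-s)^{-\alpha}\,\partial_sv(s)\,ds$. Alikhanov operator: let $\Pi_{1,j}$ and $\Pi_{2,j}$ be the Lagrange interpolation operators with interpolation points $\{t_{j-1},t_j\}$ (linear) and $\{t_{j-1},t_j,t_{j+1}\}$ (quadratic), respectively. For $m=1,\dots,M$, $$\delta_t^{\alpha,*}U^m:=D_t^\alpha(\Pi^mU)(t_m^* ),\qquad \Pi^m:=\begin{cases}\Pi_{2,j}&\text{on }(t_{j-1},t_j)\ \ \forall j<m,\\ \Pi_{1,m}&\text{on }(t_{m-1},t_m^* ).\end{cases}$$ Quasi-graded mesh with parameter $r\ge1$: with $\tau:=t_1$, $$\tau\simeq M^{-r},\qquad t_j\simeq\tau j^r,\qquad \tau_j\simeq\tau^{1/r}t_j^{1-1/r}\qquad\forall j=1,\dots,M.$$ Notation: $a\lesssim b$ means $a\le Cb$ with a generic constant $C>0$ that does not depend on the number $M$ of mesh intervals or on mesh indices (it may depend on fixed data such as $\alpha,T,r$, $u_0$, $f$ and on the constants implicit in the hypotheses); $a\simeq b$ means $a\lesssim b$ and $b\lesssim a$. *)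

theory Defs
  imports "HOL-Analysis.Analysis"
begin

(* The ordinary derivative is used; values of deriv v at the finitely many points where v fails to be
   differentiable, and at the end points 0 and t, do not affect the integral.  For absolutely
   integrable integrands the library's (Henstock-Kurzweil) integral is the Lebesgue integral. *)
definition caputo :: "real \<Rightarrow> (real \<Rightarrow> real) \<Rightarrow> real \<Rightarrow> real" where
  "caputo \<alpha> v t =
     1 / Gamma (1 - \<alpha>) * integral {0..t} (\<lambda>s. (t - s) powr (- \<alpha>) * deriv v s)"

definition temporal_mesh :: "real \<Rightarrow> nat \<Rightarrow> (nat \<Rightarrow> real) \<Rightarrow> bool" where
  "temporal_mesh T M t \<longleftrightarrow> t 0 = 0 \<and> t M = T \<and> (\<forall>j\<in>{1..M}. t (j - 1) < t j)"

definition mesh_step :: "(nat \<Rightarrow> real) \<Rightarrow> nat \<Rightarrow> real" where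
  "mesh_step t j = t j - t (j - 1)"

definition mesh_ratio :: "(nat \<Rightarrow> real) \<Rightarrow> nat \<Rightarrow> real" where
  "mesh_ratio t j = mesh_step t (j + 1) / mesh_step t j"

(* The ratio of index j involves the node t (j + 1), so it is defined for j < M only. *)
definition mesh_ratio_condition :: "nat \<Rightarrow> (nat \<Rightarrow> real) \<Rightarrow> bool" where
  "mesh_ratio_condition M t \<longleftrightarrow>
     (\<forall>j\<in>{2..<M}. 0.4656 \<le> mesh_ratio t j \<and> mesh_ratio t j \<le> mesh_ratio t (j - 1)) \<or>
     (\<forall>j\<in>{2..<M}. 4 / 7 \<le> mesh_ratio t j)"

(* a \<simeq> b, with the generic constant K made explicit *)
definition equiv_upto :: "real \<Rightarrow> real \<Rightarrow> real \<Rightarrow> bool" where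
  "equiv_upto K a b \<longleftrightarrow> a \<le> K * b \<and> b \<le> K * a"

definition quasi_graded :: "real \<Rightarrow> real \<Rightarrow> nat \<Rightarrow> (nat \<Rightarrow> real) \<Rightarrow> bool" where
  "quasi_graded K r M t \<longleftrightarrow>
     equiv_upto K (t 1) (real M powr (- r)) \<and>
     (\<forall>j\<in>{1..M}.
        equiv_upto K (t j) (t 1 * real j powr r) \<and>
        equiv_upto K (mesh_step t j) (t 1 powr (1 / r) * t j powr (1 - 1 / r)))"

(* Lagrange interpolant, at the point s, of the nodal values U i at the nodes t i with i in I *)
definition lagrange_interp :: "nat set \<Rightarrow> (nat \<Rightarrow> real) \<Rightarrow> (nat \<Rightarrow> real) \<Rightarrow> real \<Rightarrow> real" where
  "lagrange_interp I t U s = (\<Sum>i\<in>I. U i * (\<Prod>k\<in>I - {i}. (s - t k) / (t i - t k)))"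

definition interp_linear :: "nat \<Rightarrow> (nat \<Rightarrow> real) \<Rightarrow> (nat \<Rightarrow> real) \<Rightarrow> real \<Rightarrow> real" where
  "interp_linear j = lagrange_interp {j - 1, j}"

definition interp_quadratic :: "nat \<Rightarrow> (nat \<Rightarrow> real) \<Rightarrow> (nat \<Rightarrow> real) \<Rightarrow> real \<Rightarrow> real" where
  "interp_quadratic j = lagrange_interp {j - 1, j, j + 1}"

(* For 0 \<le> s \<le> t (m - 1) the selected index j is the one whose mesh interval (t (j - 1), t j] contains s
   (and j = 1 for s = 0), so j < m. *)
definition alikhanov_interp :: "nat \<Rightarrow> (nat \<Rightarrow> real) \<Rightarrow> (nat \<Rightarrow> real) \<Rightarrow> real \<Rightarrow> real" where
  "alikhanov_interp m t U s =
     (if t (m - 1) < s then interp_linear m t U s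
      else interp_quadratic (LEAST j. 1 \<le> j \<and> s \<le> t j) t U s)"

definition t_star :: "real \<Rightarrow> (nat \<Rightarrow> real) \<Rightarrow> nat \<Rightarrow> real" where
  "t_star \<alpha> t m = t m - 1 / 2 * \<alpha> * mesh_step t m"

definition alikhanov :: "real \<Rightarrow> (nat \<Rightarrow> real) \<Rightarrow> (nat \<Rightarrow> real) \<Rightarrow> nat \<Rightarrow> real" where
  "alikhanov \<alpha> t U m = caputo \<alpha> (alikhanov_interp m t U) (t_star \<alpha> t m)"

definition error_bound :: "real \<Rightarrow> real \<Rightarrow> nat \<Rightarrow> (nat \<Rightarrow> real) \<Rightarrow> nat \<Rightarrow> real" where
  "error_bound \<alpha> r M t m =
     (if r < 3 - \<alpha> then real M powr (- r) * t m powr (\<alpha> - 1)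
      else if r = 3 - \<alpha> then real M powr (\<alpha> - 3) * t m powr (\<alpha> - 1) * (1 + ln (t m / t 1))
      else real M powr (\<alpha> - 3) * t m powr (\<alpha> - (3 - \<alpha>) / r))"

end

(*
With w = t*_m, the operator is (up to 1/Gamma(1 - alpha)) a sum of coefficients times increments
U_j - U_(j-1).  Comparing the convex kernel (w - s)^(-alpha) with its tangents shows that these
coefficients are positive and nondecreasing in j, which is a discrete maximum principle.  The only
possible exception, the second coefficient (the ratio tau_2/tau_1 may be small), is repaired by
estimating the first two errors directly.

The truncation error is O((t_1/t_m)^q), q = min(alpha + 1, (3 - alpha)/r): interpolation errors on the
inner intervals are integrated by parts against the kernel, and on the last interval w is such that
s - (t_(m-1) + t_m)/2 is orthogonal to the kernel.

For q <= alpha the barrier t^(alpha - q) needs only the monotonicity of the coefficients.  For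
q > alpha use V_p(s) = p (s + p)^(alpha - 1) for s > 0, with V_p(0) = 0.  The jump at 0 makes its
Riemann-Liouville derivative the positive multiple p^(alpha + 1) s^(-alpha) / (s + p) of 1/Gamma(1 - alpha),
and for p >= L t_1 with L large the truncation error of V_p is at most half of that, since V_p varies on
the scale s + p >= p.  Superposing V_p over the scales p = 2^k L t_1 up to t_m gives a barrier for the rate
(t_1/t)^q; the resulting geometric sum over k produces the three cases of the error bound.
*)
theory Submission
  imports Defs
begin

section \<open>Discrete comparison principle\<close>

text \<open>Of the quasi-grading the locales keep only that \<open>mesh_step\<close> is comparable
  to \<open>grading\<close> and that neighbouring nodes have bounded ratio. Every constant is
  therefore a function of alpha, \<open>r\<close>, \<open>K\<close> and the derivative bounds, and
  \<open>M\<close> enters only at the end through t_1 <= K M^(-r). The exponent alpha + 1 in the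
  truncation order stems from the first interval, where \<open>u\<close> is only known to be Hoelder
  continuous of order alpha; (3 - alpha)/r stems from the intervals where the third derivative is
  controlled. The repair of the second coefficient costs a multiple of (t_1/t_m)^(alpha + 1), so it
  never worsens this order. In the superposition the scale p carries the weight p^(-q). Positivity
  at level m is drawn from one scale comparable to t_m, where the rate of V_p is at least 1/2 and
  the weight is comparable to t_m^(-q). The value at t_n is t_1 t_n^(alpha - 1) times a geometric
  sum of ratio 2^(1 - q).\<close>

lemma summation_by_parts:
  fixes g V :: "nat \<Rightarrow> real"
  assumes "1 \<le> m"
  shows "(\<Sum>j=1..m. g j * (V j - V (j - 1))) =
         g m * V m - g 1 * V 0 - (\<Sum>j=1..<m. (g (Suc j) - g j) * V j)"
  using assms
proof (induction m rule: nat_induct_at_least)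
  case base
  then show ?case by (simp add: algebra_simps)
next
  case (Suc n)
  then show ?case by (simp add: algebra_simps)
qed

text \<open>Summation by parts expresses \<open>g m m * V m\<close> as the given sum plus
  \<open>g m 1 * V 0\<close> plus earlier values of \<open>V\<close> weighted by
  \<open>g m (Suc j) - g m j\<close>. All these weights are nonnegative, so the sign passes from the
  earlier levels to level \<open>m\<close>.\<close>

lemma discrete_comparison:
  fixes g :: "nat \<Rightarrow> nat \<Rightarrow> real" and V :: "nat \<Rightarrow> real"
  assumes mono: "\<And>m j. \<lbrakk>m \<in> {1..n}; 1 \<le> j; j < m\<rbrakk> \<Longrightarrow> g m j \<le> g m (Suc j)"
    and pos: "\<And>m. m \<in> {1..n} \<Longrightarrow> 0 < g m 1"
    and V0: "0 \<le> V 0"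
    and super: "\<And>m. m \<in> {1..n} \<Longrightarrow> 0 \<le> (\<Sum>j=1..m. g m j * (V j - V (j - 1)))"
    and "m \<le> n"
  shows "0 \<le> V m"
  using \<open>m \<le> n\<close>
proof (induction m rule: less_induct)
  case (less m)
  show ?case
  proof (cases "m = 0")
    case False
    then have m: "1 \<le> m" "m \<in> {1..n}" using less.prems by auto
    have "g m 1 \<le> g m j" if "1 \<le> j" "j \<le> m" for j
      using that
    proof (induction j rule: nat_induct_at_least)
      case (Suc k)
      then show ?case using mono[of m k] m by force
    qed simp
    then have gm: "0 < g m m" using pos[OF m(2)] m(1) by force
    have s: "0 \<le> (\<Sum>j=1..<m. (g m (Suc j) - g m j) * V j)"
      using less mono[OF m(2)] by (intro sum_nonneg mult_nonneg_nonneg) auto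
    have "0 \<le> g m m * V m - g m 1 * V 0 - (\<Sum>j=1..<m. (g m (Suc j) - g m j) * V j)"
      using super[OF m(2)] summation_by_parts[OF m(1), of "g m" V] by simp
    then have "0 \<le> g m m * V m"
      using s mult_nonneg_nonneg[of "g m 1" "V 0"] V0 pos[OF m(2)] by linarith
    then show ?thesis using gm by (simp add: zero_le_mult_iff)
  qed (use V0 in simp)
qed

section \<open>The convolution kernel and its increments\<close>

definition ker :: "real \<Rightarrow> real \<Rightarrow> real \<Rightarrow> real" where
  "ker \<alpha> w s = (w - s) powr (- \<alpha>)"

lemma ker_deriv:
  assumes "s < w"
  shows "(ker \<alpha> w has_real_derivative \<alpha> * (w - s) powr (- \<alpha> - 1)) (at s within S)"
  unfolding ker_def using assms by (auto intro!: derivative_eq_intros)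

lemma ker_continuous_on: "b < w \<Longrightarrow> continuous_on {a..b} (ker \<alpha> w)"
  unfolding ker_def by (intro continuous_intros) auto

lemma ker_pos: "s < w \<Longrightarrow> 0 < ker \<alpha> w s"
  by (simp add: ker_def)

lemma ker_mono: "0 \<le> \<alpha> \<Longrightarrow> s \<le> s' \<Longrightarrow> s' < w \<Longrightarrow> ker \<alpha> w s \<le> ker \<alpha> w s'"
  unfolding ker_def by (intro powr_mono2') auto

text \<open>The kernel is convex: its slope grows with \<open>s\<close>, so the slope at the left
  end \<open>a\<close> bounds increments from below. In \<open>ker_diff_le\<close> the slope at the
  right end \<open>b\<close> bounds them from above.\<close>

lemma ker_diff_ge:
  assumes "0 \<le> \<alpha>" "a \<le> s" "s \<le> s'" "s' < w"
  shows "\<alpha> * (w - a) powr (- \<alpha> - 1) * (s' - s) \<le> ker \<alpha> w s' - ker \<alpha> w s"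
proof -
  define d where "d = \<alpha> * (w - a) powr (- \<alpha> - 1)"
  have "ker \<alpha> w s - d * s \<le> ker \<alpha> w s' - d * s'"
  proof (rule DERIV_nonneg_imp_nondecreasing[OF assms(3)])
    fix x assume x: "s \<le> x" "x \<le> s'"
    have "((\<lambda>x. ker \<alpha> w x - d * x) has_real_derivative \<alpha> * (w - x) powr (- \<alpha> - 1) - d) (at x)"
      using x assms by (auto intro!: derivative_eq_intros ker_deriv)
    moreover have "d \<le> \<alpha> * (w - x) powr (- \<alpha> - 1)"
      unfolding d_def using x assms by (intro mult_left_mono powr_mono2') auto
    ultimately show "\<exists>y. ((\<lambda>x. ker \<alpha> w x - d * x) has_real_derivative y) (at x) \<and> 0 \<le> y"
      by (intro exI[of _ "\<alpha> * (w - x) powr (- \<alpha> - 1) - d"]) auto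
  qed
  then show ?thesis by (simp add: d_def algebra_simps)
qed

lemma ker_diff_le:
  assumes "0 \<le> \<alpha>" "s \<le> s'" "s' \<le> b" "b < w"
  shows "ker \<alpha> w s' - ker \<alpha> w s \<le> \<alpha> * (w - b) powr (- \<alpha> - 1) * (s' - s)"
proof -
  define d where "d = \<alpha> * (w - b) powr (- \<alpha> - 1)"
  have "d * s - ker \<alpha> w s \<le> d * s' - ker \<alpha> w s'"
  proof (rule DERIV_nonneg_imp_nondecreasing[OF assms(2)])
    fix x assume x: "s \<le> x" "x \<le> s'"
    have "((\<lambda>x. d * x - ker \<alpha> w x) has_real_derivative d - \<alpha> * (w - x) powr (- \<alpha> - 1)) (at x)"
      using x assms by (auto intro!: derivative_eq_intros ker_deriv)
    moreover have "\<alpha> * (w - x) powr (- \<alpha> - 1) \<le> d"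
      unfolding d_def using x assms by (intro mult_left_mono powr_mono2') auto
    ultimately show "\<exists>y. ((\<lambda>x. d * x - ker \<alpha> w x) has_real_derivative y) (at x) \<and> 0 \<le> y"
      by (intro exI[of _ "d - \<alpha> * (w - x) powr (- \<alpha> - 1)"]) auto
  qed
  then show ?thesis by (simp add: d_def algebra_simps)
qed

section \<open>Moments of the kernel against the centred weight 2 s - a - b\<close>

lemma has_integral_moment0:
  fixes a b :: real
  assumes "a \<le> b"
  shows "((\<lambda>s. 2 * s - a - b) has_integral 0) {a..b}"
proof -
  have "((\<lambda>s. 2 * s - a - b) has_integral (b\<^sup>2 - (a + b) * b) - (a\<^sup>2 - (a + b) * a)) {a..b}"
    using assms by (intro fundamental_theorem_of_calculus)
      (auto intro!: derivative_eq_intros simp flip: has_real_derivative_iff_has_vector_derivative)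
  then show ?thesis by (simp add: algebra_simps power2_eq_square)
qed

lemma has_integral_moment1:
  fixes a b :: real
  assumes "a \<le> b"
  shows "((\<lambda>s. s * (2 * s - a - b)) has_integral (b - a) ^ 3 / 6) {a..b}"
proof -
  have "((\<lambda>s. s * (2 * s - a - b)) has_integral
      (2 / 3 * b ^ 3 - (a + b) * b\<^sup>2 / 2) - (2 / 3 * a ^ 3 - (a + b) * a\<^sup>2 / 2)) {a..b}"
    using assms by (intro fundamental_theorem_of_calculus)
      (auto intro!: derivative_eq_intros simp: algebra_simps power2_eq_square
        simp flip: has_real_derivative_iff_has_vector_derivative)
  moreover have "(2 / 3 * b ^ 3 - (a + b) * b\<^sup>2 / 2) - (2 / 3 * a ^ 3 - (a + b) * a\<^sup>2 / 2) = (b - a) ^ 3 / 6"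
    by (simp add: field_simps power2_eq_square power3_eq_cube)
  ultimately show ?thesis by (simp only:)
qed

text \<open>The weight has mean zero, so the midpoint value of \<open>h\<close> may be subtracted
  from \<open>h\<close>; by monotonicity both factors then have the same sign. The weight is the
  derivative of (s - a)(s - b), the last term of a quadratic Newton interpolant.\<close>

lemma integral_moment_nonneg:
  fixes h :: "real \<Rightarrow> real"
  assumes "a \<le> b" "continuous_on {a..b} h" "\<And>x y. \<lbrakk>a \<le> x; x \<le> y; y \<le> b\<rbrakk> \<Longrightarrow> h x \<le> h y"
  shows "0 \<le> integral {a..b} (\<lambda>s. h s * (2 * s - a - b))"
proof -
  have "((\<lambda>s. h ((a + b) / 2) * (2 * s - a - b)) has_integral h ((a + b) / 2) * 0) {a..b}"
    by (intro has_integral_mult_right has_integral_moment0 assms)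
  moreover have "((\<lambda>s. h s * (2 * s - a - b)) has_integral integral {a..b} (\<lambda>s. h s * (2 * s - a - b))) {a..b}"
    by (intro integrable_integral integrable_continuous_interval continuous_intros assms)
  moreover have "h ((a + b) / 2) * (2 * s - a - b) \<le> h s * (2 * s - a - b)" if "s \<in> {a..b}" for s
  proof (cases "2 * s \<le> a + b")
    case True
    then have "h s \<le> h ((a + b) / 2)" using that by (intro assms) auto
    then show ?thesis using True by (intro mult_right_mono_neg) auto
  next
    case False
    then have "h ((a + b) / 2) \<le> h s" using that by (intro assms) auto
    then show ?thesis using False by (intro mult_right_mono) auto
  qed
  ultimately have "h ((a + b) / 2) * 0 \<le> integral {a..b} (\<lambda>s. h s * (2 * s - a - b))"
    by (rule has_integral_le)
  then show ?thesis by simp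
qed

text \<open>By \<open>ker_diff_ge\<close> the kernel remains nondecreasing after the line of slope
  \<open>d\<close> is subtracted. That line has the moment d (b - a)^3 / 6.\<close>

lemma ker_moment_ge:
  assumes "0 \<le> \<alpha>" "a \<le> b" "b < w"
  shows "\<alpha> * (w - a) powr (- \<alpha> - 1) * ((b - a) ^ 3 / 6)
           \<le> integral {a..b} (\<lambda>s. ker \<alpha> w s * (2 * s - a - b))"
proof -
  define d where "d = \<alpha> * (w - a) powr (- \<alpha> - 1)"
  have "0 \<le> integral {a..b} (\<lambda>s. (ker \<alpha> w s - d * s) * (2 * s - a - b))"
  proof (rule integral_moment_nonneg)
    fix x y assume "a \<le> x" "x \<le> y" "y \<le> b"
    then show "ker \<alpha> w x - d * x \<le> ker \<alpha> w y - d * y"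
      using ker_diff_ge[of \<alpha> a x y w] assms by (auto simp: d_def algebra_simps)
  qed (intro continuous_intros ker_continuous_on assms)+
  also have "\<dots> = integral {a..b} (\<lambda>s. ker \<alpha> w s * (2 * s - a - b)) - d * ((b - a) ^ 3 / 6)"
  proof (rule integral_unique)
    have "((\<lambda>s. ker \<alpha> w s * (2 * s - a - b) - d * (s * (2 * s - a - b))) has_integral
        integral {a..b} (\<lambda>s. ker \<alpha> w s * (2 * s - a - b)) - d * ((b - a) ^ 3 / 6)) {a..b}"
      by (intro has_integral_diff has_integral_mult_right has_integral_moment1 assms
          integrable_integral integrable_continuous_interval continuous_intros ker_continuous_on)
    then show "((\<lambda>s. (ker \<alpha> w s - d * s) * (2 * s - a - b)) has_integral
        integral {a..b} (\<lambda>s. ker \<alpha> w s * (2 * s - a - b)) - d * ((b - a) ^ 3 / 6)) {a..b}"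
      by (simp add: algebra_simps)
  qed
  finally show ?thesis by (simp add: d_def)
qed

lemma ker_moment_le:
  assumes "0 \<le> \<alpha>" "a \<le> b" "b < w"
  shows "integral {a..b} (\<lambda>s. ker \<alpha> w s * (2 * s - a - b))
           \<le> \<alpha> * (w - b) powr (- \<alpha> - 1) * ((b - a) ^ 3 / 6)"
proof -
  define d where "d = \<alpha> * (w - b) powr (- \<alpha> - 1)"
  have "0 \<le> integral {a..b} (\<lambda>s. (d * s - ker \<alpha> w s) * (2 * s - a - b))"
  proof (rule integral_moment_nonneg)
    fix x y assume "a \<le> x" "x \<le> y" "y \<le> b"
    then show "d * x - ker \<alpha> w x \<le> d * y - ker \<alpha> w y"
      using ker_diff_le[of \<alpha> x y b w] assms by (auto simp: d_def algebra_simps)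
  qed (intro continuous_intros ker_continuous_on assms)+
  also have "\<dots> = d * ((b - a) ^ 3 / 6) - integral {a..b} (\<lambda>s. ker \<alpha> w s * (2 * s - a - b))"
  proof (rule integral_unique)
    have "((\<lambda>s. d * (s * (2 * s - a - b)) - ker \<alpha> w s * (2 * s - a - b)) has_integral
        d * ((b - a) ^ 3 / 6) - integral {a..b} (\<lambda>s. ker \<alpha> w s * (2 * s - a - b))) {a..b}"
      by (intro has_integral_diff has_integral_mult_right has_integral_moment1 assms
          integrable_integral integrable_continuous_interval continuous_intros ker_continuous_on)
    then show "((\<lambda>s. (d * s - ker \<alpha> w s) * (2 * s - a - b)) has_integral
        d * ((b - a) ^ 3 / 6) - integral {a..b} (\<lambda>s. ker \<alpha> w s * (2 * s - a - b))) {a..b}"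
      by (simp add: algebra_simps)
  qed
  finally show ?thesis by (simp add: d_def)
qed

section \<open>Coefficients of the Alikhanov operator\<close>

lemma has_integral_ker_singular:
  assumes "0 < \<alpha>" "\<alpha> < 1" "a < w"
  shows "(ker \<alpha> w has_integral (w - a) powr (1 - \<alpha>) / (1 - \<alpha>)) {a..w}"
proof -
  have "(ker \<alpha> w has_integral - ((w - w) powr (1 - \<alpha>) / (1 - \<alpha>)) - (- ((w - a) powr (1 - \<alpha>) / (1 - \<alpha>)))) {a..w}"
  proof (rule fundamental_theorem_of_calculus_interior)
    show "continuous_on {a..w} (\<lambda>s. - ((w - s) powr (1 - \<alpha>) / (1 - \<alpha>)))"
      using assms
      by (intro continuous_on_minus continuous_on_divide continuous_on_powr' continuous_intros ballI) auto
    fix s assume "s \<in> {a<..<w}"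
    then have "((\<lambda>s. - ((w - s) powr (1 - \<alpha>) / (1 - \<alpha>))) has_real_derivative ker \<alpha> w s) (at s)"
      using assms by (auto intro!: derivative_eq_intros simp: ker_def)
    then show "((\<lambda>s. - ((w - s) powr (1 - \<alpha>) / (1 - \<alpha>))) has_vector_derivative ker \<alpha> w s) (at s)"
      by (simp add: has_real_derivative_iff_has_vector_derivative)
  qed (use assms in auto)
  then show ?thesis by simp
qed

definition alik_mass :: "real \<Rightarrow> (nat \<Rightarrow> real) \<Rightarrow> nat \<Rightarrow> nat \<Rightarrow> real" where
  "alik_mass \<alpha> t m j =
     integral {t (j - 1)..if j < m then t j else t_star \<alpha> t m} (ker \<alpha> (t_star \<alpha> t m))"

text \<open>The contribution of the quadratic Newton term on interval \<open>j\<close>. The value 0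
  at \<open>j = 0\<close> and at \<open>j = m\<close>, where the interpolant is linear, frees the
  index shift in \<open>sum_slope_integrals\<close> from boundary terms.\<close>

definition alik_moment :: "real \<Rightarrow> (nat \<Rightarrow> real) \<Rightarrow> nat \<Rightarrow> nat \<Rightarrow> real" where
  "alik_moment \<alpha> t m j =
     (if 1 \<le> j \<and> j < m
      then integral {t (j - 1)..t j} (\<lambda>s. ker \<alpha> (t_star \<alpha> t m) s * (2 * s - t (j - 1) - t j))
             / (t (Suc j) - t (j - 1))
      else 0)"

text \<open>The difference quotient of index \<open>j\<close> occurs in the interpolant on interval
  \<open>j\<close>, with weight mass minus moment, and in the one on interval \<open>j - 1\<close>,
  with weight \<open>alik_moment \<alpha> t m (j - 1)\<close>. Division by the step turns quotients
  into increments.\<close>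

definition alik_coef :: "real \<Rightarrow> (nat \<Rightarrow> real) \<Rightarrow> nat \<Rightarrow> nat \<Rightarrow> real" where
  "alik_coef \<alpha> t m j =
     (alik_mass \<alpha> t m j - alik_moment \<alpha> t m j + alik_moment \<alpha> t m (j - 1)) / mesh_step t j"

text \<open>A single time level. Only the nodes up to \<open>t m\<close> are ordered, because the
  operator at level \<open>m\<close> sees no others.\<close>

locale alikhanov_mesh =
  fixes \<alpha> :: real and t :: "nat \<Rightarrow> real" and m :: nat
  assumes \<alpha>: "0 < \<alpha>" "\<alpha> < 1" and t0: "t 0 = 0" and m1: "1 \<le> m"
    and step_pos': "\<And>j. \<lbrakk>1 \<le> j; j \<le> m\<rbrakk> \<Longrightarrow> t (j - 1) < t j"
begin

abbreviation "w \<equiv> t_star \<alpha> t m"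

lemma step_pos: "1 \<le> j \<Longrightarrow> j \<le> m \<Longrightarrow> 0 < mesh_step t j"
  using step_pos' by (simp add: mesh_step_def)

lemma node_strict_mono: "i < j \<Longrightarrow> j \<le> m \<Longrightarrow> t i < t j"
proof (induction j)
  case (Suc j)
  then show ?case using step_pos'[of "Suc j"] by (cases "i = j") auto
qed simp

lemma node_mono: "i \<le> j \<Longrightarrow> j \<le> m \<Longrightarrow> t i \<le> t j"
  using node_strict_mono[of i j] by (cases "i = j") auto

lemma star_minus: "w - t (m - 1) = (1 - \<alpha> / 2) * mesh_step t m"
  by (simp add: t_star_def mesh_step_def algebra_simps)

lemma star_gt: "t (m - 1) < w"
proof -
  have "0 < (1 - \<alpha> / 2) * mesh_step t m"
    using step_pos[of m] m1 \<alpha> by (intro mult_pos_pos) auto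
  then show ?thesis using star_minus by linarith
qed

lemma star_le: "w \<le> t m"
  using step_pos[of m] m1 \<alpha> by (simp add: t_star_def)

lemma star_ge_half: "t m / 2 \<le> w"
proof -
  have "\<alpha> * mesh_step t m \<le> 1 * mesh_step t m"
    using step_pos[of m] m1 \<alpha> by (intro mult_right_mono) auto
  moreover have "0 \<le> t (m - 1)" using node_mono[of 0 "m - 1"] t0 by simp
  ultimately show ?thesis by (simp add: t_star_def mesh_step_def)
qed

lemma node_lt_star: "j < m \<Longrightarrow> t j < w"
  using node_mono[of j "m - 1"] star_gt by linarith

lemma star_pos: "0 < w"
  using node_lt_star[of 0] m1 t0 by simp

lemma ker_integrable: "j < m \<Longrightarrow> ker \<alpha> w integrable_on {a..t j}"
  by (intro integrable_continuous_interval ker_continuous_on node_lt_star)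

lemma step_eq: "mesh_step t j = t j - t (j - 1)" by (simp add: mesh_step_def)

text \<open>To the left of t_j the kernel falls at least as fast as its slope \<open>d\<close> at
  t_(j-1), so it lies below the line of slope \<open>d\<close> through its value at t_j. Integrating
  that line yields the quadratic correction that \<open>coef_mono\<close> exploits.\<close>

lemma mass_le_tangent:
  assumes "1 \<le> j" "j < m"
  defines "d \<equiv> \<alpha> * (w - t (j - 1)) powr (- \<alpha> - 1)"
  shows "alik_mass \<alpha> t m j \<le> ker \<alpha> w (t j) * mesh_step t j - d * (mesh_step t j)\<^sup>2 / 2"
proof -
  have le: "t (j - 1) \<le> t j" using node_mono assms by simp
  have upper: "((\<lambda>s. ker \<alpha> w (t j) - d * (t j - s)) has_integral
     (ker \<alpha> w (t j) * t j + d * (t j - t j)\<^sup>2 / 2) -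
     (ker \<alpha> w (t j) * t (j - 1) + d * (t j - t (j - 1))\<^sup>2 / 2)) {t (j - 1)..t j}"
  proof (rule fundamental_theorem_of_calculus[OF le])
    fix s
    have "((\<lambda>s. ker \<alpha> w (t j) * s + d * (t j - s)\<^sup>2 / 2) has_real_derivative
        ker \<alpha> w (t j) - d * (t j - s)) (at s within {t (j - 1)..t j})"
      by (auto intro!: derivative_eq_intros) (simp add: algebra_simps)?
    then show "((\<lambda>s. ker \<alpha> w (t j) * s + d * (t j - s)\<^sup>2 / 2) has_vector_derivative
        ker \<alpha> w (t j) - d * (t j - s)) (at s within {t (j - 1)..t j})"
      by (simp add: has_real_derivative_iff_has_vector_derivative)
  qed
  have "(ker \<alpha> w has_integral alik_mass \<alpha> t m j) {t (j - 1)..t j}"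
    using ker_integrable[of j "t (j - 1)"] assms by (simp add: alik_mass_def integrable_integral)
  from this upper have "alik_mass \<alpha> t m j \<le>
     (ker \<alpha> w (t j) * t j + d * (t j - t j)\<^sup>2 / 2) -
     (ker \<alpha> w (t j) * t (j - 1) + d * (t j - t (j - 1))\<^sup>2 / 2)"
  proof (rule has_integral_le)
    show "ker \<alpha> w s \<le> ker \<alpha> w (t j) - d * (t j - s)" if "s \<in> {t (j - 1)..t j}" for s
    using ker_diff_ge[of \<alpha> "t (j - 1)" s "t j" w] that assms \<alpha> node_lt_star by (auto simp: d_def)
  qed
  then show ?thesis by (simp add: mesh_step_def algebra_simps)
qed

lemma moment_bounds:
  assumes "1 \<le> j" "j < m"
  shows "\<alpha> * (w - t (j - 1)) powr (- \<alpha> - 1) * ((mesh_step t j) ^ 3 / 6)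
           / (mesh_step t j + mesh_step t (Suc j)) \<le> alik_moment \<alpha> t m j"
    and "alik_moment \<alpha> t m j \<le> \<alpha> * (w - t j) powr (- \<alpha> - 1) * ((mesh_step t j) ^ 3 / 6)
           / (mesh_step t j + mesh_step t (Suc j))"
proof -
  have D: "mesh_step t j + mesh_step t (Suc j) = t (Suc j) - t (j - 1)" "0 < t (Suc j) - t (j - 1)"
    using node_strict_mono[of "j - 1" "Suc j"] assms by (auto simp: mesh_step_def)
  have le: "t (j - 1) \<le> t j" using node_mono assms by simp
  have eq: "alik_moment \<alpha> t m j =
      integral {t (j - 1)..t j} (\<lambda>s. ker \<alpha> w s * (2 * s - t (j - 1) - t j)) / (t (Suc j) - t (j - 1))"
    using assms by (simp add: alik_moment_def)
  show "\<alpha> * (w - t (j - 1)) powr (- \<alpha> - 1) * ((mesh_step t j) ^ 3 / 6)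
           / (mesh_step t j + mesh_step t (Suc j)) \<le> alik_moment \<alpha> t m j"
    unfolding eq D(1) unfolding step_eq[of j]
    using \<alpha> node_lt_star[of j] assms le D by (intro divide_right_mono ker_moment_ge) auto
  show "alik_moment \<alpha> t m j \<le> \<alpha> * (w - t j) powr (- \<alpha> - 1) * ((mesh_step t j) ^ 3 / 6)
           / (mesh_step t j + mesh_step t (Suc j))"
    unfolding eq D(1) unfolding step_eq[of j]
    using \<alpha> node_lt_star[of j] assms le D by (intro divide_right_mono ker_moment_le) auto
qed

lemma alik_moment_nonneg: "0 \<le> alik_moment \<alpha> t m j"
proof (cases "1 \<le> j \<and> j < m")
  case True
  then have "0 \<le> \<alpha> * (w - t (j - 1)) powr (- \<alpha> - 1) * ((mesh_step t j) ^ 3 / 6)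
           / (mesh_step t j + mesh_step t (Suc j))"
    using step_pos[of j] step_pos[of "Suc j"] \<alpha> by simp
  then show ?thesis using moment_bounds(1)[of j] True by linarith
qed (auto simp: alik_moment_def)

text \<open>For \<open>j < m\<close> the right side integrates the kernel against 1 - (2 s - a -
  b)/D. This weight is nonnegative, as 2 s - a - b <= b - a < D, and has total mass b - a, so the
  smallest kernel value factors out. For \<open>j = m\<close> the mass is explicit, and the step
  times 1 - alpha is at most \<open>w - t (m - 1)\<close>.\<close>

lemma mass_minus_moment_ge:
  assumes "1 \<le> j" "j \<le> m"
  shows "ker \<alpha> w (t (j - 1)) * mesh_step t j \<le> alik_mass \<alpha> t m j - alik_moment \<alpha> t m j"
proof (cases "j < m")
  case True
  define a b D where "a = t (j - 1)" and "b = t j" and "D = t (Suc j) - a"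
  have ab: "a < b" "b - a < D" using node_strict_mono[of "j - 1" j] node_strict_mono[of j "Suc j"] True assms
    by (auto simp: a_def b_def D_def)
  have bw: "b < w" using node_lt_star True by (simp add: b_def)
  have "((\<lambda>s. ker \<alpha> w a - ker \<alpha> w a / D * (2 * s - a - b)) has_integral
      (b - a) *\<^sub>R ker \<alpha> w a - ker \<alpha> w a / D * 0) {a..b}"
    using has_integral_const_real[of "ker \<alpha> w a" a b] ab
    by (intro has_integral_diff has_integral_mult_right has_integral_moment0) auto
  moreover have "((\<lambda>s. ker \<alpha> w s - ker \<alpha> w s * (2 * s - a - b) / D) has_integral
      integral {a..b} (ker \<alpha> w) - integral {a..b} (\<lambda>s. ker \<alpha> w s * (2 * s - a - b)) / D) {a..b}"
    using bw by (intro has_integral_diff has_integral_divide integrable_integral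
        integrable_continuous_interval continuous_intros ker_continuous_on)
  moreover have "ker \<alpha> w a - ker \<alpha> w a / D * (2 * s - a - b) \<le> ker \<alpha> w s - ker \<alpha> w s * (2 * s - a - b) / D"
    if s: "s \<in> {a..b}" for s
  proof -
    have "(2 * s - a - b) / D \<le> 1" using s ab by (simp add: divide_le_eq)
    then have "ker \<alpha> w a * (1 - (2 * s - a - b) / D) \<le> ker \<alpha> w s * (1 - (2 * s - a - b) / D)"
      using ker_mono[of \<alpha> a s w] s bw \<alpha> by (intro mult_right_mono) auto
    then show ?thesis by (simp add: algebra_simps)
  qed
  ultimately have "(b - a) *\<^sub>R ker \<alpha> w a - ker \<alpha> w a / D * 0 \<le>
      integral {a..b} (ker \<alpha> w) - integral {a..b} (\<lambda>s. ker \<alpha> w s * (2 * s - a - b)) / D"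
    by (rule has_integral_le)
  then show ?thesis using True assms
    by (simp add: alik_mass_def alik_moment_def mesh_step_def a_def b_def D_def mult.commute)
next
  case False
  then have jm: "j = m" using assms by simp
  have p: "0 < w - t (m - 1)" using star_gt by simp
  have "(1 - \<alpha>) * mesh_step t m \<le> w - t (m - 1)"
    unfolding star_minus using \<alpha> step_pos[of m] m1 by (intro mult_right_mono) auto
  then have "mesh_step t m \<le> (w - t (m - 1)) / (1 - \<alpha>)"
    using \<alpha> by (simp add: field_simps)
  then have "ker \<alpha> w (t (m - 1)) * mesh_step t m \<le> ker \<alpha> w (t (m - 1)) * ((w - t (m - 1)) / (1 - \<alpha>))"
    by (intro mult_left_mono less_imp_le[OF ker_pos[OF star_gt]])
  also have "\<dots> = (w - t (m - 1)) powr (1 - \<alpha>) / (1 - \<alpha>)"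
    using p powr_add[of "w - t (m - 1)" "- \<alpha>" 1] by (simp add: ker_def)
  also have "\<dots> = alik_mass \<alpha> t m m"
    using integral_unique[OF has_integral_ker_singular[OF \<alpha> star_gt]] by (simp add: alik_mass_def)
  finally show ?thesis by (simp add: jm alik_moment_def)
qed

text \<open>This lower bound refers to the kernel at the left end of the interval, the upper bound
  \<open>coef_le\<close> to the right end. For neighbouring coefficients both fall on the same node
  and cancel, so \<open>coef_mono\<close> only compares correction terms.\<close>

lemma coef_ge:
  assumes "1 \<le> j" "j \<le> m"
  shows "ker \<alpha> w (t (j - 1)) + alik_moment \<alpha> t m (j - 1) / mesh_step t j \<le> alik_coef \<alpha> t m j"
proof -
  have y: "0 < mesh_step t j" using assms step_pos by simp
  have "ker \<alpha> w (t (j - 1)) \<le> (alik_mass \<alpha> t m j - alik_moment \<alpha> t m j) / mesh_step t j"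
    using mass_minus_moment_ge[OF assms] y by (simp add: pos_le_divide_eq)
  then show ?thesis by (simp add: alik_coef_def add_divide_distrib)
qed

lemma coef_le:
  assumes "1 \<le> j" "j < m"
  shows "alik_coef \<alpha> t m j \<le> ker \<alpha> w (t j)
      - \<alpha> * (w - t (j - 1)) powr (- \<alpha> - 1) * mesh_step t j / 2
      - alik_moment \<alpha> t m j / mesh_step t j + alik_moment \<alpha> t m (j - 1) / mesh_step t j"
proof -
  have y: "0 < mesh_step t j" using assms step_pos by simp
  have "alik_mass \<alpha> t m j \<le>
      (ker \<alpha> w (t j) - \<alpha> * (w - t (j - 1)) powr (- \<alpha> - 1) * mesh_step t j / 2) * mesh_step t j"
    using mass_le_tangent[OF assms] by (simp add: algebra_simps power2_eq_square)
  then have "alik_mass \<alpha> t m j / mesh_step t j \<le>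
      ker \<alpha> w (t j) - \<alpha> * (w - t (j - 1)) powr (- \<alpha> - 1) * mesh_step t j / 2"
    using y by (simp add: pos_divide_le_eq)
  then show ?thesis by (simp add: alik_coef_def add_divide_distrib diff_divide_distrib)
qed

lemma coef_ge_ker:
  assumes "1 \<le> j" "j \<le> m"
  shows "ker \<alpha> w (t (j - 1)) \<le> alik_coef \<alpha> t m j"
proof -
  have "0 \<le> alik_moment \<alpha> t m (j - 1) / mesh_step t j"
    using alik_moment_nonneg[of "j - 1"] step_pos[OF assms] by (intro divide_nonneg_pos)
  then show ?thesis using coef_ge[OF assms] by linarith
qed

lemma coef_first_ge: "w powr (- \<alpha>) \<le> alik_coef \<alpha> t m 1"
  using coef_ge_ker[of 1] m1 by (simp add: t0 ker_def)

lemma coef_le_ker: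
  assumes "1 \<le> j" "j < m"
  shows "alik_coef \<alpha> t m j \<le> ker \<alpha> w (t j) + alik_moment \<alpha> t m (j - 1) / mesh_step t j"
proof -
  have "0 \<le> alik_moment \<alpha> t m j / mesh_step t j"
    using alik_moment_nonneg[of j] step_pos[of j] assms by simp
  moreover have "0 \<le> \<alpha> * (w - t (j - 1)) powr (- \<alpha> - 1) * mesh_step t j / 2"
    using step_pos[of j] assms \<alpha> by simp
  ultimately show ?thesis using coef_le[OF assms] by linarith
qed

text \<open>The first coefficient inherits no moment from a previous interval and therefore lies
  below the kernel at t_1, while each later one exceeds the kernel at its own left end. This holds
  on every mesh.\<close>

lemma coef_first_le:
  assumes "2 \<le> j" "j \<le> m"
  shows "alik_coef \<alpha> t m 1 \<le> alik_coef \<alpha> t m j"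
proof -
  have "alik_coef \<alpha> t m 1 \<le> ker \<alpha> w (t 1)"
    using coef_le_ker[of 1] assms by (simp add: alik_moment_def)
  also have "\<dots> \<le> ker \<alpha> w (t (j - 1))"
    using assms \<alpha> by (intro ker_mono node_mono node_lt_star) auto
  also have "\<dots> \<le> alik_coef \<alpha> t m j" using coef_ge_ker assms by simp
  finally show ?thesis .
qed

text \<open>The moment inherited from interval 1 is the only term that can break the order of these
  two coefficients. Its size is the price of the repair in \<open>adj_excess_le\<close>.\<close>

lemma coef_second_third:
  assumes "3 \<le> m"
  shows "alik_coef \<alpha> t m 2 - alik_coef \<alpha> t m 3 \<le>
      \<alpha> * (w - t 1) powr (- \<alpha> - 1) * ((mesh_step t 1) ^ 3 / 6)
        / (mesh_step t 1 + mesh_step t 2) / mesh_step t 2"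
proof -
  have "alik_coef \<alpha> t m 2 - alik_coef \<alpha> t m 3 \<le> alik_moment \<alpha> t m 1 / mesh_step t 2"
    using coef_le_ker[of 2] coef_ge_ker[of 3] assms by simp
  also have "\<dots> \<le> \<alpha> * (w - t 1) powr (- \<alpha> - 1) * ((mesh_step t 1) ^ 3 / 6)
        / (mesh_step t 1 + mesh_step t 2) / mesh_step t 2"
    using moment_bounds(2)[of 1] assms step_pos[of 2]
    by (intro divide_right_mono) (auto simp: numeral_2_eq_2)
  finally show ?thesis .
qed

text \<open>The harmful term is the inherited moment C/y. Against it stand d y / 2, from convexity
  on interval \<open>j\<close>, and B/y + B/z, since the moment of interval \<open>j\<close> is lost
  by coefficient \<open>j\<close> and gained by the next one. Inserting the moment bounds and
  cancelling d/6 leaves exactly \<open>cond\<close>.\<close>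

lemma coef_mono:
  assumes "2 \<le> j" "j < m"
    and cond: "mesh_step t (j - 1) ^ 3 / (mesh_step t j * (mesh_step t (j - 1) + mesh_step t j))
       \<le> 3 * mesh_step t j + (mesh_step t j)\<^sup>2 / mesh_step t (Suc j)"
  shows "alik_coef \<alpha> t m j \<le> alik_coef \<alpha> t m (Suc j)"
proof -
  define x y z where "x = mesh_step t (j - 1)" and "y = mesh_step t j" and "z = mesh_step t (Suc j)"
  \<comment> \<open>The slope at the shared node t_(j-1) is the largest on interval j - 1 and the
    smallest on interval j, so the same \<open>d\<close> occurs in the upper bound for
    \<open>C\<close> and in the lower bound for \<open>B\<close>.\<close>
  define d where "d = \<alpha> * (w - t (j - 1)) powr (- \<alpha> - 1)"
  define B C where "B = alik_moment \<alpha> t m j" and "C = alik_moment \<alpha> t m (j - 1)"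
  have pos: "0 < x" "0 < y" "0 < z" "0 \<le> d"
    using step_pos[of "j - 1"] step_pos[of j] step_pos[of "Suc j"] assms \<alpha>
    by (auto simp: x_def y_def z_def d_def)
  have C: "C \<le> d * (x ^ 3 / 6) / (x + y)"
    using moment_bounds(2)[of "j - 1"] assms by (simp add: C_def d_def x_def y_def)
  have B: "d * (y ^ 3 / 6) / (y + z) \<le> B"
    using moment_bounds(1)[of j] assms by (simp add: B_def d_def z_def y_def)
  have "C / y \<le> d * (x ^ 3 / 6) / (x + y) / y"
    using C pos by (intro divide_right_mono) auto
  also have "\<dots> = d / 6 * (x ^ 3 / (y * (x + y)))" using pos by (simp add: field_simps)
  also have "\<dots> \<le> d / 6 * (3 * y + y\<^sup>2 / z)"
    using cond pos by (intro mult_left_mono) (auto simp: x_def y_def z_def)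
  also have "\<dots> = d * y / 2 + d * (y ^ 3 / 6) / (y + z) * ((y + z) / (y * z))"
  proof -
    have *: "A / h * (h / (y * z)) = A / (y * z)" if "0 < h" for A h :: real
      using that by simp
    have "d * (y ^ 3 / 6) / (y + z) * ((y + z) / (y * z)) = d * (y ^ 3 / 6) / (y * z)"
      using pos by (intro *) simp
    moreover have "d / 6 * (3 * y + y\<^sup>2 / z) = d * y / 2 + d * (y ^ 3 / 6) / (y * z)"
      using pos by (simp add: field_simps power2_eq_square power3_eq_cube)
    ultimately show ?thesis by (simp only:)
  qed
  also have "\<dots> \<le> d * y / 2 + B * ((y + z) / (y * z))"
    using B pos by (intro add_left_mono mult_right_mono) auto
  also have "B * ((y + z) / (y * z)) = B / y + B / z"
    using pos by (simp add: field_simps)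
  finally have "C / y \<le> d * y / 2 + (B / y + B / z)" .
  moreover have "ker \<alpha> w (t j) + B / z \<le> alik_coef \<alpha> t m (Suc j)"
    using coef_ge[of "Suc j"] assms by (simp add: B_def z_def)
  moreover have "alik_coef \<alpha> t m j \<le> ker \<alpha> w (t j) - d * y / 2 - B / y + C / y"
    using coef_le[of j] assms by (simp add: B_def C_def d_def y_def)
  ultimately show ?thesis by linarith
qed

end

section \<open>Mesh-ratio inequalities\<close>

lemma ratio_condition_four_sevenths:
  fixes x y z :: real
  assumes "0 < x" "0 < y" "0 < z" "4 / 7 \<le> y / x"
  shows "x ^ 3 / (y * (x + y)) \<le> 3 * y + y\<^sup>2 / z"
proof -
  have y: "4 / 7 * x \<le> y" using assms by (simp add: field_simps)
  \<comment> \<open>With rho = y/x the term 3 y alone dominates once 3 rho^2 (1 + rho) >= 1. At rho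
    = 4/7 the left side is 528/343.\<close>
  have "x ^ 3 \<le> 3 * ((4 / 7 * x) * (4 / 7 * x) * (x + 4 / 7 * x))"
    using assms by (simp add: power3_eq_cube)
  also have "\<dots> \<le> 3 * (y * y * (x + y))"
    using assms y by (intro mult_left_mono mult_mono add_mono) auto
  finally have "x ^ 3 \<le> 3 * y * (y * (x + y))"
    by (simp add: algebra_simps)
  then have "x ^ 3 / (y * (x + y)) \<le> 3 * y"
    using assms by (simp add: pos_divide_le_eq)
  then show ?thesis using assms by (simp add: add_increasing2)
qed

lemma ratio_condition_decreasing:
  fixes x y z :: real
  assumes "0 < x" "0 < y" "0 < z" "0.4656 \<le> z / y" "z / y \<le> y / x"
  shows "x ^ 3 / (y * (x + y)) \<le> 3 * y + y\<^sup>2 / z"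
proof -
  have "0.4656 \<le> y / x" using assms by linarith
  then have y: "0.4656 * x \<le> y" using assms by (simp add: field_simps)
  have xz: "x \<le> y\<^sup>2 / z" using assms by (simp add: field_simps power2_eq_square)
  \<comment> \<open>Decreasing ratios give x <= y^2/z, so (3 rho + 1) rho (1 + rho) >= 1 is enough.
    At rho = 0.4656 the left side is about 1.64.\<close>
  have "x ^ 3 \<le> (3 * (0.4656 * x) + x) * ((0.4656 * x) * (x + 0.4656 * x))"
    using assms by (simp add: power3_eq_cube)
  also have "\<dots> \<le> (3 * y + x) * (y * (x + y))"
    using assms y by (intro mult_mono add_mono mult_left_mono) auto
  finally have "x ^ 3 / (y * (x + y)) \<le> 3 * y + x"
    using assms by (simp add: pos_divide_le_eq)
  then show ?thesis using xz by linarith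
qed

section \<open>Newton form of the interpolant\<close>

definition diff_quot :: "(nat \<Rightarrow> real) \<Rightarrow> (nat \<Rightarrow> real) \<Rightarrow> nat \<Rightarrow> real" where
  "diff_quot t U j = (U j - U (j - 1)) / mesh_step t j"

text \<open>In this form the slope is affine in \<open>s\<close> with coefficients built from two
  neighbouring difference quotients, which is what leads to one coefficient per increment of
  \<open>U\<close>.\<close>

definition newton_poly :: "(nat \<Rightarrow> real) \<Rightarrow> nat \<Rightarrow> (nat \<Rightarrow> real) \<Rightarrow> nat \<Rightarrow> real \<Rightarrow> real" where
  "newton_poly t m U j s = U (j - 1) + diff_quot t U j * (s - t (j - 1)) +
     (if j < m then (s - t (j - 1)) * (s - t j) *
        ((diff_quot t U (Suc j) - diff_quot t U j) / (t (Suc j) - t (j - 1))) else 0)"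

definition newton_slope :: "(nat \<Rightarrow> real) \<Rightarrow> nat \<Rightarrow> (nat \<Rightarrow> real) \<Rightarrow> nat \<Rightarrow> real \<Rightarrow> real" where
  "newton_slope t m U j s = diff_quot t U j +
     (if j < m then (2 * s - t (j - 1) - t j) *
        ((diff_quot t U (Suc j) - diff_quot t U j) / (t (Suc j) - t (j - 1))) else 0)"

lemma newton_poly_deriv:
  "(newton_poly t m U j has_real_derivative newton_slope t m U j s) (at s within S)"
proof -
  have *: "((\<lambda>s. A + B * (s - x) + (s - x) * (s - y) * c) has_real_derivative B + (2 * s - x - y) * c)
      (at s within S)" for A B x y c :: real
    by (auto intro!: derivative_eq_intros simp: algebra_simps)
  have **: "((\<lambda>s. A + B * (s - x)) has_real_derivative B) (at s within S)" for A B x :: real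
    by (auto intro!: derivative_eq_intros)
  show ?thesis
  proof (cases "j < m")
    case True
    show ?thesis unfolding newton_poly_def newton_slope_def if_P[OF True] by (rule *)
  qed (use ** in \<open>simp add: newton_poly_def[abs_def] newton_slope_def\<close>)
qed

lemma newton_slope_deriv:
  "(newton_slope t m U j has_real_derivative
      (if j < m then 2 * ((diff_quot t U (Suc j) - diff_quot t U j) / (t (Suc j) - t (j - 1))) else 0))
     (at s within S)"
proof -
  have *: "((\<lambda>s. B + (2 * s - x - y) * c) has_real_derivative 2 * c) (at s within S)" for B x y c :: real
    by (auto intro!: derivative_eq_intros)
  show ?thesis
  proof (cases "j < m")
    case True
    show ?thesis unfolding newton_slope_def if_P[OF True] by (rule *)
  qed (simp add: newton_slope_def[abs_def])
qed

section \<open>Integration against the kernel and interpolation errors\<close>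

lemma has_integral_nodes:
  fixes f :: "real \<Rightarrow> real" and e :: "nat \<Rightarrow> real"
  assumes "\<And>j. \<lbrakk>1 \<le> j; j \<le> n\<rbrakk> \<Longrightarrow> e (j - 1) \<le> e j"
    and "\<And>j. \<lbrakk>1 \<le> j; j \<le> n\<rbrakk> \<Longrightarrow> (f has_integral I j) {e (j - 1)..e j}"
  shows "(f has_integral (\<Sum>j=1..n. I j)) {e 0..e n} \<and> e 0 \<le> e n"
  using assms
proof (induction n)
  case 0
  then show ?case by (simp add: has_integral_refl)
next
  case (Suc n)
  have 1: "(f has_integral (\<Sum>j=1..n. I j)) {e 0..e n}" "e 0 \<le> e n" using Suc by auto
  have 2: "(f has_integral I (Suc n)) {e n..e (Suc n)}" "e n \<le> e (Suc n)"
    using Suc.prems[of "Suc n"] by auto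
  show ?case using has_integral_combine[OF 1(2) 2(2) 1(1) 2(1)] 1(2) 2(2) by simp
qed

lemma sum_shift_boundary:
  fixes f :: "nat \<Rightarrow> real"
  shows "(\<Sum>j=1..n. f (Suc j)) + f 1 = (\<Sum>j=1..n. f j) + f (Suc n)"
  by (induction n) auto

text \<open>The boundary term at \<open>a\<close> vanishes, and the integral of \<open>e\<close>
  against the derivative of the kernel is at most \<open>E\<close> times the growth of the kernel.
  Since \<open>e'\<close> may blow up at an end point, as it does for the solution at 0,
  integrability is part of the conclusion.\<close>

lemma ker_by_parts:
  assumes \<alpha>: "0 \<le> \<alpha>" and ab: "a \<le> b" "b < w"
    and cont: "continuous_on {a..b} e"
    and der: "\<And>s. s \<in> {a<..<b} \<Longrightarrow> (e has_real_derivative e' s) (at s)"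
    and ea: "e a = 0" and E: "\<And>s. s \<in> {a..b} \<Longrightarrow> \<bar>e s\<bar> \<le> E"
  shows "\<exists>I. ((\<lambda>s. ker \<alpha> w s * e' s) has_integral I) {a..b} \<and>
           \<bar>I\<bar> \<le> \<bar>ker \<alpha> w b * e b\<bar> + E * (ker \<alpha> w b - ker \<alpha> w a)"
proof -
  define k' where "k' s = \<alpha> * (w - s) powr (- \<alpha> - 1)" for s
  have k'cont: "continuous_on {a..b} k'"
    unfolding k'_def using ab by (intro continuous_intros) auto
  have 1: "((\<lambda>s. k' s * e s + ker \<alpha> w s * e' s) has_integral ker \<alpha> w b * e b - ker \<alpha> w a * e a) {a..b}"
  proof (rule fundamental_theorem_of_calculus_interior[OF ab(1)])
    show "continuous_on {a..b} (\<lambda>s. ker \<alpha> w s * e s)"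
      using ab by (intro continuous_intros cont ker_continuous_on)
    fix s assume s: "s \<in> {a<..<b}"
    then have "((\<lambda>s. ker \<alpha> w s * e s) has_real_derivative k' s * e s + ker \<alpha> w s * e' s) (at s)"
      using ab unfolding k'_def
      by (auto intro!: derivative_eq_intros ker_deriv der simp: algebra_simps)
    then show "((\<lambda>s. ker \<alpha> w s * e s) has_vector_derivative k' s * e s + ker \<alpha> w s * e' s) (at s)"
      by (simp add: has_real_derivative_iff_has_vector_derivative)
  qed
  define J where "J = integral {a..b} (\<lambda>s. k' s * e s)"
  have J: "((\<lambda>s. k' s * e s) has_integral J) {a..b}"
    unfolding J_def
    by (intro integrable_integral integrable_continuous_interval continuous_intros k'cont cont)
  have k'int: "(k' has_integral ker \<alpha> w b - ker \<alpha> w a) {a..b}"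
    unfolding k'_def using ab
    by (intro fundamental_theorem_of_calculus)
       (auto intro!: ker_deriv simp flip: has_real_derivative_iff_has_vector_derivative)
  have bd: "\<bar>k' s * e s\<bar> \<le> E * k' s" if "s \<in> {a..b}" for s
  proof -
    have "0 \<le> k' s" using \<alpha> by (simp add: k'_def)
    then show ?thesis using mult_right_mono[OF E[OF that], of "k' s"] by (simp add: abs_mult mult.commute)
  qed
  have "J \<le> E * (ker \<alpha> w b - ker \<alpha> w a)"
    using bd by (intro has_integral_le[OF J has_integral_mult_right[OF k'int]]) (auto dest: abs_le_D1)
  moreover have "- J \<le> E * (ker \<alpha> w b - ker \<alpha> w a)"
    using bd by (intro has_integral_le[OF has_integral_neg[OF J] has_integral_mult_right[OF k'int]])
      (auto dest: abs_le_D2)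
  moreover have "((\<lambda>s. ker \<alpha> w s * e' s) has_integral ker \<alpha> w b * e b - J) {a..b}"
    using has_integral_diff[OF 1 J] ea by simp
  ultimately show ?thesis by (intro exI[of _ "ker \<alpha> w b * e b - J"]) auto
qed

text \<open>The kernel is singular at \<open>w\<close>, but its antiderivative Omega is continuous
  up to \<open>w\<close>. The product rule for Omega times \<open>g\<close> leaves only the
  continuous integrand Omega times \<open>g'\<close>.\<close>

lemma ker_mult_integrable:
  assumes \<alpha>: "0 < \<alpha>" "\<alpha> < 1" and aw: "a < w"
    and cont: "continuous_on {a..w} g" "continuous_on {a..w} g'"
    and der: "\<And>s. s \<in> {a<..<w} \<Longrightarrow> (g has_real_derivative g' s) (at s)"
  shows "(\<lambda>s. ker \<alpha> w s * g s) integrable_on {a..w}"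
proof -
  define \<Omega> where "\<Omega> s = - ((w - s) powr (1 - \<alpha>) / (1 - \<alpha>))" for s
  have \<Omega>: "continuous_on {a..w} \<Omega>"
    unfolding \<Omega>_def using \<alpha>
    by (intro continuous_on_minus continuous_on_divide continuous_on_powr' continuous_intros ballI) auto
  have 1: "((\<lambda>s. ker \<alpha> w s * g s + \<Omega> s * g' s) has_integral \<Omega> w * g w - \<Omega> a * g a) {a..w}"
  proof (rule fundamental_theorem_of_calculus_interior)
    show "continuous_on {a..w} (\<lambda>s. \<Omega> s * g s)" by (intro continuous_intros \<Omega> cont)
    fix s assume s: "s \<in> {a<..<w}"
    have "(\<Omega> has_real_derivative ker \<alpha> w s) (at s)"
      unfolding \<Omega>_def using \<alpha> s by (auto intro!: derivative_eq_intros simp: ker_def)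
    then have "((\<lambda>s. \<Omega> s * g s) has_real_derivative ker \<alpha> w s * g s + \<Omega> s * g' s) (at s)"
      using der[OF s] by (auto intro!: derivative_eq_intros simp: algebra_simps)
    then show "((\<lambda>s. \<Omega> s * g s) has_vector_derivative ker \<alpha> w s * g s + \<Omega> s * g' s) (at s)"
      by (simp add: has_real_derivative_iff_has_vector_derivative)
  qed (use aw in simp)
  have 2: "(\<lambda>s. \<Omega> s * g' s) integrable_on {a..w}"
    by (intro integrable_continuous_interval continuous_intros \<Omega> cont)
  show ?thesis
    using integrable_diff[OF has_integral_integrable[OF 1] 2] by simp
qed

lemma ker_mult_integral_bound:
  assumes \<alpha>: "0 < \<alpha>" "\<alpha> < 1" and aw: "a < w"
    and I: "((\<lambda>s. ker \<alpha> w s * g s) has_integral I) {a..w}"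
    and bd: "\<And>s. s \<in> {a..w} \<Longrightarrow> \<bar>g s\<bar> \<le> E"
  shows "\<bar>I\<bar> \<le> E * ((w - a) powr (1 - \<alpha>) / (1 - \<alpha>))"
proof -
  have k: "((\<lambda>s. E * ker \<alpha> w s) has_integral E * ((w - a) powr (1 - \<alpha>) / (1 - \<alpha>))) {a..w}"
    by (intro has_integral_mult_right has_integral_ker_singular assms)
  have bd': "\<bar>ker \<alpha> w s * g s\<bar> \<le> E * ker \<alpha> w s" if "s \<in> {a..w}" for s
  proof -
    have "0 \<le> ker \<alpha> w s" by (simp add: ker_def)
    then show ?thesis using bd[OF that] mult_right_mono[of "\<bar>g s\<bar>" E "ker \<alpha> w s"]
      by (simp add: abs_mult mult.commute)
  qed
  have "I \<le> E * ((w - a) powr (1 - \<alpha>) / (1 - \<alpha>))"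
    using bd' by (intro has_integral_le[OF I k]) (auto dest: abs_le_D1)
  moreover have "- I \<le> E * ((w - a) powr (1 - \<alpha>) / (1 - \<alpha>))"
    using bd' by (intro has_integral_le[OF has_integral_neg[OF I] k]) (auto dest: abs_le_D2)
  ultimately show ?thesis by linarith
qed

lemma mvt_abs_le:
  fixes g g' :: "real \<Rightarrow> real"
  assumes "continuous_on (closed_segment x y) g"
    and "\<And>z. z \<in> open_segment x y \<Longrightarrow> (g has_real_derivative g' z) (at z)"
    and "\<And>z. z \<in> open_segment x y \<Longrightarrow> \<bar>g' z\<bar> \<le> S"
  shows "\<bar>g x - g y\<bar> \<le> S * \<bar>x - y\<bar>"
proof -
  have *: "\<bar>g b - g a\<bar> \<le> S * (b - a)"
    if ab: "a < b" "continuous_on {a..b} g"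
      and der: "\<And>z. z \<in> {a<..<b} \<Longrightarrow> (g has_real_derivative g' z) (at z)"
      and bd: "\<And>z. z \<in> {a<..<b} \<Longrightarrow> \<bar>g' z\<bar> \<le> S" for a b
  proof -
    obtain z where z: "a < z" "z < b" "g b - g a = (b - a) * g' z"
      using mvt[OF ab, of "\<lambda>z. (*) (g' z)"] der
      by (auto simp: has_field_derivative_def mult.commute)
    then show ?thesis using bd[of z] ab(1) by (simp add: abs_mult mult.commute)
  qed
  consider "x < y" | "x = y" | "y < x" by linarith
  then show ?thesis
  proof cases
    case 1
    then show ?thesis using *[of x y] assms
      by (simp add: closed_segment_eq_real_ivl open_segment_eq_real_ivl abs_minus_commute)
  next
    case 3
    then show ?thesis using *[of y x] assms
      by (simp add: closed_segment_eq_real_ivl open_segment_eq_real_ivl abs_minus_commute)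
  qed simp
qed

text \<open>Rolle on the two intervals gives zeros of \<open>e1\<close>, and between them a zero of
  \<open>e2\<close>. Going back from the bound on \<open>e3\<close> through these zeros and the node
  \<open>a\<close> costs a factor c - a each time.\<close>

lemma quadratic_interp_error:
  fixes e e1 e2 e3 :: "real \<Rightarrow> real"
  assumes abc: "a < b" "b < c" and cont: "continuous_on {a..c} e"
    and d1: "\<And>s. s \<in> {a<..<c} \<Longrightarrow> (e has_real_derivative e1 s) (at s)"
    and d2: "\<And>s. s \<in> {a<..<c} \<Longrightarrow> (e1 has_real_derivative e2 s) (at s)"
    and d3: "\<And>s. s \<in> {a<..<c} \<Longrightarrow> (e2 has_real_derivative e3 s) (at s)"
    and S: "\<And>s. s \<in> {a<..<c} \<Longrightarrow> \<bar>e3 s\<bar> \<le> S"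
    and zero: "e a = 0" "e b = 0" "e c = 0" and x: "x \<in> {a..b}"
  shows "\<bar>e x\<bar> \<le> S * (c - a) ^ 3"
proof -
  have rolle: "\<exists>z. p < z \<and> z < q \<and> g' z = 0"
    if pq: "p < q" "continuous_on {p..q} g" "g p = g q"
      and der: "\<And>z. z \<in> {p<..<q} \<Longrightarrow> (g has_real_derivative g' z) (at z)" for p q and g g' :: "real \<Rightarrow> real"
  proof -
    obtain z where "p < z" "z < q" "(g has_real_derivative 0) (at z)"
      using Rolle[OF pq(1,3,2)] der by (auto simp: real_differentiable_def)
    then show ?thesis using der[of z] DERIV_unique by force
  qed
  have S0: "0 \<le> S" using S[of b] abc by force
  have cont1: "continuous_on T e1" if "T \<subseteq> {a<..<c}" for T
    using d2 that by (meson DERIV_continuous_on has_field_derivative_at_within subsetD)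
  have cont2: "continuous_on T e2" if "T \<subseteq> {a<..<c}" for T
    using d3 that by (meson DERIV_continuous_on has_field_derivative_at_within subsetD)
  obtain p where p: "a < p" "p < b" "e1 p = 0"
    using rolle[of a b e e1] abc zero d1 continuous_on_subset[OF cont, of "{a..b}"] by auto
  obtain q where q: "b < q" "q < c" "e1 q = 0"
    using rolle[of b c e e1] abc zero d1 continuous_on_subset[OF cont, of "{b..c}"] by auto
  obtain r where r: "p < r" "r < q" "e2 r = 0"
  proof -
    have "{p..q} \<subseteq> {a<..<c}" using p q by auto
    then show thesis using that rolle[of p q e1 e2] p q d2 cont1[of "{p..q}"] by force
  qed
  have b2: "\<bar>e2 s\<bar> \<le> S * (c - a)" if s: "s \<in> {a<..<c}" for s
  proof -
    have sub: "closed_segment s r \<subseteq> {a<..<c}" "open_segment s r \<subseteq> {a<..<c}"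
      using s p q r by (auto simp: closed_segment_eq_real_ivl open_segment_eq_real_ivl split: if_splits)
    have "\<bar>e2 s - e2 r\<bar> \<le> S * \<bar>s - r\<bar>"
      using sub by (intro mvt_abs_le[where g' = e3] cont2 d3 S) auto
    also have "\<dots> \<le> S * (c - a)" using s p q r S0 by (intro mult_left_mono) auto
    finally show ?thesis using r by simp
  qed
  have b1: "\<bar>e1 s\<bar> \<le> S * (c - a) * (c - a)" if s: "s \<in> {a<..<c}" for s
  proof -
    have sub: "closed_segment s p \<subseteq> {a<..<c}" "open_segment s p \<subseteq> {a<..<c}"
      using s p abc by (auto simp: closed_segment_eq_real_ivl open_segment_eq_real_ivl split: if_splits)
    have "\<bar>e1 s - e1 p\<bar> \<le> S * (c - a) * \<bar>s - p\<bar>"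
      using sub by (intro mvt_abs_le[where g' = e2] cont1 d2 b2) auto
    also have "\<dots> \<le> S * (c - a) * (c - a)" using s p abc S0 by (intro mult_left_mono) auto
    finally show ?thesis using p by simp
  qed
  have "\<bar>e x - e a\<bar> \<le> S * (c - a) * (c - a) * \<bar>x - a\<bar>"
  proof (rule mvt_abs_le[where g' = e1])
    show "continuous_on (closed_segment x a) e"
      using x abc by (intro continuous_on_subset[OF cont]) (auto simp: closed_segment_eq_real_ivl)
    fix z assume "z \<in> open_segment x a"
    then have "z \<in> {a<..<c}" using x abc by (auto simp: open_segment_eq_real_ivl split: if_splits)
    then show "(e has_real_derivative e1 z) (at z)" "\<bar>e1 z\<bar> \<le> S * (c - a) * (c - a)"
      using d1 b1 by auto
  qed
  also have "\<dots> \<le> S * (c - a) * (c - a) * (c - a)" using x abc S0 by (intro mult_left_mono) auto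
  finally show ?thesis using zero by (simp add: power3_eq_cube mult.assoc)
qed

section \<open>Representation and local truncation errors\<close>

text \<open>Coordinates relative to the left node: \<open>y\<close> is the offset of the point,
  \<open>h\<close> and \<open>k\<close> are the two steps, and \<open>u\<close>, \<open>v\<close>,
  \<open>z\<close> are the nodal values.\<close>

lemma lagrange_quadratic_newton:
  fixes h k y u v z :: real
  assumes "0 < h" "0 < k"
  shows "u * ((y - h) * (y - h - k) / (h * (h + k))) - v * (y * (y - h - k) / (h * k))
           + z * (y * (y - h) / ((h + k) * k))
         = u + (v - u) / h * y + y * (y - h) * (((z - v) / k - (v - u) / h) / (h + k))"
proof -
  have nz: "h \<noteq> 0" "k \<noteq> 0" "h + k \<noteq> 0" using assms by auto
  show ?thesis
    using nz by (simp add: divide_simps) (simp add: algebra_simps)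
qed

definition alik_sum :: "real \<Rightarrow> (nat \<Rightarrow> real) \<Rightarrow> nat \<Rightarrow> (nat \<Rightarrow> real) \<Rightarrow> real" where
  "alik_sum \<alpha> t m U = (\<Sum>j=1..m. alik_coef \<alpha> t m j * (U j - U (j - 1)))"

context alikhanov_mesh
begin

abbreviation "node_end j \<equiv> (if j < m then t j else w)"

lemma node_end_gt: "1 \<le> j \<Longrightarrow> j \<le> m \<Longrightarrow> t (j - 1) < node_end j"
  using step_pos'[of j] star_gt by (cases "j = m") auto

lemma interp_quadratic_newton:
  assumes "1 \<le> j" "j < m"
  shows "interp_quadratic j t U s = newton_poly t m U j s"
proof -
  obtain i where i: "j = Suc i" using assms(1) by (cases j) auto
  define h k y where "h = t (Suc i) - t i" and "k = t (Suc (Suc i)) - t (Suc i)" and "y = s - t i"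
  have hk: "0 < h" "0 < k" using node_strict_mono[of i "Suc i"] node_strict_mono[of "Suc i" "Suc (Suc i)"] assms i
    by (auto simp: h_def k_def)
  have sets: "{i, Suc i, Suc (Suc i)} - {i} = {Suc i, Suc (Suc i)}"
    "{i, Suc i, Suc (Suc i)} - {Suc i} = {i, Suc (Suc i)}"
    "{i, Suc i, Suc (Suc i)} - {Suc (Suc i)} = {i, Suc i}" by auto
  have t: "t (Suc i) = t i + h" "t (Suc (Suc i)) = t i + h + k" "s = t i + y"
    by (auto simp: h_def k_def y_def)
  have "interp_quadratic j t U s =
      U i * ((y - h) / (- h) * ((y - h - k) / (- (h + k)))) +
      (U (Suc i) * (y / h * ((y - h - k) / (- k))) +
       U (Suc (Suc i)) * (y / (h + k) * ((y - h) / k)))"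
    by (simp add: interp_quadratic_def lagrange_interp_def i sets t algebra_simps del: minus_divide_left minus_divide_right divide_minus_left)
  also have "\<dots> = U i * ((y - h) * (y - h - k) / (h * (h + k))) - U (Suc i) * (y * (y - h - k) / (h * k))
           + U (Suc (Suc i)) * (y * (y - h) / ((h + k) * k))"
  proof -
    have 1: "(y - h) / (- h) * ((y - h - k) / (- (h + k))) = (y - h) * (y - h - k) / (h * (h + k))"
      by (simp only: times_divide_times_eq mult_minus_left mult_minus_right minus_minus)
    have 2: "y / h * ((y - h - k) / (- k)) = - (y * (y - h - k) / (h * k))" by simp
    have 3: "y / (h + k) * ((y - h) / k) = y * (y - h) / ((h + k) * k)" by simp
    show ?thesis unfolding 1 2 3 by simp
  qed
  also have "\<dots> = newton_poly t m U j s"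
    unfolding lagrange_quadratic_newton[OF hk]
    using assms by (simp add: newton_poly_def diff_quot_def mesh_step_def i t add.commute)
  finally show ?thesis .
qed

lemma interp_linear_newton: "interp_linear m t U s = newton_poly t m U m s"
proof -
  obtain i where i: "m = Suc i" using m1 by (cases m) auto
  define h y where "h = t (Suc i) - t i" and "y = s - t i"
  have h: "0 < h" using step_pos'[of m] m1 i by (auto simp: h_def)
  have sets: "{i, Suc i} - {i} = {Suc i}" "{i, Suc i} - {Suc i} = {i}" by auto
  have t: "t (Suc i) = t i + h" "s = t i + y" by (auto simp: h_def y_def)
  have "interp_linear m t U s = U i * ((y - h) / (- h)) + U (Suc i) * (y / h)"
    by (simp add: interp_linear_def lagrange_interp_def i sets t)
  also have "\<dots> = newton_poly t m U m s"
    using h by (simp add: newton_poly_def diff_quot_def mesh_step_def i t field_simps)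
  finally show ?thesis .
qed

lemma alikhanov_interp_newton:
  assumes j: "1 \<le> j" "j \<le> m" and s: "t (j - 1) < s" "s < node_end j"
  shows "alikhanov_interp m t U s = newton_poly t m U j s"
proof (cases "j < m")
  case True
  then have "t j \<le> t (m - 1)" by (intro node_mono) auto
  then have "\<not> t (m - 1) < s" using s True by auto
  moreover have "(LEAST i. 1 \<le> i \<and> s \<le> t i) = j"
  proof (rule Least_equality)
    fix i assume i: "1 \<le> i \<and> s \<le> t i"
    show "j \<le> i"
    proof (rule ccontr)
      assume "\<not> j \<le> i"
      then have "t i \<le> t (j - 1)" using j by (intro node_mono) auto
      then show False using i s by simp
    qed
  qed (use True j s in auto)
  ultimately show ?thesis using interp_quadratic_newton[OF j(1) True] by (simp add: alikhanov_interp_def)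
next
  case False
  then have "j = m" using j by simp
  then show ?thesis using s interp_linear_newton by (simp add: alikhanov_interp_def)
qed

lemma deriv_alikhanov_interp:
  assumes j: "1 \<le> j" "j \<le> m" and s: "s \<in> {t (j - 1)<..<node_end j}"
  shows "deriv (alikhanov_interp m t U) s = newton_slope t m U j s"
proof (rule DERIV_imp_deriv)
  show "(alikhanov_interp m t U has_real_derivative newton_slope t m U j s) (at s)"
  proof (rule has_field_derivative_transform_within_open[OF newton_poly_deriv])
    show "open {t (j - 1)<..<node_end j}" by simp
    show "newton_poly t m U j x = alikhanov_interp m t U x" if "x \<in> {t (j - 1)<..<node_end j}" for x
      using alikhanov_interp_newton[OF j, of x U] that by auto
  qed (use s in auto)
qed

lemma newton_slope_has_integral:
  assumes j: "1 \<le> j" "j \<le> m"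
  shows "((\<lambda>s. ker \<alpha> w s * newton_slope t m U j s) has_integral
      diff_quot t U j * (alik_mass \<alpha> t m j - alik_moment \<alpha> t m j)
        + diff_quot t U (Suc j) * alik_moment \<alpha> t m j) {t (j - 1)..node_end j}"
proof (cases "j < m")
  case True
  define c where "c = (diff_quot t U (Suc j) - diff_quot t U j) / (t (Suc j) - t (j - 1))"
  have "((\<lambda>s. diff_quot t U j * ker \<alpha> w s + c * (ker \<alpha> w s * (2 * s - t (j - 1) - t j))) has_integral
      diff_quot t U j * integral {t (j - 1)..t j} (ker \<alpha> w)
       + c * integral {t (j - 1)..t j} (\<lambda>s. ker \<alpha> w s * (2 * s - t (j - 1) - t j))) {t (j - 1)..t j}"
    using node_lt_star[OF True]
    by (intro has_integral_add has_integral_mult_right integrable_integral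
        integrable_continuous_interval continuous_intros ker_continuous_on)
  moreover
  have "c * integral {t (j - 1)..t j} (\<lambda>s. ker \<alpha> w s * (2 * s - t (j - 1) - t j))
      = (diff_quot t U (Suc j) - diff_quot t U j) * alik_moment \<alpha> t m j"
    using True j by (simp add: c_def alik_moment_def)
  moreover have "(\<lambda>s. ker \<alpha> w s * newton_slope t m U j s) =
     (\<lambda>s. diff_quot t U j * ker \<alpha> w s + c * (ker \<alpha> w s * (2 * s - t (j - 1) - t j)))"
    unfolding newton_slope_def c_def[symmetric] if_P[OF True] by (auto simp: algebra_simps)
  moreover have "diff_quot t U j * integral {t (j - 1)..t j} (ker \<alpha> w)
      + (diff_quot t U (Suc j) - diff_quot t U j) * alik_moment \<alpha> t m j =
     diff_quot t U j * (alik_mass \<alpha> t m j - alik_moment \<alpha> t m j)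
        + diff_quot t U (Suc j) * alik_moment \<alpha> t m j"
    using True by (simp add: alik_mass_def algebra_simps)
  ultimately show ?thesis using if_P[OF True] by (simp only: if_P[OF True])
next
  case False
  then have jm: "j = m" using j by simp
  have "((\<lambda>s. diff_quot t U m * ker \<alpha> w s) has_integral
      diff_quot t U m * integral {t (m - 1)..w} (ker \<alpha> w)) {t (m - 1)..w}"
    using has_integral_ker_singular[OF \<alpha> star_gt]
    by (intro has_integral_mult_right) (metis integral_unique)
  then show ?thesis by (simp add: jm newton_slope_def alik_mass_def alik_moment_def mult.commute)
qed

text \<open>Shifting the index in the second summand collects all contributions to one difference
  quotient. The quotient of index \<open>Suc m\<close> is multiplied by the moment of index
  \<open>m\<close>, which is 0, so no value beyond U_m enters.\<close>

lemma sum_slope_integrals: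
  "(\<Sum>j=1..m. diff_quot t U j * (alik_mass \<alpha> t m j - alik_moment \<alpha> t m j)
        + diff_quot t U (Suc j) * alik_moment \<alpha> t m j) = alik_sum \<alpha> t m U"
proof -
  define f where "f j = diff_quot t U j * alik_moment \<alpha> t m (j - 1)" for j
  have "f 1 = 0" "f (Suc m) = 0" by (auto simp: f_def alik_moment_def)
  then have "(\<Sum>j=1..m. f (Suc j)) = (\<Sum>j=1..m. f j)" using sum_shift_boundary[of f m] by simp
  then have "(\<Sum>j=1..m. diff_quot t U (Suc j) * alik_moment \<alpha> t m j) =
      (\<Sum>j=1..m. diff_quot t U j * alik_moment \<alpha> t m (j - 1))"
    by (simp add: f_def)
  then show ?thesis
    unfolding sum.distrib
    by (simp add: alik_sum_def sum.distrib[symmetric] alik_coef_def diff_quot_def algebra_simps add_divide_distrib diff_divide_distrib)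
qed

lemma has_integral_pieces:
  fixes f :: "real \<Rightarrow> real"
  assumes "\<And>j. \<lbrakk>1 \<le> j; j \<le> m\<rbrakk> \<Longrightarrow> (f has_integral I j) {t (j - 1)..node_end j}"
  shows "(f has_integral (\<Sum>j=1..m. I j)) {0..w}"
proof -
  have e: "node_end (j - 1) = t (j - 1)" if "1 \<le> j" "j \<le> m" for j
    using that by (cases j) auto
  define E where "E j = node_end j" for j
  have "(f has_integral (\<Sum>j=1..m. I j)) {E 0..E m} \<and> E 0 \<le> E m"
  proof (rule has_integral_nodes)
    fix j assume j: "1 \<le> j" "j \<le> m"
    show "E (j - 1) \<le> E j" unfolding E_def e[OF j] using node_end_gt[OF j] by linarith
    show "(f has_integral I j) {E (j - 1)..E j}" unfolding E_def e[OF j] by (rule assms[OF j])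
  qed
  then show ?thesis using m1 t0 by (simp add: E_def)
qed

lemma alikhanov_eq_sum: "alikhanov \<alpha> t U m = 1 / Gamma (1 - \<alpha>) * alik_sum \<alpha> t m U"
proof -
  have "((\<lambda>s. (w - s) powr (- \<alpha>) * deriv (alikhanov_interp m t U) s) has_integral alik_sum \<alpha> t m U) {0..w}"
    unfolding sum_slope_integrals[symmetric]
  proof (rule has_integral_pieces)
    fix j assume j: "1 \<le> j" "j \<le> m"
    show "((\<lambda>s. (w - s) powr (- \<alpha>) * deriv (alikhanov_interp m t U) s) has_integral
       diff_quot t U j * (alik_mass \<alpha> t m j - alik_moment \<alpha> t m j)
        + diff_quot t U (Suc j) * alik_moment \<alpha> t m j) {t (j - 1)..node_end j}"
      unfolding cbox_interval[symmetric]
    \<comment> \<open>The slope of the piecewise interpolant may jump at the nodes, so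
      \<open>deriv\<close> is only known inside a piece; the two end points do not affect the
      integral.\<close>
    proof (rule has_integral_spike_interior)
      show "((\<lambda>s. ker \<alpha> w s * newton_slope t m U j s) has_integral
       diff_quot t U j * (alik_mass \<alpha> t m j - alik_moment \<alpha> t m j)
        + diff_quot t U (Suc j) * alik_moment \<alpha> t m j) (cbox (t (j - 1)) (node_end j))"
        using newton_slope_has_integral[OF j] by simp
    next
      fix s assume "s \<in> box (t (j - 1)) (node_end j)"
      then show "(w - s) powr (- \<alpha>) * deriv (alikhanov_interp m t U) s = ker \<alpha> w s * newton_slope t m U j s"
        using deriv_alikhanov_interp[OF j] by (simp add: ker_def)
    qed
  qed
  then show ?thesis by (simp add: alikhanov_def caputo_def integral_unique)
qed

text \<open>The continuous integral appears as the discrete operator minus the total error. In this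
  way the integrability of \<open>f1\<close> against the singular kernel on all of [0, w] comes out
  of the piecewise estimates.\<close>

lemma truncation_sum:
  assumes "\<And>j. \<lbrakk>1 \<le> j; j \<le> m\<rbrakk> \<Longrightarrow>
     ((\<lambda>s. ker \<alpha> w s * (newton_slope t m U j s - f1 s)) has_integral R j) {t (j - 1)..node_end j}"
  shows "((\<lambda>s. ker \<alpha> w s * f1 s) has_integral alik_sum \<alpha> t m U - (\<Sum>j=1..m. R j)) {0..w}"
  unfolding sum_slope_integrals[symmetric] sum_subtractf[symmetric]
proof (rule has_integral_pieces)
  fix j assume j: "1 \<le> j" "j \<le> m"
  show "((\<lambda>s. ker \<alpha> w s * f1 s) has_integral
       diff_quot t U j * (alik_mass \<alpha> t m j - alik_moment \<alpha> t m j)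
        + diff_quot t U (Suc j) * alik_moment \<alpha> t m j - R j) {t (j - 1)..node_end j}"
    using has_integral_diff[OF newton_slope_has_integral[OF j, of U] assms[OF j]]
    by (simp add: algebra_simps)
qed

lemma newton_poly_nodes:
  assumes "1 \<le> j" "j \<le> m"
  shows "newton_poly t m U j (t (j - 1)) = U (j - 1)" "newton_poly t m U j (t j) = U j"
    "j < m \<Longrightarrow> newton_poly t m U j (t (Suc j)) = U (Suc j)"
proof -
  show "newton_poly t m U j (t (j - 1)) = U (j - 1)" by (simp add: newton_poly_def)
  have q: "diff_quot t U j * (t j - t (j - 1)) = U j - U (j - 1)"
    using step_pos'[OF assms] by (simp add: diff_quot_def mesh_step_def)
  then show "newton_poly t m U j (t j) = U j" by (simp add: newton_poly_def)
  assume jm: "j < m"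
  have q': "diff_quot t U (Suc j) * (t (Suc j) - t j) = U (Suc j) - U j"
    using step_pos'[of "Suc j"] jm by (simp add: diff_quot_def mesh_step_def)
  have c: "(t (Suc j) - t (j - 1)) * (c / (t (Suc j) - t (j - 1))) = c" for c
  proof -
    have "t (j - 1) < t (Suc j)" using jm by (intro node_strict_mono) auto
    then show ?thesis by simp
  qed
  have "newton_poly t m U j (t (Suc j)) = U (j - 1) + diff_quot t U j * (t (Suc j) - t (j - 1)) +
     (t (Suc j) - t j) * (diff_quot t U (Suc j) - diff_quot t U j)"
    using jm c by (simp add: newton_poly_def mult.assoc mult.left_commute)
  also have "\<dots> = U (j - 1) + diff_quot t U j * (t j - t (j - 1)) + diff_quot t U (Suc j) * (t (Suc j) - t j)"
    by (simp add: algebra_simps)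
  finally show "newton_poly t m U j (t (Suc j)) = U (Suc j)" using q q' by simp
qed

text \<open>The interpolation error vanishes at t_(j-1) and t_j, so integration by parts leaves no
  boundary terms. Its third zero, at t_(j+1), makes it cubic in the local step size.\<close>

lemma truncation_inner:
  assumes j: "1 \<le> j" "j < m"
    and cont: "continuous_on {t (j - 1)..t (Suc j)} f"
    and d1: "\<And>s. s \<in> {t (j - 1)<..<t (Suc j)} \<Longrightarrow> (f has_real_derivative f1 s) (at s)"
    and d2: "\<And>s. s \<in> {t (j - 1)<..<t (Suc j)} \<Longrightarrow> (f1 has_real_derivative f2 s) (at s)"
    and d3: "\<And>s. s \<in> {t (j - 1)<..<t (Suc j)} \<Longrightarrow> (f2 has_real_derivative f3 s) (at s)"
    and S: "\<And>s. s \<in> {t (j - 1)<..<t (Suc j)} \<Longrightarrow> \<bar>f3 s\<bar> \<le> S"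
  shows "\<exists>R. ((\<lambda>s. ker \<alpha> w s * (newton_slope t m (\<lambda>i. f (t i)) j s - f1 s)) has_integral R)
            {t (j - 1)..node_end j} \<and>
          \<bar>R\<bar> \<le> S * (t (Suc j) - t (j - 1)) ^ 3 * (ker \<alpha> w (t j) - ker \<alpha> w (t (j - 1)))"
proof -
  define U where "U i = f (t i)" for i
  define e where "e s = newton_poly t m U j s - f s" for s
  have abc: "t (j - 1) < t j" "t j < t (Suc j)" using j step_pos'[of j] step_pos'[of "Suc j"] by auto
  have ez: "e (t (j - 1)) = 0" "e (t j) = 0" "e (t (Suc j)) = 0"
    using newton_poly_nodes[of j U] j by (auto simp: e_def U_def)
  have ce: "continuous_on {t (j - 1)..t (Suc j)} e"
    unfolding e_def
    by (intro continuous_intros cont DERIV_continuous_on[OF newton_poly_deriv])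
  have de: "(e has_real_derivative newton_slope t m U j s - f1 s) (at s)" if "s \<in> {t (j - 1)<..<t (Suc j)}" for s
    unfolding e_def by (intro derivative_intros newton_poly_deriv d1 that)
  have eb: "\<bar>e s\<bar> \<le> S * (t (Suc j) - t (j - 1)) ^ 3" if "s \<in> {t (j - 1)..t j}" for s
  proof (rule quadratic_interp_error[OF abc ce de _ _ _ ez that])
    fix s assume s: "s \<in> {t (j - 1)<..<t (Suc j)}"
    show "((\<lambda>s. newton_slope t m U j s - f1 s) has_real_derivative
      2 * ((diff_quot t U (Suc j) - diff_quot t U j) / (t (Suc j) - t (j - 1))) - f2 s) (at s)"
      using newton_slope_deriv[of t m U j s UNIV] j by (intro derivative_intros d2 s) auto
    show "((\<lambda>s. 2 * ((diff_quot t U (Suc j) - diff_quot t U j) / (t (Suc j) - t (j - 1))) - f2 s)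
        has_real_derivative 0 - f3 s) (at s)"
      by (intro derivative_intros d3 s)
    show "\<bar>0 - f3 s\<bar> \<le> S" using S[OF s] by simp
  qed
  have "\<exists>I. ((\<lambda>s. ker \<alpha> w s * (newton_slope t m U j s - f1 s)) has_integral I) {t (j - 1)..t j} \<and>
     \<bar>I\<bar> \<le> \<bar>ker \<alpha> w (t j) * e (t j)\<bar> +
        S * (t (Suc j) - t (j - 1)) ^ 3 * (ker \<alpha> w (t j) - ker \<alpha> w (t (j - 1)))"
  proof (rule ker_by_parts)
    show "continuous_on {t (j - 1)..t j} e" using abc by (intro continuous_on_subset[OF ce]) auto
    show "(e has_real_derivative newton_slope t m U j s - f1 s) (at s)" if "s \<in> {t (j - 1)<..<t j}" for s
      using that abc by (intro de) auto
  qed (use \<alpha> abc node_lt_star j ez eb in auto)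
  then show ?thesis using j ez unfolding U_def[abs_def] by simp
qed

text \<open>The slope of a linear interpolant is only first-order accurate. Adding c/2 (s - a)(s -
  b), with \<open>c\<close> the second derivative at the midpoint, keeps the nodal zeros of the
  error and makes its slope of size S h^2, while the added slope is invisible to the kernel
  integral.\<close>

lemma truncation_last:
  assumes cont: "continuous_on {t (m - 1)..t m} f" "continuous_on {t (m - 1)..t m} f1"
      "continuous_on {t (m - 1)..t m} f2"
    and d1: "\<And>s. s \<in> {t (m - 1)<..<t m} \<Longrightarrow> (f has_real_derivative f1 s) (at s)"
    and d2: "\<And>s. s \<in> {t (m - 1)<..<t m} \<Longrightarrow> (f1 has_real_derivative f2 s) (at s)"
    and d3: "\<And>s. s \<in> {t (m - 1)<..<t m} \<Longrightarrow> (f2 has_real_derivative f3 s) (at s)"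
    and S: "\<And>s. s \<in> {t (m - 1)<..<t m} \<Longrightarrow> \<bar>f3 s\<bar> \<le> S"
  shows "\<exists>R. ((\<lambda>s. ker \<alpha> w s * (newton_slope t m (\<lambda>i. f (t i)) m s - f1 s)) has_integral R)
            {t (m - 1)..node_end m} \<and>
          \<bar>R\<bar> \<le> S * (mesh_step t m)\<^sup>2 * ((w - t (m - 1)) powr (1 - \<alpha>) / (1 - \<alpha>))"
proof -
  define a b h where "a = t (m - 1)" and "b = t m" and "h = mesh_step t m"
  define U where "U i = f (t i)" for i
  define c where "c = f2 ((a + b) / 2)"
  define e where "e s = newton_poly t m U m s - f s + c / 2 * ((s - a) * (s - b))" for s
  define e1 where "e1 s = diff_quot t U m - f1 s + c / 2 * (2 * s - a - b)" for s
  have ab: "a < b" "h = b - a" "a < w" "w \<le> b"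
    using step_pos'[of m] m1 star_gt star_le by (auto simp: a_def b_def h_def mesh_step_def)
  have slope: "newton_slope t m U m s = diff_quot t U m" for s by (simp add: newton_slope_def)
  have sub: "{a..w} \<subseteq> {a..b}" using ab by auto
  have ce: "continuous_on {a..b} e"
    unfolding e_def using cont
    by (intro continuous_intros DERIV_continuous_on[OF newton_poly_deriv]) (auto simp: a_def b_def)
  have ce1: "continuous_on {a..b} e1"
    unfolding e1_def using cont by (intro continuous_intros) (auto simp: a_def b_def)
  have de: "(e has_real_derivative e1 s) (at s)" if "s \<in> {a<..<b}" for s
    unfolding e_def e1_def using that d1[of s] newton_poly_deriv[of t m U m s UNIV]
    by (auto intro!: derivative_eq_intros simp: a_def b_def slope algebra_simps)
  have de1: "(e1 has_real_derivative c - f2 s) (at s)" if "s \<in> {a<..<b}" for s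
    unfolding e1_def using that d2[of s]
    by (auto intro!: derivative_eq_intros simp: a_def b_def algebra_simps)
  have ez: "e a = 0" "e b = 0"
    using newton_poly_nodes[of m U] m1 by (auto simp: e_def U_def a_def b_def)
  obtain z where z: "a < z" "z < b" "e1 z = 0"
  proof -
    obtain z where "a < z" "z < b" "(e has_real_derivative 0) (at z)"
      using Rolle[OF ab(1) _ ce] ez de by (auto simp: real_differentiable_def)
    then show thesis using that de[of z] DERIV_unique by force
  qed
  have S0: "0 \<le> S" using S[of z] z by (auto simp: a_def b_def)
  have e2b: "\<bar>c - f2 s\<bar> \<le> S * h" if s: "s \<in> {a<..<b}" for s
  proof -
    have seg: "closed_segment ((a + b) / 2) s \<subseteq> {a<..<b}" "open_segment ((a + b) / 2) s \<subseteq> {a<..<b}"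
      using s by (auto simp: closed_segment_eq_real_ivl open_segment_eq_real_ivl split: if_splits)
    have "\<bar>f2 ((a + b) / 2) - f2 s\<bar> \<le> S * \<bar>(a + b) / 2 - s\<bar>"
    proof (rule mvt_abs_le[where g' = f3])
      show "continuous_on (closed_segment ((a + b) / 2) s) f2"
        using seg(1) cont(3) by (intro continuous_on_subset[OF cont(3)]) (auto simp: a_def b_def)
    qed (use seg d3 S in \<open>auto simp: a_def b_def\<close>)
    also have "\<dots> \<le> S * h"
      using s ab by (intro mult_left_mono S0 abs_leI) (auto simp: field_simps)
    finally show ?thesis by (simp add: c_def)
  qed
  have e1b: "\<bar>e1 s\<bar> \<le> S * h\<^sup>2" if s: "s \<in> {a..b}" for s
  proof -
    have seg: "closed_segment s z \<subseteq> {a..b}" "open_segment s z \<subseteq> {a<..<b}"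
      using s z by (auto simp: closed_segment_eq_real_ivl open_segment_eq_real_ivl split: if_splits)
    have "\<bar>e1 s - e1 z\<bar> \<le> S * h * \<bar>s - z\<bar>"
      using seg by (intro mvt_abs_le[where g' = "\<lambda>s. c - f2 s"] continuous_on_subset[OF ce1] de1 e2b) auto
    also have "\<dots> \<le> S * h * h" using s z S0 ab by (intro mult_left_mono) (auto simp: abs_if)
    finally show ?thesis using z by (simp add: power2_eq_square mult.assoc)
  qed
  have "(\<lambda>s. ker \<alpha> w s * e1 s) integrable_on {a..w}"
  proof (rule ker_mult_integrable[OF \<alpha> ab(3)])
    show "continuous_on {a..w} e1" by (rule continuous_on_subset[OF ce1 sub])
    show "continuous_on {a..w} (\<lambda>s. c - f2 s)"
      using cont(3) sub by (intro continuous_intros continuous_on_subset[OF cont(3)]) (auto simp: a_def b_def)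
  qed (use de1 ab in auto)
  then obtain R where R: "((\<lambda>s. ker \<alpha> w s * e1 s) has_integral R) {a..w}" by blast
  have Rb: "\<bar>R\<bar> \<le> S * h\<^sup>2 * ((w - a) powr (1 - \<alpha>) / (1 - \<alpha>))"
    using sub by (intro ker_mult_integral_bound[OF \<alpha> ab(3) R] e1b) auto
  \<comment> \<open>The choice of \<open>w\<close> makes \<open>2 s - a - b\<close> orthogonal to the kernel on \<open>{a..w}\<close>.\<close>
  have orth: "((\<lambda>s. ker \<alpha> w s * (2 * s - a - b)) has_integral 0) {a..w}"
  proof -
    \<comment> \<open>The antiderivative comes from 2 s - a - b = (2 w - a - b) - 2 (w - s). It
      vanishes at \<open>w\<close> because powers of 0 are 0, and at \<open>a\<close> because w - a
      = (1 - alpha/2) h.\<close>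
    define P where "P s = - (2 * w - a - b) * ((w - s) powr (1 - \<alpha>) / (1 - \<alpha>))
       + 2 * ((w - s) powr (2 - \<alpha>) / (2 - \<alpha>))" for s
    have "((\<lambda>s. ker \<alpha> w s * (2 * s - a - b)) has_integral P w - P a) {a..w}"
    proof (rule fundamental_theorem_of_calculus_interior)
      show "continuous_on {a..w} P"
        unfolding P_def using \<alpha>
        by (intro continuous_on_add continuous_on_mult continuous_on_divide continuous_on_powr' continuous_intros ballI) auto
      fix s assume s: "s \<in> {a<..<w}"
      have "(P has_real_derivative (2 * w - a - b) * (w - s) powr (- \<alpha>) - 2 * (w - s) powr (1 - \<alpha>)) (at s)"
        unfolding P_def using \<alpha> s by (auto intro!: derivative_eq_intros) (simp add: algebra_simps)
      moreover have "(w - s) powr (1 - \<alpha>) = (w - s) * (w - s) powr (- \<alpha>)"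
        using s powr_add[of "w - s" 1 "- \<alpha>"] by simp
      ultimately have "(P has_real_derivative ker \<alpha> w s * (2 * s - a - b)) (at s)"
        by (simp add: ker_def algebra_simps)
      then show "(P has_vector_derivative ker \<alpha> w s * (2 * s - a - b)) (at s)"
        by (simp add: has_real_derivative_iff_has_vector_derivative)
    qed (use ab in simp)
    moreover have "P w = 0" by (simp add: P_def)
    moreover have "P a = 0"
    proof -
      define v where "v = w - a"
      have v: "v = (1 - \<alpha> / 2) * h" "0 < v" using star_minus ab by (auto simp: v_def a_def h_def)
      have "2 * w - a - b = 2 * v - h" using ab by (simp add: v_def)
      also have "\<dots> = (1 - \<alpha>) * h" unfolding v(1) by (simp add: algebra_simps)
      finally have 1: "2 * w - a - b = (1 - \<alpha>) * h" .
      have 2: "v powr (2 - \<alpha>) = v * v powr (1 - \<alpha>)"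
        using v powr_add[of v 1 "1 - \<alpha>"] by simp
      have 3: "2 * v / (2 - \<alpha>) = h" using v \<alpha> by (simp add: field_simps)
      have "P a = - ((1 - \<alpha>) * h) * (v powr (1 - \<alpha>) / (1 - \<alpha>)) + 2 * v / (2 - \<alpha>) * v powr (1 - \<alpha>)"
        unfolding P_def v_def[symmetric] 1 2 by simp
      also have "\<dots> = 0" unfolding 3 using \<alpha> by simp
      finally show ?thesis .
    qed
    ultimately show ?thesis by simp
  qed
  have "((\<lambda>s. ker \<alpha> w s * e1 s - c / 2 * (ker \<alpha> w s * (2 * s - a - b))) has_integral R - c / 2 * 0) {a..w}"
    by (intro has_integral_diff has_integral_mult_right R orth)
  moreover have "ker \<alpha> w s * e1 s - c / 2 * (ker \<alpha> w s * (2 * s - a - b)) =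
      ker \<alpha> w s * (newton_slope t m U m s - f1 s)" for s
    by (simp add: e1_def slope field_simps)
  ultimately have "((\<lambda>s. ker \<alpha> w s * (newton_slope t m U m s - f1 s)) has_integral R) {a..w}"
    by simp
  then show ?thesis using Rb unfolding U_def[abs_def] by (auto simp: a_def h_def)
qed

end

section \<open>Graded meshes\<close>

lemma powr_divide_neg:
  fixes x c a :: real
  assumes "0 < x" "0 < c"
  shows "(x / c) powr (- a) = c powr a * x powr (- a)"
  using assms by (simp add: powr_divide powr_minus field_simps)

text \<open>The model step length. By \<open>grading_eq\<close> it is t_j times (t_1/t_j)^(1/r), the
  form in which local errors become powers of t_1/t_j.\<close>

definition grading :: "real \<Rightarrow> (nat \<Rightarrow> real) \<Rightarrow> nat \<Rightarrow> real" where
  "grading r t j = t 1 powr (1 / r) * t j powr (1 - 1 / r)"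

lemma (in alikhanov_mesh) star_gap_ge: "mesh_step t m / 2 \<le> w - t (m - 1)"
proof -
  have "\<alpha> * mesh_step t m \<le> 1 * mesh_step t m"
    using step_pos[of m] m1 \<alpha> by (intro mult_right_mono) auto
  then show ?thesis unfolding star_minus by (simp add: algebra_simps)
qed

text \<open>The node ratio is bounded from index 2 on, since \<open>t 0 = 0\<close>. Requiring
  \<open>2 \<le> K\<close> lets sums of a few terms be absorbed into higher powers of
  \<open>K\<close>.\<close>

locale graded_mesh =
  fixes \<alpha> K r :: real and M :: nat and t :: "nat \<Rightarrow> real"
  assumes \<alpha>: "0 < \<alpha>" "\<alpha> < 1" and r1: "1 \<le> r" and K2: "2 \<le> K" and t0: "t 0 = 0"
    and step_pos': "\<And>j. \<lbrakk>1 \<le> j; j \<le> M\<rbrakk> \<Longrightarrow> t (j - 1) < t j"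
    and step_le: "\<And>j. \<lbrakk>1 \<le> j; j \<le> M\<rbrakk> \<Longrightarrow> mesh_step t j \<le> K * grading r t j"
    and grading_le: "\<And>j. \<lbrakk>1 \<le> j; j \<le> M\<rbrakk> \<Longrightarrow> grading r t j \<le> K * mesh_step t j"
    and node_ratio: "\<And>j. \<lbrakk>2 \<le> j; j \<le> M\<rbrakk> \<Longrightarrow> t j \<le> K * t (j - 1)"
begin

lemma alikhanov_mesh: "1 \<le> m \<Longrightarrow> m \<le> M \<Longrightarrow> alikhanov_mesh \<alpha> t m"
  using \<alpha> t0 step_pos' by unfold_locales auto

lemma node_strict_mono: "i < j \<Longrightarrow> j \<le> M \<Longrightarrow> t i < t j"
proof (induction j)
  case (Suc j)
  then show ?case using step_pos'[of "Suc j"] by (cases "i = j") auto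
qed simp

lemma node_mono: "i \<le> j \<Longrightarrow> j \<le> M \<Longrightarrow> t i \<le> t j"
  using node_strict_mono[of i j] by (cases "i = j") auto

lemma node_pos: "1 \<le> j \<Longrightarrow> j \<le> M \<Longrightarrow> 0 < t j"
  using node_strict_mono[of 0 j] t0 by simp

lemma step_pos: "1 \<le> j \<Longrightarrow> j \<le> M \<Longrightarrow> 0 < mesh_step t j"
  using step_pos' by (simp add: mesh_step_def)

lemma first_le: "1 \<le> j \<Longrightarrow> j \<le> M \<Longrightarrow> t 1 \<le> t j" by (rule node_mono)

lemma first_pos: "1 \<le> M \<Longrightarrow> 0 < t 1" using node_pos by simp

lemma grading_eq:
  assumes "1 \<le> j" "j \<le> M"
  shows "grading r t j = t j * (t 1 / t j) powr (1 / r)"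
proof -
  have "0 < t 1" "0 < t j" using node_pos[of 1] node_pos[of j] assms by auto
  then show ?thesis by (simp add: grading_def powr_diff powr_divide)
qed

lemma grading_pos: "1 \<le> j \<Longrightarrow> j \<le> M \<Longrightarrow> 0 < grading r t j"
  using node_pos[of 1] node_pos[of j] by (simp add: grading_def)

lemma first_le_grading:
  assumes "1 \<le> j" "j \<le> M"
  shows "t 1 \<le> grading r t j"
proof -
  have p: "0 < t 1" "t 1 \<le> t j" using first_pos first_le assms by auto
  have "t 1 = t 1 powr (1 / r) * t 1 powr (1 - 1 / r)" using p by (simp flip: powr_add)
  also have "\<dots> \<le> grading r t j"
    unfolding grading_def using p r1 by (intro mult_left_mono powr_mono2) auto
  finally show ?thesis .
qed

lemma grading_Suc_le:
  assumes "1 \<le> j" "Suc j \<le> M"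
  shows "grading r t (Suc j) \<le> K * grading r t j"
proof -
  have p: "0 < t j" using node_pos assms by simp
  have "t (Suc j) powr (1 - 1 / r) \<le> (K * t j) powr (1 - 1 / r)"
    using node_ratio[of "Suc j"] node_pos[of "Suc j"] assms r1 by (intro powr_mono2) auto
  also have "\<dots> = K powr (1 - 1 / r) * t j powr (1 - 1 / r)" using K2 p by (simp add: powr_mult)
  also have "\<dots> \<le> K * t j powr (1 - 1 / r)"
    using K2 r1 powr_mono[of "1 - 1 / r" 1 K] by (intro mult_right_mono) auto
  finally have "t 1 powr (1 / r) * t (Suc j) powr (1 - 1 / r) \<le> t 1 powr (1 / r) * (K * t j powr (1 - 1 / r))"
    by (intro mult_left_mono) auto
  then show ?thesis by (simp add: grading_def mult.left_commute)
qed

lemma double_step_le: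
  assumes "1 \<le> j" "Suc j \<le> M"
  shows "t (Suc j) - t (j - 1) \<le> 2 * K\<^sup>2 * grading r t j"
proof -
  have g: "0 < grading r t j" using grading_pos assms by simp
  have "t (Suc j) - t (j - 1) = mesh_step t j + mesh_step t (Suc j)" by (simp add: mesh_step_def)
  also have "\<dots> \<le> K * grading r t j + K * (K * grading r t j)"
    using assms K2
    by (intro add_mono step_le order_trans[OF step_le[of "Suc j"]] mult_left_mono grading_Suc_le) auto
  also have "\<dots> \<le> K * (K * grading r t j) + K * (K * grading r t j)"
    using g K2 by (intro add_right_mono mult_left_mono) auto
  finally show ?thesis by (simp add: power2_eq_square mult.assoc)
qed

text \<open>If t_m >= 4 t_1, then w >= t_m/2 leaves a gap of t_m/4. Otherwise t_1 is comparable to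
  t_m, and no step is much shorter than the first: t_1 <= K \<open>mesh_step t m\<close>, while at
  least half of the last step lies to the left of \<open>w\<close>.\<close>

lemma star_first_gap:
  assumes "2 \<le> m" "m \<le> M"
  shows "t m \<le> 8 * K * (t_star \<alpha> t m - t 1)"
proof -
  interpret A: alikhanov_mesh \<alpha> t m using alikhanov_mesh assms by simp
  have p: "0 < t m" "0 < t 1" using node_pos assms first_pos by auto
  show ?thesis
  proof (cases "4 * t 1 \<le> t m")
    case True
    then have "t m / 4 \<le> t_star \<alpha> t m - t 1" using A.star_ge_half by simp
    then have "8 * K * (t m / 4) \<le> 8 * K * (t_star \<alpha> t m - t 1)" using K2 by (intro mult_left_mono) auto
    moreover have "1 * t m \<le> (2 * K) * t m" using K2 p by (intro mult_right_mono) auto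
    ultimately show ?thesis by simp
  next
    case False
    have "t m / 4 \<le> t 1" using False by simp
    also have "\<dots> \<le> K * mesh_step t m" using first_le_grading[of m] grading_le[of m] assms by simp
    also have "mesh_step t m \<le> 2 * (t_star \<alpha> t m - t (m - 1))"
      using A.star_gap_ge by simp
    also have "\<dots> \<le> 2 * (t_star \<alpha> t m - t 1)" using node_mono[of 1 "m - 1"] assms by simp
    finally show ?thesis using K2 by (simp add: algebra_simps)
  qed
qed

text \<open>Comparison with the integral of x^y over [t_1, t_n]; moving an intermediate point to the
  right end of its interval costs at most K^|y|. The formula serves both signs of y + 1: for y < -1
  the quotient and the difference on the right are both nonpositive, and the first node
  dominates.\<close>

lemma sum_step_powr_le:
  assumes n: "n \<le> M" and y: "y \<noteq> -1" "1 \<le> n"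
  shows "(\<Sum>j=2..n. mesh_step t j * t j powr y)
     \<le> K powr \<bar>y\<bar> / (y + 1) * (t n powr (y + 1) - t 1 powr (y + 1))"
  using \<open>1 \<le> n\<close> n
proof (induction n rule: nat_induct_at_least)
  case base
  then show ?case by simp
next
  case (Suc n)
  define a b where "a = t n" and "b = t (Suc n)"
  have ab: "0 < a" "a < b" "b \<le> K * a"
    using node_pos[of n] node_strict_mono[of n "Suc n"] node_ratio[of "Suc n"] Suc by (auto simp: a_def b_def)
  have "\<exists>z. a < z \<and> z < b \<and> b powr (y + 1) - a powr (y + 1) = (b - a) * ((y + 1) * z powr y)"
  proof (rule MVT2[OF ab(2)])
    fix x assume "a \<le> x" "x \<le> b"
    then show "((\<lambda>x. x powr (y + 1)) has_real_derivative (y + 1) * x powr y) (at x)"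
      using ab by (auto intro!: derivative_eq_intros)
  qed
  then obtain z where z: "a < z" "z < b" "b powr (y + 1) - a powr (y + 1) = (b - a) * ((y + 1) * z powr y)"
    by blast
  have "b powr y \<le> K powr \<bar>y\<bar> * z powr y"
  proof (cases "0 \<le> y")
    case True
    have "b \<le> K * z" using ab z K2 mult_left_mono[of a z K] by linarith
    then have "b powr y \<le> (K * z) powr y"
      using ab True by (intro powr_mono2) auto
    then show ?thesis using True ab z K2 by (simp add: powr_mult)
  next
    case False
    have "b powr y \<le> z powr y" using ab z False by (intro powr_mono2') auto
    also have "\<dots> \<le> K powr \<bar>y\<bar> * z powr y"
      using K2 ge_one_powr_ge_zero[of K "\<bar>y\<bar>"] by (simp add: mult_le_cancel_right1)
    finally show ?thesis .
  qed
  then have "(b - a) * b powr y \<le> (b - a) * (K powr \<bar>y\<bar> * z powr y)"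
    using ab by (intro mult_left_mono) auto
  also have "\<dots> = K powr \<bar>y\<bar> / (y + 1) * (b powr (y + 1) - a powr (y + 1))"
    using y unfolding z(3) by (simp add: field_simps)
  finally have *: "mesh_step t (Suc n) * t (Suc n) powr y \<le>
     K powr \<bar>y\<bar> / (y + 1) * (t (Suc n) powr (y + 1) - t n powr (y + 1))"
    by (simp add: mesh_step_def a_def b_def)
  have "(\<Sum>j=2..Suc n. mesh_step t j * t j powr y) =
      (\<Sum>j=2..n. mesh_step t j * t j powr y) + mesh_step t (Suc n) * t (Suc n) powr y"
    using Suc by simp
  also have "\<dots> \<le> K powr \<bar>y\<bar> / (y + 1) * (t n powr (y + 1) - t 1 powr (y + 1)) +
     K powr \<bar>y\<bar> / (y + 1) * (t (Suc n) powr (y + 1) - t n powr (y + 1))"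
    using Suc * by (intro add_mono) auto
  finally show ?case by (simp add: algebra_simps)
qed

text \<open>Integral comparison gives p^(-y)/y, used for t_n > p; the crude bound t_n p^(-y-1) is
  used for t_n <= p. The factor 2 t_n/(t_n + p) covers both cases and supplies the denominator of
  \<open>barrier_rate\<close>.\<close>

lemma sum_step_shifted_powr_le:
  assumes n: "n \<le> M" and p: "0 < p" and y: "0 < y"
  shows "(\<Sum>j=1..n. mesh_step t j * (t j + p) powr (- y - 1))
     \<le> (1 / y + 1) * p powr (- y) * (2 * t n / (t n + p))"
proof -
  have 1: "(\<Sum>j=1..n. mesh_step t j * (t j + p) powr (- y - 1)) \<le> (p powr (- y) - (t n + p) powr (- y)) / y"
    using n
  proof (induction n)
    case (Suc n)
    define a b where "a = t n" and "b = t (Suc n)"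
    have ab: "0 \<le> a" "a < b"
      using node_mono[of 0 n] node_strict_mono[of n "Suc n"] Suc t0 by (auto simp: a_def b_def)
    have "\<exists>z. a < z \<and> z < b \<and> (- ((b + p) powr (- y))) - (- ((a + p) powr (- y))) = (b - a) * (y * (z + p) powr (- y - 1))"
    proof (rule MVT2[OF ab(2)])
      fix x assume "a \<le> x" "x \<le> b"
      then show "((\<lambda>x. - ((x + p) powr (- y))) has_real_derivative y * (x + p) powr (- y - 1)) (at x)"
        using ab p by (auto intro!: derivative_eq_intros)
    qed
    then obtain z where z: "a < z" "z < b"
      "(- ((b + p) powr (- y))) - (- ((a + p) powr (- y))) = (b - a) * (y * (z + p) powr (- y - 1))" by blast
    have "(b - a) * (y * (b + p) powr (- y - 1)) \<le> (b - a) * (y * (z + p) powr (- y - 1))"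
      using ab z p y by (intro mult_left_mono powr_mono2') auto
    then have "(b - a) * (b + p) powr (- y - 1) \<le> ((a + p) powr (- y) - (b + p) powr (- y)) / y"
      using z(3) y by (simp add: field_simps)
    then show ?case using Suc y by (simp add: mesh_step_def a_def b_def diff_divide_distrib)
  qed (use p t0 in simp)
  have tn: "0 \<le> t n" using node_mono[of 0 n] t0 n by simp
  have "(\<Sum>j=1..n. mesh_step t j * (t j + p) powr (- y - 1)) \<le> (\<Sum>j=1..n. mesh_step t j * p powr (- y - 1))"
    using step_pos node_pos n p y by (intro sum_mono mult_left_mono powr_mono2') (auto simp: less_imp_le)
  also have "\<dots> = (\<Sum>j=1..n. mesh_step t j) * p powr (- y - 1)" by (simp add: sum_distrib_right)
  also have "(\<Sum>j=1..n. mesh_step t j) = t n"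
    using n t0 by (induction n) (auto simp: mesh_step_def)
  also have "t n * p powr (- y - 1) = p powr (- y) * (t n / p)"
    using p by (simp add: powr_diff)
  finally have 2: "(\<Sum>j=1..n. mesh_step t j * (t j + p) powr (- y - 1)) \<le> p powr (- y) * (t n / p)" .
  define X where "X = 2 * t n / (t n + p)"
  have X0: "0 \<le> X" using tn p by (simp add: X_def)
  have pp: "0 \<le> p powr (- y)" by simp
  have "(\<Sum>j=1..n. mesh_step t j * (t j + p) powr (- y - 1)) \<le> (1 / y + 1) * (p powr (- y) * X)"
  proof (cases "t n \<le> p")
    case True
    have "t n / p = 2 * t n / (2 * p)" by simp
    also have "\<dots> \<le> X" unfolding X_def using True tn p by (intro divide_left_mono) auto
    finally have "p powr (- y) * (t n / p) \<le> p powr (- y) * X"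
      by (intro mult_left_mono pp)
    also have "\<dots> = 1 * (p powr (- y) * X)" by simp
    also have "\<dots> \<le> (1 / y + 1) * (p powr (- y) * X)"
      using y X0 by (intro mult_right_mono mult_nonneg_nonneg) auto
    finally show ?thesis using 2 by linarith
  next
    case False
    have X1: "1 \<le> X" unfolding X_def using False p tn by (subst le_divide_eq) auto
    have "(p powr (- y) - (t n + p) powr (- y)) / y \<le> (1 / y) * (p powr (- y) * 1)"
      using y by (simp add: divide_right_mono)
    also have "\<dots> \<le> (1 / y) * (p powr (- y) * X)"
      using y X1 by (intro mult_left_mono) auto
    also have "\<dots> \<le> (1 / y + 1) * (p powr (- y) * X)"
      using X0 by (intro mult_right_mono mult_nonneg_nonneg) auto
    finally show ?thesis using 1 by linarith
  qed
  then show ?thesis by (simp add: X_def mult.assoc)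
qed

text \<open>\<open>E j\<close> is a local error, multiplied by the growth of the kernel over
  interval \<open>j\<close>. For near nodes, t_m < 4 t_j, the errors are at most \<open>N\<close>
  and the growths telescope to at most the kernel at t_(m-1), which is of order
  \<open>grading r t m powr (- \<alpha>)\<close>. For the other nodes w - t_j >= t_m/4 bounds the
  slope of the kernel, with 4^(alpha + 1) <= 16. The set \<open>J\<close> makes it possible to leave
  out interval 1.\<close>

lemma near_far_split:
  assumes m: "1 \<le> m" "m \<le> M" and J: "J \<subseteq> {1..<m}"
    and E0: "\<And>j. j \<in> J \<Longrightarrow> 0 \<le> E j"
    and N0: "0 \<le> N" and N: "\<And>j. j \<in> J \<Longrightarrow> t m < 4 * t j \<Longrightarrow> E j \<le> N"
  shows "(\<Sum>j\<in>J. E j * (ker \<alpha> (t_star \<alpha> t m) (t j) - ker \<alpha> (t_star \<alpha> t m) (t (j - 1))))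
     \<le> N * (2 * K * grading r t m powr (- \<alpha>)) + 16 * t m powr (- \<alpha> - 1) * (\<Sum>j\<in>J. mesh_step t j * E j)"
proof -
  interpret A: alikhanov_mesh \<alpha> t m using alikhanov_mesh m by simp
  define w where "w = t_star \<alpha> t m"
  define k where "k j = ker \<alpha> w (t j)" for j
  have kd: "0 \<le> k j - k (j - 1)" if "j \<in> {1..<m}" for j
    using that \<alpha> A.node_lt_star[of j] node_mono[of "j - 1" j] m
    unfolding k_def by (auto intro!: ker_mono simp: w_def)
  have pt: "E j * (k j - k (j - 1)) \<le> N * (k j - k (j - 1)) + 16 * t m powr (- \<alpha> - 1) * (mesh_step t j * E j)"
    if jJ: "j \<in> J" for j
  proof -
    have j: "1 \<le> j" "j < m" using jJ J by auto
    show ?thesis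
    proof (cases "t m < 4 * t j")
      case True
      have "E j * (k j - k (j - 1)) \<le> N * (k j - k (j - 1))"
        using N[OF jJ True] kd[of j] j by (intro mult_right_mono) auto
      moreover have "0 \<le> 16 * t m powr (- \<alpha> - 1) * (mesh_step t j * E j)"
        using E0[OF jJ] step_pos[of j] j m by (auto simp: less_imp_le)
      ultimately show ?thesis by linarith
    next
      case False
      have tm: "0 < t m" using node_pos m by simp
      have gap: "t m / 4 \<le> w - t j" using False A.star_ge_half by (simp add: w_def)
      have "k j - k (j - 1) \<le> \<alpha> * (w - t j) powr (- \<alpha> - 1) * (t j - t (j - 1))"
        unfolding k_def using \<alpha> j m A.node_lt_star[of j] node_mono[of "j - 1" j]
        by (intro ker_diff_le) (auto simp: w_def)
      also have "\<dots> \<le> 1 * (16 * t m powr (- \<alpha> - 1)) * (t j - t (j - 1))"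
      proof (intro mult_right_mono mult_mono)
        have "(w - t j) powr (- \<alpha> - 1) \<le> (t m / 4) powr (- \<alpha> - 1)"
          using gap tm \<alpha> by (intro powr_mono2') auto
        also have "\<dots> = 4 powr (\<alpha> + 1) * t m powr (- \<alpha> - 1)"
          using powr_divide_neg[of "t m" 4 "\<alpha> + 1"] tm by simp
        also have "\<dots> \<le> 16 * t m powr (- \<alpha> - 1)"
          using powr_mono[of "\<alpha> + 1" 2 "4::real"] \<alpha> by (intro mult_right_mono) auto
        finally show "(w - t j) powr (- \<alpha> - 1) \<le> 16 * t m powr (- \<alpha> - 1)" .
      qed (use \<alpha> j m node_mono[of "j - 1" j] in auto)
      finally have "E j * (k j - k (j - 1)) \<le> E j * (16 * t m powr (- \<alpha> - 1) * mesh_step t j)"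
        using E0[OF jJ] by (intro mult_left_mono) (auto simp: mesh_step_def)
      moreover have "0 \<le> N * (k j - k (j - 1))" using N0 kd[of j] j by simp
      ultimately show ?thesis by (simp add: mult.commute mult.left_commute)
    qed
  qed
  have "(\<Sum>j\<in>J. k j - k (j - 1)) \<le> (\<Sum>j=1..m-1. k j - k (j - 1))"
  proof (rule sum_mono2)
    have "{1..<m} = {1..m - 1}" using m by auto
    then show "J \<subseteq> {1..m - 1}" using J by simp
  qed (use kd in auto)
  also have "\<dots> = k (m - 1) - k 0"
  proof -
    have "(\<Sum>j=1..n. k j - k (j - 1)) = k n - k 0" for n by (induction n) auto
    then show ?thesis .
  qed
  also have "\<dots> \<le> k (m - 1)" by (simp add: k_def ker_def)
  also have "\<dots> \<le> (grading r t m / (2 * K)) powr (- \<alpha>)"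
  proof -
    have "grading r t m / (2 * K) \<le> mesh_step t m / 2"
      using grading_le[of m] m K2 by (simp add: field_simps)
    also have "\<dots> \<le> w - t (m - 1)"
      using A.star_gap_ge by (simp add: w_def)
    finally show ?thesis
      unfolding k_def ker_def using \<alpha> grading_pos[of m] m K2 by (intro powr_mono2') auto
  qed
  also have "\<dots> = (2 * K) powr \<alpha> * grading r t m powr (- \<alpha>)"
    using grading_pos[of m] m K2 by (intro powr_divide_neg) auto
  also have "\<dots> \<le> 2 * K * grading r t m powr (- \<alpha>)"
    using powr_mono[of \<alpha> 1 "2 * K"] K2 \<alpha> by (intro mult_right_mono) auto
  finally have S: "(\<Sum>j\<in>J. k j - k (j - 1)) \<le> 2 * K * grading r t m powr (- \<alpha>)" .
  have "(\<Sum>j\<in>J. E j * (k j - k (j - 1))) \<le>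
      N * (\<Sum>j\<in>J. k j - k (j - 1)) + 16 * t m powr (- \<alpha> - 1) * (\<Sum>j\<in>J. mesh_step t j * E j)"
    using sum_mono[OF pt] by (simp add: sum.distrib sum_distrib_left)
  also have "\<dots> \<le> N * (2 * K * grading r t m powr (- \<alpha>)) + 16 * t m powr (- \<alpha> - 1) * (\<Sum>j\<in>J. mesh_step t j * E j)"
    using S N0 by (intro add_right_mono mult_left_mono)
  finally show ?thesis by (simp add: k_def w_def)
qed

end

section \<open>Barrier functions\<close>

definition barrier :: "real \<Rightarrow> (nat \<Rightarrow> real) \<Rightarrow> real \<Rightarrow> nat \<Rightarrow> real" where
  "barrier \<alpha> t p i = (if i = 0 then 0 else p * (t i + p) powr (\<alpha> - 1))"

definition barrier_rate :: "real \<Rightarrow> real \<Rightarrow> real \<Rightarrow> real" where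
  "barrier_rate \<alpha> p s = p powr (\<alpha> + 1) * s powr (- \<alpha>) / (s + p)"

text \<open>Compares the near part of the truncation error of V_p with its rate. The losses are
  s^(alpha/r) <= (s + p)^(alpha/r) and, with x = (3 - alpha)/r, the step from (p/(s + p))^x to (p/(s
  + p))^alpha; the latter is where alpha <= x enters.\<close>

lemma barrier_near:
  fixes \<tau> p s r \<alpha> :: real
  assumes pos: "0 < \<tau>" "0 < p" "0 < s" "1 \<le> r" and \<alpha>: "0 < \<alpha>" "\<alpha> \<le> (3 - \<alpha>) / r"
  shows "p * \<tau> powr (3 / r) * (s + p) powr (\<alpha> - 1 - 3 / r) * (\<tau> powr (1 / r) * s powr (1 - 1 / r)) powr (- \<alpha>)
     \<le> (\<tau> / p) powr ((3 - \<alpha>) / r) * barrier_rate \<alpha> p s"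
proof -
  define z where "z = s + p"
  define x where "x = (3 - \<alpha>) / r"
  have z: "0 < z" "s \<le> z" "p \<le> z" using pos by (auto simp: z_def)
  have x: "3 / r = x + \<alpha> / r" by (simp add: x_def add_divide_distrib[symmetric])
  have "(\<tau> powr (1 / r) * s powr (1 - 1 / r)) powr (- \<alpha>) = \<tau> powr (- (\<alpha> / r)) * (s powr (\<alpha> / r) * s powr (- \<alpha>))"
    using pos by (simp add: powr_mult powr_powr powr_add[symmetric] algebra_simps)
  also have "\<dots> \<le> \<tau> powr (- (\<alpha> / r)) * (z powr (\<alpha> / r) * s powr (- \<alpha>))"
    using z pos \<alpha> by (intro mult_left_mono mult_right_mono powr_mono2) auto
  finally have "p * \<tau> powr (3 / r) * z powr (\<alpha> - 1 - 3 / r) * (\<tau> powr (1 / r) * s powr (1 - 1 / r)) powr (- \<alpha>)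
      \<le> p * \<tau> powr (3 / r) * z powr (\<alpha> - 1 - 3 / r) * (\<tau> powr (- (\<alpha> / r)) * (z powr (\<alpha> / r) * s powr (- \<alpha>)))"
    using pos z by (intro mult_left_mono) auto
  also have "\<dots> = p * s powr (- \<alpha>) * (\<tau> powr (3 / r) * \<tau> powr (- (\<alpha> / r))) * (z powr (\<alpha> - 1 - 3 / r) * z powr (\<alpha> / r))"
    by (simp only: mult_ac)
  also have "\<tau> powr (3 / r) * \<tau> powr (- (\<alpha> / r)) = \<tau> powr x"
    by (simp add: powr_add[symmetric] x)
  also have "z powr (\<alpha> - 1 - 3 / r) * z powr (\<alpha> / r) = z powr (\<alpha> - 1) * z powr (- x)"
    by (simp add: powr_add[symmetric] x algebra_simps)
  also have "p * s powr (- \<alpha>) * \<tau> powr x * (z powr (\<alpha> - 1) * z powr (- x)) =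
      (\<tau> / p) powr x * (p * s powr (- \<alpha>) * z powr (\<alpha> - 1) * (p / z) powr x)"
    using pos z by (simp add: powr_divide powr_minus field_simps)
  also have "\<dots> \<le> (\<tau> / p) powr x * (p * s powr (- \<alpha>) * z powr (\<alpha> - 1) * (p / z) powr \<alpha>)"
    using pos z \<alpha> by (intro mult_left_mono powr_mono') (auto simp: x_def)
  also have "p * s powr (- \<alpha>) * z powr (\<alpha> - 1) * (p / z) powr \<alpha> = p powr (\<alpha> + 1) * s powr (- \<alpha>) / z"
    using pos z by (simp add: powr_divide powr_add powr_diff field_simps)
  also have "\<dots> = barrier_rate \<alpha> p s" by (simp add: barrier_rate_def z_def)
  finally show ?thesis by (simp add: z_def x_def)
qed

text \<open>Compares the far part with the rate. As \<open>\<tau> \<le> p\<close>, lowering the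
  exponent 3/r to (3 - alpha)/r enlarges the power of tau/p.\<close>

lemma barrier_far:
  fixes \<tau> p s r \<alpha> :: real
  assumes pos: "0 < \<tau>" "\<tau> \<le> p" "0 < s" "1 \<le> r" and \<alpha>: "0 < \<alpha>"
  shows "p * \<tau> powr (3 / r) * p powr (\<alpha> - 3 / r) * s powr (- \<alpha>) / (s + p)
     \<le> (\<tau> / p) powr ((3 - \<alpha>) / r) * barrier_rate \<alpha> p s"
proof -
  have p: "0 < p" using pos by simp
  have "p * \<tau> powr (3 / r) * p powr (\<alpha> - 3 / r) * s powr (- \<alpha>) / (s + p) = (\<tau> / p) powr (3 / r) * barrier_rate \<alpha> p s"
  proof -
    have 1: "p * p powr (\<alpha> - 3 / r) = p powr (\<alpha> + 1) / p powr (3 / r)"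
      using p by (simp add: powr_diff powr_add)
    have "p * \<tau> powr (3 / r) * p powr (\<alpha> - 3 / r) * s powr (- \<alpha>) / (s + p) =
        (p * p powr (\<alpha> - 3 / r)) * \<tau> powr (3 / r) * s powr (- \<alpha>) / (s + p)"
      by (simp only: mult_ac)
    then show ?thesis unfolding 1 using p pos by (simp add: barrier_rate_def powr_divide)
  qed
  also have "\<dots> \<le> (\<tau> / p) powr ((3 - \<alpha>) / r) * barrier_rate \<alpha> p s"
    using pos p \<alpha> by (intro mult_right_mono powr_mono') (auto simp: barrier_rate_def divide_right_mono)
  finally show ?thesis .
qed

text \<open>The exponents -alpha and alpha - 2 add up to -2, so the integrand is the derivative of a
  multiple of a power of (w - s)/(s + p). This closed form motivates the exponent alpha - 1 in
  \<open>barrier\<close>.\<close>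

lemma has_integral_ker_shifted_powr:
  assumes \<alpha>: "0 < \<alpha>" "\<alpha> < 1" and p: "0 < p" and w: "0 < w"
  shows "((\<lambda>s. ker \<alpha> w s * (p * ((\<alpha> - 1) * (s + p) powr (\<alpha> - 2)))) has_integral
     - (p powr \<alpha> * w powr (1 - \<alpha>) / (w + p))) {0..w}"
proof -
  define F where "F s = p / (w + p) * ((w - s) / (s + p)) powr (1 - \<alpha>)" for s
  have "((\<lambda>s. ker \<alpha> w s * (p * ((\<alpha> - 1) * (s + p) powr (\<alpha> - 2)))) has_integral F w - F 0) {0..w}"
  proof (rule fundamental_theorem_of_calculus_interior)
    show "continuous_on {0..w} F"
      unfolding F_def using \<alpha> p
      by (intro continuous_on_mult continuous_on_powr' continuous_on_divide continuous_intros ballI) auto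
    fix s assume s: "s \<in> {0<..<w}"
    define y where "y = (w - s) / (s + p)"
    have y: "0 < y" using s p by (simp add: y_def)
    have "((\<lambda>s. (w - s) / (s + p)) has_real_derivative - (w + p) / (s + p)\<^sup>2) (at s)"
      using s p by (auto intro!: derivative_eq_intros simp: field_simps power2_eq_square)
    from DERIV_powr[OF this _ DERIV_const[of "1 - \<alpha>"]] y
    have "((\<lambda>s. ((w - s) / (s + p)) powr (1 - \<alpha>)) has_real_derivative
        y powr (1 - \<alpha>) * ((- (w + p) / (s + p)\<^sup>2) * (1 - \<alpha>) / y)) (at s)"
      by (simp add: y_def)
    then have "(F has_real_derivative p / (w + p) * (y powr (1 - \<alpha>) * ((- (w + p) / (s + p)\<^sup>2) * (1 - \<alpha>) / y))) (at s)"
      unfolding F_def by (rule DERIV_cmult)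
    moreover have "p / (w + p) * (y powr (1 - \<alpha>) * ((- (w + p) / (s + p)\<^sup>2) * (1 - \<alpha>) / y)) =
        ker \<alpha> w s * (p * ((\<alpha> - 1) * (s + p) powr (\<alpha> - 2)))"
    proof -
      have 1: "y powr (1 - \<alpha>) / y = (w - s) powr (- \<alpha>) * (s + p) powr \<alpha>"
      proof -
        have "y powr (1 - \<alpha>) / y = y powr (- \<alpha>)" using y by (simp add: powr_diff powr_minus field_simps)
        also have "\<dots> = (w - s) powr (- \<alpha>) / (s + p) powr (- \<alpha>)"
          using s p by (simp add: y_def powr_divide)
        also have "\<dots> = (w - s) powr (- \<alpha>) * (s + p) powr \<alpha>"
          by (simp add: powr_minus[of "s + p"] divide_inverse)
        finally show ?thesis .
      qed
      have 2: "(s + p) powr (\<alpha> - 2) = (s + p) powr \<alpha> / (s + p)\<^sup>2"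
        using s p by (simp add: powr_diff)
      have "p / (w + p) * (y powr (1 - \<alpha>) * ((- (w + p) / (s + p)\<^sup>2) * (1 - \<alpha>) / y)) =
         p * ((\<alpha> - 1) / (s + p)\<^sup>2) * (y powr (1 - \<alpha>) / y)"
      proof -
        have *: "p / h * (Y * ((- h / Q) * (1 - \<alpha>) / y)) = p * ((\<alpha> - 1) / Q) * (Y / y)"
          if "0 < h" "0 < Q" for h Y Q :: real
          using that y by (simp add: field_simps)
        show ?thesis using w p s by (intro *) auto
      qed
      then show ?thesis unfolding 1 2 ker_def by simp
    qed
    ultimately show "(F has_vector_derivative ker \<alpha> w s * (p * ((\<alpha> - 1) * (s + p) powr (\<alpha> - 2)))) (at s)"
      by (simp add: has_real_derivative_iff_has_vector_derivative)
  qed (use w in simp)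
  moreover have "F w - F 0 = - (p powr \<alpha> * w powr (1 - \<alpha>) / (w + p))"
    using w p by (simp add: F_def powr_divide powr_diff mult_ac)
  ultimately show ?thesis by simp
qed

text \<open>The summands belong to the near part, the far part and the last interval. With 48 = 6 x
  2^3 from the third derivative and the cubed double step, 24576 = 48 x 256 x 2 and 1536 = 48 x 16 x
  2.\<close>

definition barrier_const :: "real \<Rightarrow> real \<Rightarrow> real \<Rightarrow> real" where
  "barrier_const \<alpha> K r =
     24576 * K ^ 11 + 1536 * K ^ 10 * (1 / (3 / r - \<alpha>) + 1) + 6 * K ^ 7 / (1 - \<alpha>)"

context graded_mesh
begin

lemma grading_shifted_le:
  assumes "1 \<le> j" "j \<le> M" "0 < p"
  shows "grading r t j ^ 3 \<le> t 1 powr (3 / r) * (t j + p) powr (3 - 3 / r)"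
proof -
  have p: "0 < t j" "0 < t 1" using node_pos[of j] node_pos[of 1] assms by auto
  have "grading r t j \<le> t 1 powr (1 / r) * (t j + p) powr (1 - 1 / r)"
    unfolding grading_def using p assms r1 by (intro mult_left_mono powr_mono2) auto
  then have "grading r t j ^ 3 \<le> (t 1 powr (1 / r) * (t j + p) powr (1 - 1 / r)) ^ 3"
    using grading_pos[of j] assms by (intro power_mono) auto
  also have "\<dots> = t 1 powr (3 / r) * (t j + p) powr (3 - 3 / r)"
    using p assms by (simp add: power_mult_distrib powr_power algebra_simps)
  finally show ?thesis .
qed

text \<open>At \<open>j = 1\<close> the nodes themselves have no bounded ratio, but the shifted ones
  do: t_1 + p <= 2 p <= K p. Hence V_p can be treated on the first interval as on any other.\<close>

lemma shifted_node_ratio: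
  assumes "1 \<le> j" "j \<le> M" "t 1 \<le> p"
  shows "t j + p \<le> K * (t (j - 1) + p)"
proof (cases "j = 1")
  case True
  have "2 * p \<le> K * p" using K2 first_pos assms by (intro mult_right_mono) auto
  then show ?thesis using True assms t0 by simp
next
  case False
  have "1 * p \<le> K * p" using K2 first_pos assms by (intro mult_right_mono) auto
  then show ?thesis using False node_ratio[of j] assms by (simp add: distrib_left)
qed

lemma shifted_third_derivative:
  assumes j: "1 \<le> j" "j \<le> M" and p: "t 1 \<le> p" and s: "t (j - 1) \<le> s"
  shows "\<bar>p * ((\<alpha> - 1) * ((\<alpha> - 2) * ((\<alpha> - 3) * (s + p) powr (\<alpha> - 4))))\<bar>
      \<le> 6 * p * K ^ 4 * (t j + p) powr (\<alpha> - 4)"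
proof -
  have p0: "0 < p" using first_pos j p by simp
  have t: "0 \<le> t (j - 1)" using node_mono[of 0 "j - 1"] t0 j by simp
  have tj: "0 < t j" using node_pos j by simp
  have "(s + p) powr (\<alpha> - 4) \<le> ((t j + p) / K) powr (- (4 - \<alpha>))"
  proof -
    have "K * (t (j - 1) + p) \<le> K * (s + p)" using s K2 by (intro mult_left_mono) auto
    then have "t j + p \<le> (s + p) * K" using shifted_node_ratio[OF j p] by (simp add: mult.commute)
    then have "(t j + p) / K \<le> s + p" using K2 by (simp add: pos_divide_le_eq)
    then show ?thesis using tj p0 K2 \<alpha> by (simp add: powr_mono2')
  qed
  also have "\<dots> = K powr (4 - \<alpha>) * (t j + p) powr (- (4 - \<alpha>))"
    using tj p0 K2 by (intro powr_divide_neg) auto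
  also have "\<dots> \<le> K ^ 4 * (t j + p) powr (- (4 - \<alpha>))"
  proof (rule mult_right_mono)
    have "K powr (4 - \<alpha>) \<le> K powr 4" using K2 \<alpha> by (intro powr_mono) auto
    then show "K powr (4 - \<alpha>) \<le> K ^ 4" using K2 by simp
  qed simp
  finally have b: "(s + p) powr (\<alpha> - 4) \<le> K ^ 4 * (t j + p) powr (\<alpha> - 4)" by simp
  have "\<bar>(\<alpha> - 1) * ((\<alpha> - 2) * (\<alpha> - 3))\<bar> \<le> 1 * (2 * 3)"
    unfolding abs_mult using \<alpha> by (intro mult_mono) auto
  then have "p * (\<bar>(\<alpha> - 1) * ((\<alpha> - 2) * (\<alpha> - 3))\<bar> * (s + p) powr (\<alpha> - 4)) \<le>
      p * (6 * (K ^ 4 * (t j + p) powr (\<alpha> - 4)))"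
    using b p0 by (intro mult_left_mono mult_mono) auto
  then show ?thesis using p0 by (simp add: abs_mult mult_ac)
qed

lemma barrier_truncation_inner_sum:
  assumes m: "1 \<le> m" "m \<le> M" and p: "t 1 \<le> p" and x: "\<alpha> < (3 - \<alpha>) / r"
  defines "w \<equiv> t_star \<alpha> t m"
  shows "(\<Sum>j\<in>{1..<m}. 6 * p * K ^ 4 * (t j + p) powr (\<alpha> - 4) * (t (Suc j) - t (j - 1)) ^ 3
            * (ker \<alpha> w (t j) - ker \<alpha> w (t (j - 1))))
     \<le> (24576 * K ^ 11 + 1536 * K ^ 10 * (1 / (3 / r - \<alpha>) + 1))
         * ((t 1 / p) powr ((3 - \<alpha>) / r) * barrier_rate \<alpha> p (t m))"
proof -
  interpret A: alikhanov_mesh \<alpha> t m using alikhanov_mesh m by simp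
  define \<tau> where "\<tau> = t 1"
  \<comment> \<open>The local errors decay like (t_j + p)^(-y - 1). Positivity of \<open>y\<close>,
    from alpha < (3 - alpha)/r, keeps their weighted sum bounded independently of the number of
    nodes.\<close>
  define y where "y = 3 / r - \<alpha>"
  \<comment> \<open>K^10 combines K^4 from \<open>shifted_third_derivative\<close> with (K^2)^3 from
    \<open>double_step_le\<close>.\<close>
  define c where "c = 48 * K ^ 10 * p * \<tau> powr (3 / r)"
  define E where "E j = c * (t j + p) powr (- y - 1)" for j
  define B where "B = (\<tau> / p) powr ((3 - \<alpha>) / r) * barrier_rate \<alpha> p (t m)"
  have \<tau>: "0 < \<tau>" "\<tau> \<le> p" using first_pos m p by (auto simp: \<tau>_def)
  have p0: "0 < p" using \<tau> by simp
  have tm: "0 < t m" using node_pos m by simp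
  have y: "0 < y" "y \<le> 3"
  proof -
    have "(3 - \<alpha>) / r \<le> 3 / r" using \<alpha> r1 by (intro divide_right_mono) auto
    then show "0 < y" using x by (simp add: y_def)
    have "3 / r \<le> 3" using r1 by (simp add: divide_le_eq)
    then show "y \<le> 3" using \<alpha> by (simp add: y_def)
  qed
  have c0: "0 \<le> c" using p0 K2 by (simp add: c_def)
  have kd: "0 \<le> ker \<alpha> w (t j) - ker \<alpha> w (t (j - 1))" if "j \<in> {1..<m}" for j
    using that \<alpha> A.node_lt_star[of j] node_mono[of "j - 1" j] m by (auto intro!: ker_mono simp: w_def)
  have E: "6 * p * K ^ 4 * (t j + p) powr (\<alpha> - 4) * (t (Suc j) - t (j - 1)) ^ 3 \<le> E j" if j: "j \<in> {1..<m}" for j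
  proof -
    have tj: "0 < t j" using node_pos j m by simp
    have "t (j - 1) < t (Suc j)" using j m by (intro node_strict_mono) auto
    then have "(t (Suc j) - t (j - 1)) ^ 3 \<le> (2 * K\<^sup>2 * grading r t j) ^ 3"
      using double_step_le[of j] j m by (intro power_mono) auto
    also have "\<dots> = 8 * K ^ 6 * grading r t j ^ 3" by (simp add: power_mult_distrib power_mult[symmetric])
    also have "\<dots> \<le> 8 * K ^ 6 * (\<tau> powr (3 / r) * (t j + p) powr (3 - 3 / r))"
      using grading_shifted_le[of j p] j m p0 K2 by (intro mult_left_mono) (auto simp: \<tau>_def)
    finally have "6 * p * K ^ 4 * (t j + p) powr (\<alpha> - 4) * (t (Suc j) - t (j - 1)) ^ 3 \<le>
        6 * p * K ^ 4 * (t j + p) powr (\<alpha> - 4) * (8 * K ^ 6 * (\<tau> powr (3 / r) * (t j + p) powr (3 - 3 / r)))"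
      using p0 K2 by (intro mult_left_mono) auto
    also have "\<dots> = 48 * (K ^ 4 * K ^ 6) * p * \<tau> powr (3 / r) * ((t j + p) powr (\<alpha> - 4) * (t j + p) powr (3 - 3 / r))"
      by simp
    also have "\<dots> = E j"
      by (simp add: E_def c_def y_def powr_add[symmetric] power_add[symmetric] algebra_simps)
    finally show ?thesis .
  qed
  \<comment> \<open>256 = 4^4 bounds 4^(y + 1), the loss in passing from t_j + p to t_m + p at near
    nodes.\<close>
  define N where "N = c * (256 * (t m + p) powr (- y - 1))"
  have "(\<Sum>j\<in>{1..<m}. 6 * p * K ^ 4 * (t j + p) powr (\<alpha> - 4) * (t (Suc j) - t (j - 1)) ^ 3
            * (ker \<alpha> w (t j) - ker \<alpha> w (t (j - 1))))
     \<le> (\<Sum>j\<in>{1..<m}. E j * (ker \<alpha> w (t j) - ker \<alpha> w (t (j - 1))))"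
    using E kd by (intro sum_mono mult_right_mono) auto
  also have "\<dots> \<le> N * (2 * K * grading r t m powr (- \<alpha>))
      + 16 * t m powr (- \<alpha> - 1) * (\<Sum>j\<in>{1..<m}. mesh_step t j * E j)"
    unfolding w_def
  proof (rule near_far_split[OF m subset_refl])
    show "0 \<le> E j" for j using c0 by (simp add: E_def)
    show "0 \<le> N" using c0 by (simp add: N_def)
    fix j assume j: "j \<in> {1..<m}" "t m < 4 * t j"
    have "(t j + p) powr (- y - 1) \<le> ((t m + p) / 4) powr (- (y + 1))"
      using j tm p0 y by (simp add: powr_mono2')
    also have "\<dots> = 4 powr (y + 1) * (t m + p) powr (- (y + 1))"
      using tm p0 by (intro powr_divide_neg) auto
    also have "\<dots> \<le> 256 * (t m + p) powr (- (y + 1))"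
      using powr_mono[of "y + 1" 4 "4::real"] y by (intro mult_right_mono) auto
    finally have "c * (t j + p) powr (- y - 1) \<le> c * (256 * (t m + p) powr (- y - 1))"
      using c0 by (intro mult_left_mono) auto
    then show "E j \<le> N" by (simp add: E_def N_def)
  qed
  also have "N * (2 * K * grading r t m powr (- \<alpha>)) \<le> 24576 * K ^ 11 * B"
  proof -
    have "N * (2 * K * grading r t m powr (- \<alpha>)) = 24576 * (K ^ 10 * K) *
       (p * \<tau> powr (3 / r) * (t m + p) powr (- y - 1) * grading r t m powr (- \<alpha>))"
      by (simp add: N_def c_def)
    also have "\<dots> \<le> 24576 * (K ^ 10 * K) * B"
    proof (rule mult_left_mono)
      have "(t m + p) powr (- y - 1) = (t m + p) powr (\<alpha> - 1 - 3 / r)" by (simp add: y_def algebra_simps)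
      then show "p * \<tau> powr (3 / r) * (t m + p) powr (- y - 1) * grading r t m powr (- \<alpha>) \<le> B"
        using barrier_near[OF \<tau>(1) p0 tm r1 \<alpha>(1)] x unfolding B_def grading_def \<tau>_def[symmetric] by simp
    qed (use K2 in simp)
    finally show ?thesis by (simp add: power_Suc2[symmetric])
  qed
  also have "16 * t m powr (- \<alpha> - 1) * (\<Sum>j\<in>{1..<m}. mesh_step t j * E j) \<le> 1536 * K ^ 10 * (1 / y + 1) * B"
  proof -
    have st: "0 \<le> mesh_step t j" if "j \<in> {1..m}" for j using step_pos[of j] that m by auto
    have "(\<Sum>j\<in>{1..<m}. mesh_step t j * E j) \<le> (\<Sum>j=1..m. mesh_step t j * E j)"
      using st c0 by (intro sum_mono2) (auto simp: E_def)
    also have "\<dots> = c * (\<Sum>j=1..m. mesh_step t j * (t j + p) powr (- y - 1))"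
      by (simp add: E_def sum_distrib_left mult.left_commute)
    also have "\<dots> \<le> c * ((1 / y + 1) * p powr (- y) * (2 * t m / (t m + p)))"
      using sum_step_shifted_powr_le[OF m(2) p0 y(1)] c0 by (intro mult_left_mono)
    finally have "16 * t m powr (- \<alpha> - 1) * (\<Sum>j\<in>{1..<m}. mesh_step t j * E j) \<le>
        16 * t m powr (- \<alpha> - 1) * (c * ((1 / y + 1) * p powr (- y) * (2 * t m / (t m + p))))"
      by (intro mult_left_mono) auto
    also have "\<dots> = 1536 * K ^ 10 * (1 / y + 1) *
        (p * \<tau> powr (3 / r) * p powr (- y) * (t m powr (- \<alpha> - 1) * t m) / (t m + p))"
      by (simp add: c_def)
    also have "t m powr (- \<alpha> - 1) * t m = t m powr (- \<alpha>)" using tm by (simp add: powr_diff)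
    also have "- y = \<alpha> - 3 / r" by (simp add: y_def)
    also have "1536 * K ^ 10 * (1 / y + 1) *
        (p * \<tau> powr (3 / r) * p powr (\<alpha> - 3 / r) * t m powr (- \<alpha>) / (t m + p)) \<le> 1536 * K ^ 10 * (1 / y + 1) * B"
      unfolding B_def using y K2 by (intro mult_left_mono barrier_far \<tau> tm r1 \<alpha>) auto
    finally show ?thesis .
  qed
  finally show ?thesis by (simp add: B_def y_def \<tau>_def algebra_simps)
qed


text \<open>As w <= t_m, the left side is at most the step to the power 3 - alpha. Separating the
  power -alpha of \<open>grading\<close> gives the same shape as the near part of the inner
  sums.\<close>

lemma step_cube_bound:
  assumes m: "1 \<le> m" "m \<le> M"
  shows "(mesh_step t m)\<^sup>2 * (t_star \<alpha> t m - t (m - 1)) powr (1 - \<alpha>)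
      \<le> K ^ 3 * (grading r t m ^ 3 * grading r t m powr (- \<alpha>))"
proof -
  interpret A: alikhanov_mesh \<alpha> t m using alikhanov_mesh m by simp
  define h \<theta> where "h = mesh_step t m" and "\<theta> = grading r t m"
  have h: "0 < h" "0 < \<theta>" "h \<le> K * \<theta>" using step_pos[OF m] grading_pos[OF m] step_le[OF m] by (auto simp: h_def \<theta>_def)
  have "h\<^sup>2 * (t_star \<alpha> t m - t (m - 1)) powr (1 - \<alpha>) \<le> h\<^sup>2 * h powr (1 - \<alpha>)"
    using A.star_gt A.star_le \<alpha> by (intro mult_left_mono powr_mono2) (auto simp: h_def mesh_step_def)
  also have "\<dots> = h powr (3 - \<alpha>)"
    using h powr_add[of h 2 "1 - \<alpha>"] by simp
  also have "\<dots> \<le> (K * \<theta>) powr (3 - \<alpha>)" using h \<alpha> by (intro powr_mono2) auto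
  also have "\<dots> = K powr (3 - \<alpha>) * \<theta> powr (3 - \<alpha>)" using h K2 by (simp add: powr_mult)
  also have "\<dots> \<le> K ^ 3 * \<theta> powr (3 - \<alpha>)"
  proof (rule mult_right_mono)
    have "K powr (3 - \<alpha>) \<le> K powr 3" using K2 \<alpha> by (intro powr_mono) auto
    then show "K powr (3 - \<alpha>) \<le> K ^ 3" using K2 by simp
  qed simp
  also have "\<theta> powr (3 - \<alpha>) = \<theta> ^ 3 * \<theta> powr (- \<alpha>)"
    using h powr_add[of \<theta> 3 "- \<alpha>"] by simp
  finally show ?thesis by (simp add: h_def \<theta>_def)
qed

lemma barrier_truncation_last:
  assumes m: "1 \<le> m" "m \<le> M" and p: "t 1 \<le> p" and x: "\<alpha> < (3 - \<alpha>) / r"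
  shows "6 * p * K ^ 4 * (t m + p) powr (\<alpha> - 4) * (mesh_step t m)\<^sup>2
            * ((t_star \<alpha> t m - t (m - 1)) powr (1 - \<alpha>) / (1 - \<alpha>))
     \<le> 6 * K ^ 7 / (1 - \<alpha>) * ((t 1 / p) powr ((3 - \<alpha>) / r) * barrier_rate \<alpha> p (t m))"
proof -
  define \<tau> \<theta> where "\<tau> = t 1" and "\<theta> = grading r t m"
  define c where "c = 6 * K ^ 4 / (1 - \<alpha>)"
  have \<tau>: "0 < \<tau>" "\<tau> \<le> p" using first_pos m p by (auto simp: \<tau>_def)
  have p0: "0 < p" using \<tau> by simp
  have tm: "0 < t m" using node_pos m by simp
  have c0: "0 \<le> c" using \<alpha> K2 by (simp add: c_def)
  have "6 * p * K ^ 4 * (t m + p) powr (\<alpha> - 4) * (mesh_step t m)\<^sup>2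
            * ((t_star \<alpha> t m - t (m - 1)) powr (1 - \<alpha>) / (1 - \<alpha>))
     = c * p * (t m + p) powr (\<alpha> - 4) * ((mesh_step t m)\<^sup>2 * (t_star \<alpha> t m - t (m - 1)) powr (1 - \<alpha>))"
    by (simp add: c_def)
  also have "\<dots> \<le> c * p * (t m + p) powr (\<alpha> - 4) * (K ^ 3 * (\<theta> ^ 3 * \<theta> powr (- \<alpha>)))"
    using step_cube_bound[OF m] c0 p0 by (intro mult_left_mono) (auto simp: \<theta>_def)
  also have "\<dots> \<le> c * p * (t m + p) powr (\<alpha> - 4) * (K ^ 3 * ((\<tau> powr (3 / r) * (t m + p) powr (3 - 3 / r)) * \<theta> powr (- \<alpha>)))"
    using grading_shifted_le[OF m p0] c0 p0 K2
    by (intro mult_left_mono mult_right_mono) (auto simp: \<theta>_def \<tau>_def)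
  also have "\<dots> = c * K ^ 3 * (p * \<tau> powr (3 / r) * ((t m + p) powr (\<alpha> - 4) * (t m + p) powr (3 - 3 / r)) * \<theta> powr (- \<alpha>))"
    by (simp only: mult_ac)
  also have "(t m + p) powr (\<alpha> - 4) * (t m + p) powr (3 - 3 / r) = (t m + p) powr (\<alpha> - 1 - 3 / r)"
    by (simp add: powr_add[symmetric] algebra_simps)
  also have "c * K ^ 3 * (p * \<tau> powr (3 / r) * (t m + p) powr (\<alpha> - 1 - 3 / r) * \<theta> powr (- \<alpha>))
     \<le> c * K ^ 3 * ((\<tau> / p) powr ((3 - \<alpha>) / r) * barrier_rate \<alpha> p (t m))"
    using barrier_near[OF \<tau>(1) p0 tm r1 \<alpha>(1)] x c0 K2 unfolding \<theta>_def grading_def \<tau>_def[symmetric]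
    by (intro mult_left_mono) auto
  also have "c * K ^ 3 = 6 * K ^ 7 / (1 - \<alpha>)" by (simp add: c_def power_add[symmetric])
  finally show ?thesis by (simp add: \<tau>_def)
qed

text \<open>Up to truncation the smooth part \<open>v\<close> contributes -p^alpha w^(1 - alpha)/(w
  + p), and the jump at 0 contributes at least p^alpha w^(-alpha). Together they leave p^(alpha + 1)
  w^(-alpha)/(w + p), which decreases in \<open>w\<close>, so that w <= t_m allows evaluation at
  t_m.\<close>

lemma barrier_lower:
  assumes m: "1 \<le> m" "m \<le> M" and p: "t 1 \<le> p" and x: "\<alpha> < (3 - \<alpha>) / r"
  shows "(1 - barrier_const \<alpha> K r * (t 1 / p) powr ((3 - \<alpha>) / r)) * barrier_rate \<alpha> p (t m)
     \<le> alik_sum \<alpha> t m (barrier \<alpha> t p)"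
proof -
  interpret A: alikhanov_mesh \<alpha> t m using alikhanov_mesh m by simp
  define w where "w = t_star \<alpha> t m"
  define v v1 v2 v3 :: "real \<Rightarrow> real"
    where "v s = p * (s + p) powr (\<alpha> - 1)"
      and "v1 s = p * ((\<alpha> - 1) * (s + p) powr (\<alpha> - 2))"
      and "v2 s = p * ((\<alpha> - 1) * ((\<alpha> - 2) * (s + p) powr (\<alpha> - 3)))"
      and "v3 s = p * ((\<alpha> - 1) * ((\<alpha> - 2) * ((\<alpha> - 3) * (s + p) powr (\<alpha> - 4))))" for s
  have p0: "0 < p" using first_pos m p by simp
  have tm: "0 < t m" using node_pos m by simp
  have w: "0 < w" "w \<le> t m" using A.star_pos A.star_le by (auto simp: w_def)
  have d1: "(v has_real_derivative v1 s) (at s)" if "0 \<le> s" for s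
    unfolding v_def v1_def using that p0 by (auto intro!: derivative_eq_intros)
  have d2: "(v1 has_real_derivative v2 s) (at s)" if "0 \<le> s" for s
    unfolding v1_def v2_def using that p0 by (auto intro!: derivative_eq_intros)
  have d3: "(v2 has_real_derivative v3 s) (at s)" if "0 \<le> s" for s
    unfolding v2_def v3_def using that p0 by (auto intro!: derivative_eq_intros)
  have cont: "continuous_on S v" "continuous_on S v1" "continuous_on S v2" if "\<And>s. s \<in> S \<Longrightarrow> 0 \<le> s" for S
    using that by (intro continuous_at_imp_continuous_on ballI DERIV_isCont[OF d1] DERIV_isCont[OF d2]
        DERIV_isCont[OF d3]; blast)+
  have t_nonneg: "0 \<le> t j" if "j \<le> M" for j using node_mono[of 0 j] t0 that by simp
  define bi where "bi j = 6 * p * K ^ 4 * (t j + p) powr (\<alpha> - 4) * (t (Suc j) - t (j - 1)) ^ 3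
            * (ker \<alpha> w (t j) - ker \<alpha> w (t (j - 1)))" for j
  define bl where "bl = 6 * p * K ^ 4 * (t m + p) powr (\<alpha> - 4) * (mesh_step t m)\<^sup>2
            * ((w - t (m - 1)) powr (1 - \<alpha>) / (1 - \<alpha>))"
  \<comment> \<open>The range of \<open>j\<close> is put under the quantifier so that choice yields
    one function \<open>R\<close> of \<open>j\<close>.\<close>
  have "\<exists>R. 1 \<le> j \<and> j \<le> m \<longrightarrow>
      ((\<lambda>s. ker \<alpha> w s * (newton_slope t m (\<lambda>i. v (t i)) j s - v1 s)) has_integral R)
        {t (j - 1)..if j < m then t j else w} \<and> \<bar>R\<bar> \<le> (if j < m then bi j else bl)" for j
  proof (cases "1 \<le> j \<and> j \<le> m")
    case True
    have tj: "0 \<le> t (j - 1)" using True m by (intro t_nonneg) auto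
    have cj: "continuous_on {t (j - 1)..b} v" "continuous_on {t (j - 1)..b} v1"
      "continuous_on {t (j - 1)..b} v2" for b
      by (rule cont; use tj in auto)+
    have S: "\<bar>v3 s\<bar> \<le> 6 * p * K ^ 4 * (t j + p) powr (\<alpha> - 4)" if "t (j - 1) < s" for s
      unfolding v3_def using True m p that by (intro shifted_third_derivative) auto
    show ?thesis
    proof (cases "j < m")
      case jm: True
      have "\<exists>R. ((\<lambda>s. ker \<alpha> w s * (newton_slope t m (\<lambda>i. v (t i)) j s - v1 s)) has_integral R)
        {t (j - 1)..if j < m then t j else w} \<and> \<bar>R\<bar> \<le> bi j"
        unfolding bi_def w_def
        by (rule A.truncation_inner[where ?f2.0 = v2 and ?f3.0 = v3])
          (use True jm tj S d1 d2 d3 cj in \<open>auto simp: less_imp_le\<close>)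
      then show ?thesis using jm by auto
    next
      case False
      then have jm: "j = m" using True by simp
      have "\<exists>R. ((\<lambda>s. ker \<alpha> w s * (newton_slope t m (\<lambda>i. v (t i)) m s - v1 s)) has_integral R)
        {t (m - 1)..if m < m then t m else w} \<and> \<bar>R\<bar> \<le> bl"
        unfolding bl_def w_def
        by (rule A.truncation_last[where ?f2.0 = v2 and ?f3.0 = v3])
          (use jm tj S d1 d2 d3 cj in \<open>auto simp: less_imp_le\<close>)
      then show ?thesis using jm by auto
    qed
  qed auto
  then obtain R where R: "\<And>j. 1 \<le> j \<Longrightarrow> j \<le> m \<Longrightarrow>
      ((\<lambda>s. ker \<alpha> w s * (newton_slope t m (\<lambda>i. v (t i)) j s - v1 s)) has_integral R j)
        {t (j - 1)..if j < m then t j else w}"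
    and Rb: "\<And>j. 1 \<le> j \<Longrightarrow> j \<le> m \<Longrightarrow> \<bar>R j\<bar> \<le> (if j < m then bi j else bl)"
    by metis
  define B where "B = (t 1 / p) powr ((3 - \<alpha>) / r) * barrier_rate \<alpha> p (t m)"
  have "((\<lambda>s. ker \<alpha> w s * v1 s) has_integral
       alik_sum \<alpha> t m (\<lambda>i. v (t i)) - (\<Sum>j=1..m. R j)) {0..w}"
    unfolding w_def by (rule A.truncation_sum[OF R[unfolded w_def]])
  moreover have "((\<lambda>s. ker \<alpha> w s * v1 s) has_integral - (p powr \<alpha> * w powr (1 - \<alpha>) / (w + p))) {0..w}"
    unfolding v1_def by (intro has_integral_ker_shifted_powr \<alpha> p0 w)
  ultimately have Z: "alik_sum \<alpha> t m (\<lambda>i. v (t i)) - (\<Sum>j=1..m. R j) = - (p powr \<alpha> * w powr (1 - \<alpha>) / (w + p))"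
    by (rule has_integral_unique)
  have "\<bar>\<Sum>j=1..m. R j\<bar> \<le> (\<Sum>j=1..m. \<bar>R j\<bar>)" by (rule sum_abs)
  also have "\<dots> \<le> (\<Sum>j=1..m. if j < m then bi j else bl)" using Rb by (intro sum_mono) auto
  also have "\<dots> = (\<Sum>j\<in>{1..<m}. bi j) + bl"
  proof -
    have "{1..m} = insert m {1..<m}" using m by auto
    then show ?thesis by (simp add: add.commute)
  qed
  also have "\<dots> \<le> barrier_const \<alpha> K r * B"
  proof -
    have "(\<Sum>j\<in>{1..<m}. bi j) \<le> (24576 * K ^ 11 + 1536 * K ^ 10 * (1 / (3 / r - \<alpha>) + 1)) * B"
      unfolding bi_def B_def w_def by (rule barrier_truncation_inner_sum[OF m p x])
    moreover have "bl \<le> 6 * K ^ 7 / (1 - \<alpha>) * B"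
      unfolding bl_def B_def w_def by (rule barrier_truncation_last[OF m p x])
    ultimately show ?thesis by (simp add: barrier_const_def distrib_right)
  qed
  finally have Rsum: "\<bar>\<Sum>j=1..m. R j\<bar> \<le> barrier_const \<alpha> K r * B" .
  \<comment> \<open>\<open>barrier\<close> and \<open>v\<close> differ at node 0 only, so the
    increment of index 1 exceeds that of \<open>v\<close> by v 0 = p^alpha.\<close>
  have "alik_sum \<alpha> t m (barrier \<alpha> t p) =
     (\<Sum>j=1..m. alik_coef \<alpha> t m j * (v (t j) - v (t (j - 1))) + (if j = 1 then alik_coef \<alpha> t m j * v 0 else 0))"
    unfolding alik_sum_def
  proof (rule sum.cong[OF refl])
    fix j assume "j \<in> {1..m}"
    then show "alik_coef \<alpha> t m j * (barrier \<alpha> t p j - barrier \<alpha> t p (j - 1)) =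
      alik_coef \<alpha> t m j * (v (t j) - v (t (j - 1))) + (if j = 1 then alik_coef \<alpha> t m j * v 0 else 0)"
      by (auto simp: barrier_def v_def t0 algebra_simps)
  qed
  also have "\<dots> = alik_sum \<alpha> t m (\<lambda>i. v (t i)) + alik_coef \<alpha> t m 1 * v 0"
    using m by (simp add: sum.distrib alik_sum_def)
  finally have eq: "alik_sum \<alpha> t m (barrier \<alpha> t p) = alik_sum \<alpha> t m (\<lambda>i. v (t i)) + alik_coef \<alpha> t m 1 * v 0" .
  have v0: "v 0 = p powr \<alpha>" using p0 by (simp add: v_def powr_diff)
  have "w powr (- \<alpha>) * p powr \<alpha> \<le> alik_coef \<alpha> t m 1 * v 0"
    unfolding v0 using A.coef_first_ge by (intro mult_right_mono) (auto simp: w_def)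
  moreover have "barrier_rate \<alpha> p (t m) \<le> w powr (- \<alpha>) * p powr \<alpha> - p powr \<alpha> * w powr (1 - \<alpha>) / (w + p)"
  proof -
    have "barrier_rate \<alpha> p (t m) \<le> p powr (\<alpha> + 1) * w powr (- \<alpha>) / (w + p)"
      unfolding barrier_rate_def using w p0 tm \<alpha> by (intro frac_le mult_left_mono powr_mono2') auto
    also have "\<dots> = w powr (- \<alpha>) * p powr \<alpha> - p powr \<alpha> * w powr (1 - \<alpha>) / (w + p)"
    proof -
      have "w powr (1 - \<alpha>) = w * w powr (- \<alpha>)" using w powr_add[of w 1 "- \<alpha>"] by simp
      moreover have "p powr (\<alpha> + 1) = p * p powr \<alpha>" using p0 by (simp add: powr_add)
      ultimately show ?thesis using w p0 by (simp add: field_simps)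
    qed
    finally show ?thesis .
  qed
  ultimately show ?thesis using eq Z Rsum by (simp add: B_def algebra_simps abs_le_iff)
qed

end

section \<open>Truncation error of the exact solution\<close>

lemma powr_mult_neg_powr:
  fixes x y a :: real
  assumes "0 < x" "0 < y"
  shows "x powr a * y powr (- a) = (x / y) powr a"
  using assms by (simp add: powr_divide powr_minus_divide)

text \<open>The derivative may blow up at 0, so no uniform Lipschitz bound exists. Instead C/alpha
  s^alpha - sigma u(s) is continuous at 0 and has a nonnegative derivative inside, for sigma = 1 and
  sigma = -1.\<close>

lemma abs_diff_le_powr:
  fixes u u' :: "real \<Rightarrow> real"
  assumes \<alpha>: "0 < \<alpha>" and cont: "continuous_on {0..T} u"
    and der: "\<And>s. s \<in> {0<..<T} \<Longrightarrow> (u has_real_derivative u' s) (at s)"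
    and bd: "\<And>s. s \<in> {0<..<T} \<Longrightarrow> \<bar>u' s\<bar> \<le> C * s powr (\<alpha> - 1)"
    and x: "0 \<le> x" "x \<le> T"
  shows "\<bar>u x - u 0\<bar> \<le> C / \<alpha> * x powr \<alpha>"
proof (cases "x = 0")
  case False
  have *: "\<sigma> * (u x - u 0) \<le> C / \<alpha> * x powr \<alpha>" if \<sigma>: "\<bar>\<sigma>\<bar> = 1" for \<sigma>
  proof -
    define g where "g s = C / \<alpha> * s powr \<alpha> - \<sigma> * u s" for s
    have "g 0 \<le> g x"
    proof (rule DERIV_nonneg_imp_increasing_open[where f = g and a = 0 and b = x])
      show "0 \<le> x" using x by simp
      show "continuous_on {0..x} g"
        unfolding g_def using x \<alpha> by (intro continuous_on_diff continuous_on_mult continuous_on_const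
            continuous_on_powr' continuous_on_id continuous_on_subset[OF cont] ballI) auto
      fix s assume s: "0 < s" "s < x"
      have "(g has_real_derivative C * s powr (\<alpha> - 1) - \<sigma> * u' s) (at s)"
        unfolding g_def using s x \<alpha> by (auto intro!: derivative_eq_intros der)
      moreover have "\<sigma> * u' s \<le> \<bar>u' s\<bar>"
        using abs_ge_self[of "\<sigma> * u' s"] \<sigma> by (simp add: abs_mult)
      ultimately show "\<exists>y. (g has_real_derivative y) (at s) \<and> 0 \<le> y"
        using bd[of s] s x by (intro exI[of _ "C * s powr (\<alpha> - 1) - \<sigma> * u' s"]) auto
    qed
    then show ?thesis using \<alpha> by (simp add: g_def right_diff_distrib)
  qed
  show ?thesis using *[of 1] *[of "-1"] by (simp add: abs_le_iff)
qed (use \<alpha> in simp)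

lemma (in graded_mesh) star_gap_powr:
  assumes m: "2 \<le> m" "m \<le> M"
  shows "(t_star \<alpha> t m - t 1) powr (- \<alpha> - 1) \<le> 64 * K\<^sup>2 * t m powr (- (\<alpha> + 1))"
proof -
  have tm: "0 < t m" using node_pos m by simp
  have "t m / (8 * K) \<le> t_star \<alpha> t m - t 1" using star_first_gap[OF m] K2 by (simp add: field_simps)
  then have "(t_star \<alpha> t m - t 1) powr (- \<alpha> - 1) \<le> (t m / (8 * K)) powr (- (\<alpha> + 1))"
    using tm K2 \<alpha> by (simp add: powr_mono2')
  also have "\<dots> = (8 * K) powr (\<alpha> + 1) * t m powr (- (\<alpha> + 1))"
    using tm K2 by (intro powr_divide_neg) auto
  also have "\<dots> \<le> (8 * K) powr 2 * t m powr (- (\<alpha> + 1))"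
    using K2 \<alpha> by (intro mult_right_mono powr_mono) auto
  also have "(8 * K) powr 2 = 64 * K\<^sup>2" using K2 by (simp add: power_mult_distrib)
  finally show ?thesis .
qed

definition trunc_order :: "real \<Rightarrow> real \<Rightarrow> real" where
  "trunc_order \<alpha> r = min (\<alpha> + 1) ((3 - \<alpha>) / r)"

text \<open>Sum of the two constants that \<open>sum_step_powr_le\<close> yields in the two cases of
  \<open>u_far_sum\<close>. A summand with denominator 0 has the value 0, and it is never the one
  relied on.\<close>

definition far_const :: "real \<Rightarrow> real \<Rightarrow> real \<Rightarrow> real" where
  "far_const \<alpha> K r =
     K powr \<bar>\<alpha> - trunc_order \<alpha> r\<bar> / \<bar>\<alpha> + 1 - trunc_order \<alpha> r\<bar> + K powr \<bar>\<alpha> - 3 / r\<bar> / \<bar>\<alpha> + 1 - 3 / r\<bar>"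

text \<open>The additive 1 of the derivative bounds is already absorbed into the powers. Continuity
  includes the right end \<open>t M\<close>, because \<open>truncation_last\<close> at
  \<open>m = M\<close> works on the closed last interval; derivatives are taken in the
  interior.\<close>

locale graded_solution = graded_mesh +
  fixes u u1 u2 u3 :: "real \<Rightarrow> real" and C1 C3 :: real
  assumes M1: "1 \<le> M"
    and cont: "continuous_on {0..t M} u" "continuous_on {0<..t M} u1" "continuous_on {0<..t M} u2"
    and d1: "\<And>s. s \<in> {0<..<t M} \<Longrightarrow> (u has_real_derivative u1 s) (at s)"
    and d2: "\<And>s. s \<in> {0<..<t M} \<Longrightarrow> (u1 has_real_derivative u2 s) (at s)"
    and d3: "\<And>s. s \<in> {0<..<t M} \<Longrightarrow> (u2 has_real_derivative u3 s) (at s)"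
    and b1: "\<And>s. s \<in> {0<..<t M} \<Longrightarrow> \<bar>u1 s\<bar> \<le> C1 * s powr (\<alpha> - 1)"
    and b3: "\<And>s. s \<in> {0<..<t M} \<Longrightarrow> \<bar>u3 s\<bar> \<le> C3 * s powr (\<alpha> - 3)"
begin

lemma consts_nonneg: "0 \<le> C1" "0 \<le> C3"
proof -
  have T: "0 < t M / 2" "t M / 2 < t M" using node_pos[of M] M1 by auto
  have "0 \<le> C1 * (t M / 2) powr (\<alpha> - 1)" using b1[of "t M / 2"] T by force
  moreover have "0 \<le> C3 * (t M / 2) powr (\<alpha> - 3)" using b3[of "t M / 2"] T by force
  moreover have "0 < (t M / 2) powr (\<alpha> - 1)" "0 < (t M / 2) powr (\<alpha> - 3)" using T by auto
  ultimately show "0 \<le> C1" "0 \<le> C3" by (auto simp: zero_le_mult_iff)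
qed

lemma u_holder: "0 \<le> x \<Longrightarrow> x \<le> t M \<Longrightarrow> \<bar>u x - u 0\<bar> \<le> C1 / \<alpha> * x powr \<alpha>"
  using abs_diff_le_powr[OF \<alpha>(1) cont(1) d1 b1] by simp

text \<open>Here only the Hoelder bound is available, so the interpolation error is of order
  t_1^alpha. Integration by parts multiplies it by the growth of the kernel over [0, t_1], which is
  of order t_1 t_m^(-alpha - 1).\<close>

lemma u_truncation_first:
  assumes m: "2 \<le> m" "m \<le> M"
  shows "\<exists>R. ((\<lambda>s. ker \<alpha> (t_star \<alpha> t m) s * (newton_slope t m (\<lambda>i. u (t i)) 1 s - u1 s)) has_integral R)
      {0..t 1} \<and> \<bar>R\<bar> \<le> 320 * K ^ 4 * (C1 / \<alpha>) * (t 1 / t m) powr (\<alpha> + 1)"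
proof -
  interpret A: alikhanov_mesh \<alpha> t m using alikhanov_mesh m by simp
  define H where "H = C1 / \<alpha>"
  define U where "U i = u (t i)" for i
  define e where "e s = newton_poly t m U 1 s - u s" for s
  define \<tau> w where "\<tau> = t 1" and "w = t_star \<alpha> t m"
  define P where "P = H * \<tau> powr \<alpha>"
  have H: "0 \<le> H" using consts_nonneg \<alpha> by (simp add: H_def)
  have \<tau>: "0 < \<tau>" "\<tau> < t 2" "t 2 \<le> t M" "\<tau> < t M"
    using first_pos node_strict_mono[of 1 2] node_mono[of 2 M] node_strict_mono[of 1 M] m by (auto simp: \<tau>_def)
  have \<tau>m: "0 < t m" "\<tau> \<le> t m" using node_pos m first_le by (auto simp: \<tau>_def)
  have P0: "0 \<le> P" using H by (simp add: P_def)
  have h1: "\<bar>u s - u 0\<bar> \<le> P" if "0 \<le> s" "s \<le> \<tau>" for s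
  proof -
    have "\<bar>u s - u 0\<bar> \<le> H * s powr \<alpha>" using u_holder[of s] that \<tau> by (simp add: H_def)
    also have "\<dots> \<le> P" unfolding P_def using that \<alpha> H by (intro mult_left_mono powr_mono2) auto
    finally show ?thesis .
  qed
  have h2: "\<bar>u (t 2) - u 0\<bar> \<le> K * P"
  proof -
    have "\<bar>u (t 2) - u 0\<bar> \<le> H * t 2 powr \<alpha>" using u_holder[of "t 2"] \<tau> by (simp add: H_def)
    also have "\<dots> \<le> H * (K * \<tau>) powr \<alpha>"
      using node_ratio[of 2] m \<tau> \<alpha> H by (intro mult_left_mono powr_mono2) (auto simp: \<tau>_def)
    also have "\<dots> = K powr \<alpha> * P" using K2 \<tau> by (simp add: powr_mult P_def)
    also have "\<dots> \<le> K * P" using powr_mono[of \<alpha> 1 K] K2 \<alpha> P0 by (intro mult_right_mono) auto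
    finally show ?thesis .
  qed
  have D1: "\<bar>diff_quot t U 1\<bar> \<le> P / \<tau>"
  proof -
    have "diff_quot t U 1 = (u \<tau> - u 0) / \<tau>" by (simp add: diff_quot_def mesh_step_def U_def t0 \<tau>_def)
    then show ?thesis using h1[of \<tau>] \<tau> by (simp add: abs_divide divide_right_mono)
  qed
  have D2: "\<bar>diff_quot t U 2\<bar> \<le> 2 * K\<^sup>2 * P / \<tau>"
  proof -
    have s2: "0 < mesh_step t 2" "\<tau> \<le> K * mesh_step t 2"
      using step_pos[of 2] first_le_grading[of 2] grading_le[of 2] m by (auto simp: \<tau>_def)
    have "1 * P \<le> K * P" using K2 P0 by (intro mult_right_mono) auto
    then have "\<bar>U 2 - U 1\<bar> \<le> 2 * K * P"
      using h2 h1[of \<tau>] \<tau> unfolding U_def \<tau>_def[symmetric] by linarith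
    then have "\<bar>U 2 - U 1\<bar> * \<tau> \<le> 2 * K * P * (K * mesh_step t 2)"
      using s2 \<tau> K2 P0 by (intro mult_mono) auto
    then show ?thesis
      using s2 \<tau> by (simp add: diff_quot_def abs_divide field_simps power2_eq_square)
  qed
  \<comment> \<open>The error consists of u(0) - u(s), the linear and the quadratic Newton term,
    with bounds P, P and (2 K^2 + 1) P. The last one uses \<open>D2\<close>, hence that the second
    step is at least t_1/K.\<close>
  have eb: "\<bar>e s\<bar> \<le> 5 * K\<^sup>2 * P" if s: "s \<in> {0..t 1}" for s
  proof -
    define c where "c = (diff_quot t U 2 - diff_quot t U 1) / t 2"
    have s': "0 \<le> s" "s \<le> \<tau>" using s by (auto simp: \<tau>_def)
    have e: "e s = (u 0 - u s) + diff_quot t U 1 * s + s * (s - \<tau>) * c"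
      using m by (simp add: e_def newton_poly_def U_def t0 \<tau>_def c_def numeral_2_eq_2)
    have "\<bar>diff_quot t U 1 * s\<bar> \<le> P / \<tau> * \<tau>"
      unfolding abs_mult using D1 s' \<tau> P0 by (intro mult_mono) auto
    then have 1: "\<bar>diff_quot t U 1 * s\<bar> \<le> P" using \<tau> by simp
    have "\<bar>c\<bar> \<le> (2 * K\<^sup>2 * P / \<tau> + P / \<tau>) / t 2"
      unfolding c_def abs_divide using D1 D2 \<tau> abs_triangle_ineq4[of "diff_quot t U 2" "diff_quot t U 1"]
      by (intro frac_le) auto
    also have "\<dots> \<le> (2 * K\<^sup>2 * P / \<tau> + P / \<tau>) / \<tau>"
      using \<tau> P0 K2 by (intro divide_left_mono) auto
    finally have c: "\<bar>c\<bar> \<le> (2 * K\<^sup>2 + 1) * P / (\<tau> * \<tau>)" using \<tau> by (simp add: field_simps)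
    have "\<bar>s * (s - \<tau>) * c\<bar> \<le> \<tau> * \<tau> * ((2 * K\<^sup>2 + 1) * P / (\<tau> * \<tau>))"
      unfolding abs_mult using c s' \<tau> by (intro mult_mono) auto
    then have 2: "\<bar>s * (s - \<tau>) * c\<bar> \<le> (2 * K\<^sup>2 + 1) * P" using \<tau> by simp
    have "1 * P \<le> K\<^sup>2 * P" using K2 P0 power_mono[of 1 K 2] by (intro mult_right_mono) auto
    moreover have "\<bar>e s\<bar> \<le> P + P + (2 * K\<^sup>2 + 1) * P"
      using e h1[OF s'] 1 2 by (simp add: abs_le_iff)
    ultimately show ?thesis by (simp add: algebra_simps)
  qed
  have e0: "e 0 = 0" "e (t 1) = 0"
    using A.newton_poly_nodes[of 1 U] m by (auto simp: e_def U_def t0)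
  have tw: "t 1 < w" using A.node_lt_star[of 1] m by (simp add: w_def)
  have "\<exists>I. ((\<lambda>s. ker \<alpha> w s * (newton_slope t m U 1 s - u1 s)) has_integral I) {0..t 1} \<and>
     \<bar>I\<bar> \<le> \<bar>ker \<alpha> w (t 1) * e (t 1)\<bar> + 5 * K\<^sup>2 * P * (ker \<alpha> w (t 1) - ker \<alpha> w 0)"
  proof (rule ker_by_parts)
    show "continuous_on {0..t 1} e"
      unfolding e_def using \<tau>
      by (intro continuous_intros DERIV_continuous_on[OF newton_poly_deriv] continuous_on_subset[OF cont(1)]) (auto simp: \<tau>_def)
    show "(e has_real_derivative newton_slope t m U 1 s - u1 s) (at s)" if "s \<in> {0<..<t 1}" for s
      unfolding e_def using that \<tau> by (intro derivative_intros newton_poly_deriv d1) (auto simp: \<tau>_def)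
  qed (use \<alpha> tw e0 eb \<tau> in \<open>auto simp: \<tau>_def\<close>)
  then obtain R where R: "((\<lambda>s. ker \<alpha> w s * (newton_slope t m U 1 s - u1 s)) has_integral R) {0..t 1}"
     "\<bar>R\<bar> \<le> 5 * K\<^sup>2 * P * (ker \<alpha> w (t 1) - ker \<alpha> w 0)" using e0 by auto
  have "ker \<alpha> w (t 1) - ker \<alpha> w 0 \<le> \<alpha> * (w - t 1) powr (- \<alpha> - 1) * (t 1 - 0)"
    using \<alpha> tw \<tau> by (intro ker_diff_le) (auto simp: \<tau>_def)
  also have "\<dots> \<le> 1 * (64 * K\<^sup>2 * t m powr (- (\<alpha> + 1))) * (t 1 - 0)"
  proof (intro mult_right_mono mult_mono)
    show "(w - t 1) powr (- \<alpha> - 1) \<le> 64 * K\<^sup>2 * t m powr (- (\<alpha> + 1))"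
      unfolding w_def by (rule star_gap_powr[OF m])
  qed (use \<alpha> \<tau> in \<open>auto simp: \<tau>_def\<close>)
  finally have "5 * K\<^sup>2 * P * (ker \<alpha> w (t 1) - ker \<alpha> w 0) \<le> 5 * K\<^sup>2 * P * (64 * K\<^sup>2 * t m powr (- (\<alpha> + 1)) * \<tau>)"
    using P0 by (intro mult_left_mono) (auto simp: \<tau>_def)
  also have "\<dots> = 320 * (K\<^sup>2 * K\<^sup>2) * H * ((\<tau> powr \<alpha> * \<tau>) * t m powr (- (\<alpha> + 1)))"
    by (simp add: P_def)
  also have "(\<tau> powr \<alpha> * \<tau>) * t m powr (- (\<alpha> + 1)) = (\<tau> / t m) powr (\<alpha> + 1)"
  proof -
    have "\<tau> powr \<alpha> * \<tau> = \<tau> powr (\<alpha> + 1)" using \<tau> by (simp add: powr_add)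
    then show ?thesis using powr_mult_neg_powr[of \<tau> "t m" "\<alpha> + 1"] \<tau> \<tau>m by simp
  qed
  also have "K\<^sup>2 * K\<^sup>2 = K ^ 4" by (simp add: power_add[symmetric])
  finally have "\<bar>R\<bar> \<le> 320 * K ^ 4 * H * (\<tau> / t m) powr (\<alpha> + 1)" using R(2) by linarith
  then show ?thesis using R(1) unfolding U_def[abs_def] by (auto simp: w_def H_def \<tau>_def)
qed

lemma third_derivative_le:
  assumes j: "2 \<le> j" "j \<le> M" and s: "t (j - 1) < s" "s < t M"
  shows "\<bar>u3 s\<bar> \<le> C3 * (K ^ 3 * t j powr (\<alpha> - 3))"
proof -
  have p: "0 < t (j - 1)" "0 < t j" using node_pos[of "j - 1"] node_pos[of j] j by auto
  have "\<bar>u3 s\<bar> \<le> C3 * s powr (\<alpha> - 3)" using b3[of s] s p by simp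
  also have "\<dots> \<le> C3 * (K ^ 3 * t j powr (\<alpha> - 3))"
  proof (intro mult_left_mono consts_nonneg)
    have "K * t (j - 1) \<le> K * s" using s K2 by (intro mult_left_mono) auto
    then have "t j \<le> s * K" using node_ratio[OF j] by (simp add: mult.commute)
    then have "t j / K \<le> s" using K2 by (simp add: pos_divide_le_eq)
    then have "s powr (\<alpha> - 3) \<le> (t j / K) powr (- (3 - \<alpha>))" using p K2 \<alpha> by (simp add: powr_mono2')
    also have "\<dots> = K powr (3 - \<alpha>) * t j powr (- (3 - \<alpha>))" using p K2 by (intro powr_divide_neg) auto
    also have "\<dots> \<le> K powr 3 * t j powr (- (3 - \<alpha>))" using K2 \<alpha> by (intro mult_right_mono powr_mono) auto
    finally show "s powr (\<alpha> - 3) \<le> K ^ 3 * t j powr (\<alpha> - 3)" using K2 by simp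
  qed
  finally show ?thesis .
qed

lemma far_const_nonneg: "0 \<le> far_const \<alpha> K r" by (simp add: far_const_def)

text \<open>If (3 - alpha)/r < alpha + 1, the exponent 3/r is lowered to \<open>q\<close>; then
  alpha - q > -1, the power of t_m dominates, and no logarithm arises when 3/r = alpha + 1.
  Otherwise 3/r > alpha + 1 strictly and the first node dominates.\<close>

lemma u_far_sum:
  assumes m: "2 \<le> m" "m \<le> M"
  defines "q \<equiv> trunc_order \<alpha> r"
  shows "(\<Sum>j=2..m. mesh_step t j * (t j powr \<alpha> * (t 1 / t j) powr (3 / r)))
     \<le> far_const \<alpha> K r * (t 1 powr q * t m powr (\<alpha> + 1 - q))"
proof -
  define \<tau> where "\<tau> = t 1"
  have \<tau>: "0 < \<tau>" "\<tau> \<le> t m" using first_pos first_le[of m] m by (auto simp: \<tau>_def)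
  have tj: "0 < t j" "\<tau> \<le> t j" "0 \<le> mesh_step t j" if "j \<in> {2..m}" for j
    using node_pos[of j] first_le[of j] step_pos[of j] that m by (auto simp: \<tau>_def)
  show ?thesis
  proof (cases "(3 - \<alpha>) / r < \<alpha> + 1")
    case True
    then have q: "q = (3 - \<alpha>) / r" by (simp add: q_def trunc_order_def)
    have q3: "q \<le> 3 / r" unfolding q using \<alpha> r1 by (intro divide_right_mono) auto
    define y where "y = \<alpha> - q"
    have y: "y \<noteq> -1" "0 < y + 1" using True q by (auto simp: y_def)
    have "(\<Sum>j=2..m. mesh_step t j * (t j powr \<alpha> * (\<tau> / t j) powr (3 / r))) \<le>
        (\<Sum>j=2..m. \<tau> powr q * (mesh_step t j * t j powr y))"
    proof (rule sum_mono)
      fix j assume j: "j \<in> {2..m}"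
      have "(\<tau> / t j) powr (3 / r) \<le> (\<tau> / t j) powr q"
        using tj[OF j] \<tau> q3 by (intro powr_mono') auto
      then have "mesh_step t j * (t j powr \<alpha> * (\<tau> / t j) powr (3 / r)) \<le>
          mesh_step t j * (t j powr \<alpha> * (\<tau> / t j) powr q)"
        using tj[OF j] by (intro mult_left_mono) auto
      also have "\<dots> = \<tau> powr q * (mesh_step t j * t j powr y)"
        using tj[OF j] \<tau> by (simp add: powr_divide y_def powr_diff)
      finally show "mesh_step t j * (t j powr \<alpha> * (\<tau> / t j) powr (3 / r)) \<le> \<tau> powr q * (mesh_step t j * t j powr y)" .
    qed
    also have "\<dots> = \<tau> powr q * (\<Sum>j=2..m. mesh_step t j * t j powr y)" by (simp add: sum_distrib_left)
    also have "\<dots> \<le> \<tau> powr q * (K powr \<bar>y\<bar> / (y + 1) * (t m powr (y + 1) - t 1 powr (y + 1)))"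
      using sum_step_powr_le[OF m(2) y(1)] m by (intro mult_left_mono) auto
    also have "\<dots> \<le> \<tau> powr q * (K powr \<bar>y\<bar> / (y + 1) * t m powr (y + 1))"
      using y K2 by (intro mult_left_mono) auto
    also have "\<dots> = K powr \<bar>\<alpha> - q\<bar> / \<bar>\<alpha> + 1 - q\<bar> * (\<tau> powr q * t m powr (\<alpha> + 1 - q))"
      using y by (simp add: y_def algebra_simps)
    also have "\<dots> \<le> far_const \<alpha> K r * (\<tau> powr q * t m powr (\<alpha> + 1 - q))"
      by (intro mult_right_mono) (auto simp: far_const_def q_def)
    finally show ?thesis by (simp add: \<tau>_def)
  next
    case False
    then have q: "q = \<alpha> + 1" by (simp add: q_def trunc_order_def)
    define y where "y = \<alpha> - 3 / r"
    have "(3 - \<alpha>) / r < 3 / r" using \<alpha> r1 by (intro divide_strict_right_mono) auto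
    then have y: "y \<noteq> -1" "y + 1 < 0" using False by (auto simp: y_def)
    have "(\<Sum>j=2..m. mesh_step t j * (t j powr \<alpha> * (\<tau> / t j) powr (3 / r))) =
        (\<Sum>j=2..m. \<tau> powr (3 / r) * (mesh_step t j * t j powr y))"
      using tj \<tau> by (intro sum.cong) (auto simp: powr_divide y_def powr_diff)
    also have "\<dots> = \<tau> powr (3 / r) * (\<Sum>j=2..m. mesh_step t j * t j powr y)" by (simp add: sum_distrib_left)
    also have "\<dots> \<le> \<tau> powr (3 / r) * (K powr \<bar>y\<bar> / (y + 1) * (t m powr (y + 1) - \<tau> powr (y + 1)))"
      using sum_step_powr_le[OF m(2) y(1)] m unfolding \<tau>_def by (intro mult_left_mono) auto
    also have "K powr \<bar>y\<bar> / (y + 1) * (t m powr (y + 1) - \<tau> powr (y + 1)) =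
        K powr \<bar>y\<bar> / \<bar>y + 1\<bar> * (\<tau> powr (y + 1) - t m powr (y + 1))"
      using y by (simp add: field_simps)
    also have "\<dots> \<le> K powr \<bar>y\<bar> / \<bar>y + 1\<bar> * \<tau> powr (y + 1)"
      using y K2 by (intro mult_left_mono) auto
    finally have "(\<Sum>j=2..m. mesh_step t j * (t j powr \<alpha> * (\<tau> / t j) powr (3 / r))) \<le>
        \<tau> powr (3 / r) * (K powr \<bar>y\<bar> / \<bar>y + 1\<bar> * \<tau> powr (y + 1))"
      by (simp add: mult_left_mono)
    also have "\<dots> = K powr \<bar>\<alpha> - 3 / r\<bar> / \<bar>\<alpha> + 1 - 3 / r\<bar> * (\<tau> powr (3 / r) * \<tau> powr (y + 1))"
      by (simp add: y_def algebra_simps)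
    also have "\<tau> powr (3 / r) * \<tau> powr (y + 1) = \<tau> powr q * t m powr (\<alpha> + 1 - q)"
      using \<tau> by (simp add: powr_add[symmetric] y_def q)
    also have "K powr \<bar>\<alpha> - 3 / r\<bar> / \<bar>\<alpha> + 1 - 3 / r\<bar> * (\<tau> powr q * t m powr (\<alpha> + 1 - q))
       \<le> far_const \<alpha> K r * (\<tau> powr q * t m powr (\<alpha> + 1 - q))"
      by (intro mult_right_mono) (auto simp: far_const_def)
    finally show ?thesis by (simp add: \<tau>_def)
  qed
qed

lemma grading_cube:
  assumes "1 \<le> j" "j \<le> M"
  shows "grading r t j ^ 3 = t j ^ 3 * (t 1 / t j) powr (3 / r)"
proof -
  have "((t 1 / t j) powr (1 / r)) ^ 3 = (t 1 / t j) powr (3 / r)"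
    using node_pos[of 1] node_pos[of j] assms by (simp add: powr_power)
  then show ?thesis by (simp add: grading_eq[OF assms] power_mult_distrib)
qed

lemma grading_neg_powr:
  assumes "1 \<le> j" "j \<le> M"
  shows "grading r t j powr (- \<alpha>) = t j powr (- \<alpha>) * (t 1 / t j) powr (- (\<alpha> / r))"
  using node_pos[of 1] node_pos[of j] assms unfolding grading_eq[OF assms]
  by (simp add: powr_mult powr_powr)

text \<open>In the near part of \<open>near_far_split\<close> the powers of t_m cancel and
  (t_1/t_m)^((3 - alpha)/r) remains; the far part is \<open>u_far_sum\<close> divided by t_m^(alpha
  + 1). Interval 1 is excluded, since the third derivative is unbounded there.\<close>

lemma u_inner_sum:
  assumes m: "2 \<le> m" "m \<le> M"
  defines "w \<equiv> t_star \<alpha> t m"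
  shows "(\<Sum>j\<in>{2..<m}. C3 * (K ^ 3 * t j powr (\<alpha> - 3)) * (t (Suc j) - t (j - 1)) ^ 3
            * (ker \<alpha> w (t j) - ker \<alpha> w (t (j - 1))))
     \<le> C3 * (1024 * K ^ 10 + 128 * K ^ 9 * far_const \<alpha> K r) * (t 1 / t m) powr trunc_order \<alpha> r"
proof -
  interpret A: alikhanov_mesh \<alpha> t m using alikhanov_mesh m by simp
  define \<tau> where "\<tau> = t 1"
  define q where "q = trunc_order \<alpha> r"
  define c where "c = 8 * K ^ 9 * C3"
  define E where "E j = c * (t j powr \<alpha> * (\<tau> / t j) powr (3 / r))" for j
  have c0: "0 \<le> c" using consts_nonneg K2 by (simp add: c_def)
  have \<tau>: "0 < \<tau>" using first_pos m by (simp add: \<tau>_def)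
  have tm: "0 < t m" "\<tau> \<le> t m" using node_pos m first_le by (auto simp: \<tau>_def)
  have kd: "0 \<le> ker \<alpha> w (t j) - ker \<alpha> w (t (j - 1))" if "j \<in> {2..<m}" for j
    using that \<alpha> A.node_lt_star[of j] node_mono[of "j - 1" j] m by (auto intro!: ker_mono simp: w_def)
  have E: "C3 * (K ^ 3 * t j powr (\<alpha> - 3)) * (t (Suc j) - t (j - 1)) ^ 3 \<le> E j" if j: "j \<in> {2..<m}" for j
  proof -
    have tj: "0 < t j" using node_pos j m by simp
    have "t (j - 1) < t (Suc j)" using j m by (intro node_strict_mono) auto
    then have "(t (Suc j) - t (j - 1)) ^ 3 \<le> (2 * K\<^sup>2 * grading r t j) ^ 3"
      using double_step_le[of j] j m by (intro power_mono) auto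
    also have "\<dots> = 8 * K ^ 6 * grading r t j ^ 3" by (simp add: power_mult_distrib power_mult[symmetric])
    also have "grading r t j ^ 3 = t j ^ 3 * (\<tau> / t j) powr (3 / r)"
      unfolding \<tau>_def using j m by (intro grading_cube) auto
    finally have "C3 * (K ^ 3 * t j powr (\<alpha> - 3)) * (t (Suc j) - t (j - 1)) ^ 3 \<le>
        C3 * (K ^ 3 * t j powr (\<alpha> - 3)) * (8 * K ^ 6 * (t j ^ 3 * (\<tau> / t j) powr (3 / r)))"
      using consts_nonneg K2 by (intro mult_left_mono) auto
    also have "\<dots> = 8 * (K ^ 3 * K ^ 6) * C3 * ((t j powr (\<alpha> - 3) * t j ^ 3) * (\<tau> / t j) powr (3 / r))"
      by (simp only: mult_ac)
    also have "t j powr (\<alpha> - 3) * t j ^ 3 = t j powr \<alpha>" using tj by (simp add: powr_diff)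
    also have "K ^ 3 * K ^ 6 = K ^ 9" by (simp add: power_add[symmetric])
    finally show ?thesis by (simp add: E_def c_def)
  qed
  \<comment> \<open>64 = 4^3 bounds 4^(3/r), the loss from replacing t_j by t_m at near
    nodes.\<close>
  define N where "N = c * (t m powr \<alpha> * (64 * (\<tau> / t m) powr (3 / r)))"
  have "(\<Sum>j\<in>{2..<m}. C3 * (K ^ 3 * t j powr (\<alpha> - 3)) * (t (Suc j) - t (j - 1)) ^ 3
            * (ker \<alpha> w (t j) - ker \<alpha> w (t (j - 1))))
     \<le> (\<Sum>j\<in>{2..<m}. E j * (ker \<alpha> w (t j) - ker \<alpha> w (t (j - 1))))"
    using E kd by (intro sum_mono mult_right_mono) auto
  also have "\<dots> \<le> N * (2 * K * grading r t m powr (- \<alpha>))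
      + 16 * t m powr (- \<alpha> - 1) * (\<Sum>j\<in>{2..<m}. mesh_step t j * E j)"
    unfolding w_def
  proof (rule near_far_split)
    show "1 \<le> m" "m \<le> M" "{2..<m} \<subseteq> {1..<m}" using m by auto
    show "0 \<le> E j" for j using c0 by (simp add: E_def)
    show "0 \<le> N" using c0 by (simp add: N_def)
    fix j assume j: "j \<in> {2..<m}" "t m < 4 * t j"
    have tj: "0 < t j" "t j \<le> t m" using node_pos[of j] node_mono[of j m] j m by auto
    have "(\<tau> / t j) powr (3 / r) \<le> (4 * (\<tau> / t m)) powr (3 / r)"
      using j tj tm \<tau> r1 by (intro powr_mono2) (auto simp: field_simps)
    also have "\<dots> = 4 powr (3 / r) * (\<tau> / t m) powr (3 / r)" using powr_mult[of 4 "\<tau> / t m"] by simp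
    also have "\<dots> \<le> 4 powr 3 * (\<tau> / t m) powr (3 / r)"
      using r1 by (intro mult_right_mono powr_mono) (auto simp: divide_le_eq)
    finally have "(\<tau> / t j) powr (3 / r) \<le> 64 * (\<tau> / t m) powr (3 / r)" by simp
    then show "E j \<le> N" unfolding E_def N_def
      using c0 tj \<alpha> by (intro mult_left_mono mult_mono powr_mono2) auto
  qed
  also have "N * (2 * K * grading r t m powr (- \<alpha>)) \<le> C3 * (1024 * K ^ 10) * (\<tau> / t m) powr q"
  proof -
    have "N * (2 * K * grading r t m powr (- \<alpha>)) = 1024 * (K ^ 9 * K) * C3 *
       ((t m powr \<alpha> * t m powr (- \<alpha>)) * ((\<tau> / t m) powr (3 / r) * (\<tau> / t m) powr (- (\<alpha> / r))))"
      using m by (simp add: N_def c_def grading_neg_powr \<tau>_def)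
    also have "t m powr \<alpha> * t m powr (- \<alpha>) = 1" using tm by (simp add: powr_add[symmetric])
    also have "(\<tau> / t m) powr (3 / r) * (\<tau> / t m) powr (- (\<alpha> / r)) = (\<tau> / t m) powr ((3 - \<alpha>) / r)"
      by (simp add: powr_add[symmetric] diff_divide_distrib)
    also have "1024 * (K ^ 9 * K) * C3 * (1 * (\<tau> / t m) powr ((3 - \<alpha>) / r)) \<le> 1024 * (K ^ 9 * K) * C3 * (1 * (\<tau> / t m) powr q)"
      using consts_nonneg K2 \<tau> tm by (intro mult_left_mono powr_mono') (auto simp: q_def trunc_order_def)
    finally show ?thesis by (simp add: power_Suc2[symmetric])
  qed
  also have "16 * t m powr (- \<alpha> - 1) * (\<Sum>j\<in>{2..<m}. mesh_step t j * E j) \<le>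
      C3 * (128 * K ^ 9 * far_const \<alpha> K r) * (\<tau> / t m) powr q"
  proof -
    have st: "0 \<le> mesh_step t j" if "j \<in> {2..m}" for j using step_pos[of j] that m by auto
    have "(\<Sum>j\<in>{2..<m}. mesh_step t j * E j) \<le> (\<Sum>j=2..m. mesh_step t j * E j)"
      using st c0 by (intro sum_mono2) (auto simp: E_def)
    also have "\<dots> = c * (\<Sum>j=2..m. mesh_step t j * (t j powr \<alpha> * (t 1 / t j) powr (3 / r)))"
      by (simp add: E_def sum_distrib_left mult.left_commute \<tau>_def)
    also have "\<dots> \<le> c * (far_const \<alpha> K r * (t 1 powr q * t m powr (\<alpha> + 1 - q)))"
      unfolding q_def using u_far_sum[OF m] c0 by (intro mult_left_mono)
    finally have "16 * t m powr (- \<alpha> - 1) * (\<Sum>j\<in>{2..<m}. mesh_step t j * E j) \<le>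
        16 * t m powr (- \<alpha> - 1) * (c * (far_const \<alpha> K r * (t 1 powr q * t m powr (\<alpha> + 1 - q))))"
      by (intro mult_left_mono) auto
    also have "\<dots> = C3 * (128 * K ^ 9 * far_const \<alpha> K r) *
        (\<tau> powr q * (t m powr (- \<alpha> - 1) * t m powr (\<alpha> + 1 - q)))"
      by (simp add: c_def \<tau>_def)
    also have "t m powr (- \<alpha> - 1) * t m powr (\<alpha> + 1 - q) = t m powr (- q)"
      by (simp add: powr_add[symmetric])
    also have "\<tau> powr q * t m powr (- q) = (\<tau> / t m) powr q"
      using \<tau> tm by (intro powr_mult_neg_powr) auto
    finally show ?thesis .
  qed
  finally show ?thesis by (simp add: \<tau>_def q_def algebra_simps)
qed


lemma u_truncation_last:
  assumes m: "2 \<le> m" "m \<le> M"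
  shows "\<exists>R. ((\<lambda>s. ker \<alpha> (t_star \<alpha> t m) s * (newton_slope t m (\<lambda>i. u (t i)) m s - u1 s)) has_integral R)
      {t (m - 1)..t_star \<alpha> t m} \<and> \<bar>R\<bar> \<le> C3 * K ^ 6 / (1 - \<alpha>) * (t 1 / t m) powr ((3 - \<alpha>) / r)"
proof -
  interpret A: alikhanov_mesh \<alpha> t m using alikhanov_mesh m by simp
  define w x where "w = t_star \<alpha> t m" and "x = t 1 / t m"
  define S where "S = C3 * (K ^ 3 * t m powr (\<alpha> - 3))"
  have tm: "0 < t m" "0 < t (m - 1)" "t m \<le> t M"
    using node_pos[of m] node_pos[of "m - 1"] node_mono[of m M] m by auto
  have "\<exists>R. ((\<lambda>s. ker \<alpha> w s * (newton_slope t m (\<lambda>i. u (t i)) m s - u1 s)) has_integral R)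
      {t (m - 1)..if m < m then t m else w} \<and>
      \<bar>R\<bar> \<le> S * (mesh_step t m)\<^sup>2 * ((w - t (m - 1)) powr (1 - \<alpha>) / (1 - \<alpha>))"
    unfolding w_def
  proof (rule A.truncation_last[where ?f2.0 = u2 and ?f3.0 = u3])
    show "continuous_on {t (m - 1)..t m} u" "continuous_on {t (m - 1)..t m} u1" "continuous_on {t (m - 1)..t m} u2"
      using tm by (auto intro!: continuous_on_subset[OF cont(1)] continuous_on_subset[OF cont(2)] continuous_on_subset[OF cont(3)])
    fix s assume s: "s \<in> {t (m - 1)<..<t m}"
    then have s': "s \<in> {0<..<t M}" using tm by auto
    show "(u has_real_derivative u1 s) (at s)" "(u1 has_real_derivative u2 s) (at s)"
      "(u2 has_real_derivative u3 s) (at s)" using d1 d2 d3 s' by auto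
    show "\<bar>u3 s\<bar> \<le> S" unfolding S_def using third_derivative_le[OF m] s s' by auto
  qed
  then obtain R where R: "((\<lambda>s. ker \<alpha> w s * (newton_slope t m (\<lambda>i. u (t i)) m s - u1 s)) has_integral R) {t (m - 1)..w}"
     "\<bar>R\<bar> \<le> S * (mesh_step t m)\<^sup>2 * ((w - t (m - 1)) powr (1 - \<alpha>) / (1 - \<alpha>))" by auto
  have S0: "0 \<le> S" using consts_nonneg K2 by (simp add: S_def)
  note R(2)
  also have "S * (mesh_step t m)\<^sup>2 * ((w - t (m - 1)) powr (1 - \<alpha>) / (1 - \<alpha>)) =
     S / (1 - \<alpha>) * ((mesh_step t m)\<^sup>2 * (w - t (m - 1)) powr (1 - \<alpha>))" by simp
  also have "\<dots> \<le> S / (1 - \<alpha>) * (K ^ 3 * (grading r t m ^ 3 * grading r t m powr (- \<alpha>)))"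
    unfolding w_def using step_cube_bound[of m] m S0 \<alpha> by (intro mult_left_mono) auto
  also have "\<dots> = C3 * (K ^ 3 * K ^ 3) / (1 - \<alpha>) *
      ((t m powr (\<alpha> - 3) * t m ^ 3 * t m powr (- \<alpha>)) * (x powr (3 / r) * x powr (- (\<alpha> / r))))"
    using m by (simp add: S_def grading_cube grading_neg_powr x_def)
  also have "t m powr (\<alpha> - 3) * t m ^ 3 * t m powr (- \<alpha>) = 1"
    using tm by (simp add: powr_diff powr_minus)
  also have "x powr (3 / r) * x powr (- (\<alpha> / r)) = x powr ((3 - \<alpha>) / r)"
    by (simp add: powr_add[symmetric] diff_divide_distrib)
  also have "K ^ 3 * K ^ 3 = K ^ 6" by (simp add: power_add[symmetric])
  finally show ?thesis using R(1) by (auto simp: w_def x_def)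
qed

text \<open>At level 1 one interval carries two singularities, of u' at 0 and of the kernel at
  \<open>w\<close>. They are separated at h = w/2: integration by parts on [0, h], where the kernel
  is bounded, and a direct estimate on [h, w], where u' is bounded. In both parts the powers of t_1
  cancel.\<close>

lemma u_truncation_single:
  "\<exists>R. ((\<lambda>s. ker \<alpha> (t_star \<alpha> t 1) s * (newton_slope t 1 (\<lambda>i. u (t i)) 1 s - u1 s)) has_integral R)
      {0..t_star \<alpha> t 1} \<and> \<bar>R\<bar> \<le> (C1 / \<alpha>) * (16 + 5 / (1 - \<alpha>))"
proof -
  interpret A: alikhanov_mesh \<alpha> t 1 using alikhanov_mesh M1 by simp
  define H where "H = C1 / \<alpha>"
  define \<tau> w h where "\<tau> = t 1" and "w = t_star \<alpha> t 1" and "h = t_star \<alpha> t 1 / 2"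
  define d where "d = (u \<tau> - u 0) / \<tau>"
  define e where "e s = d * s - (u s - u 0)" for s
  have H: "0 \<le> H" "C1 \<le> H" using consts_nonneg \<alpha> by (auto simp: H_def le_divide_eq mult_left_le)
  have \<tau>: "0 < \<tau>" "\<tau> \<le> t M" using first_pos first_le[of M] M1 by (auto simp: \<tau>_def)
  have w: "\<tau> / 2 \<le> w" "w < \<tau>" "0 < w" "w = 2 * h"
    using A.star_ge_half A.star_pos \<alpha> \<tau> by (auto simp: \<tau>_def w_def h_def t_star_def mesh_step_def t0)
  have h: "0 < h" "\<tau> / 4 \<le> h" "h < w" "w - h = h" using w by auto
  have slope: "newton_slope t 1 (\<lambda>i. u (t i)) 1 s = d" for s
    by (simp add: newton_slope_def diff_quot_def mesh_step_def d_def t0 \<tau>_def)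
  have hold: "\<bar>u s - u 0\<bar> \<le> H * \<tau> powr \<alpha>" if "0 \<le> s" "s \<le> \<tau>" for s
  proof -
    have "\<bar>u s - u 0\<bar> \<le> H * s powr \<alpha>" using u_holder[of s] that \<tau> by (simp add: H_def)
    also have "\<dots> \<le> H * \<tau> powr \<alpha>" using that \<alpha> H by (intro mult_left_mono powr_mono2) auto
    finally show ?thesis .
  qed
  have d: "\<bar>d\<bar> \<le> H * \<tau> powr \<alpha> / \<tau>"
    using hold[of \<tau>] \<tau> by (simp add: d_def abs_divide divide_right_mono)
  have eb: "\<bar>e s\<bar> \<le> 2 * H * \<tau> powr \<alpha>" if "0 \<le> s" "s \<le> \<tau>" for s
  proof -
    have "\<bar>d * s\<bar> \<le> H * \<tau> powr \<alpha> / \<tau> * \<tau>"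
      unfolding abs_mult using d that \<tau> H by (intro mult_mono) auto
    then have "\<bar>d * s\<bar> \<le> H * \<tau> powr \<alpha>" using \<tau> by simp
    then show ?thesis using hold[OF that] unfolding e_def by (simp add: abs_le_iff)
  qed
  have "\<exists>I. ((\<lambda>s. ker \<alpha> w s * (d - u1 s)) has_integral I) {0..h} \<and>
     \<bar>I\<bar> \<le> \<bar>ker \<alpha> w h * e h\<bar> + 2 * H * \<tau> powr \<alpha> * (ker \<alpha> w h - ker \<alpha> w 0)"
  proof (rule ker_by_parts)
    show "continuous_on {0..h} e" unfolding e_def using h w \<tau>
      by (intro continuous_intros continuous_on_subset[OF cont(1)]) auto
    show "(e has_real_derivative d - u1 s) (at s)" if "s \<in> {0<..<h}" for s
    proof -
      have "(u has_real_derivative u1 s) (at s)" using that h w \<tau> by (intro d1) auto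
      then show ?thesis unfolding e_def by (auto intro!: derivative_eq_intros)
    qed
  qed (use \<alpha> h w eb in \<open>auto simp: e_def\<close>)
  then obtain I where I: "((\<lambda>s. ker \<alpha> w s * (d - u1 s)) has_integral I) {0..h}"
     "\<bar>I\<bar> \<le> \<bar>ker \<alpha> w h * e h\<bar> + 2 * H * \<tau> powr \<alpha> * (ker \<alpha> w h - ker \<alpha> w 0)" by blast
  have Ib: "\<bar>I\<bar> \<le> 16 * H"
  proof -
    have k: "0 \<le> ker \<alpha> w s" for s by (simp add: ker_def)
    have "\<bar>ker \<alpha> w h * e h\<bar> \<le> ker \<alpha> w h * (2 * H * \<tau> powr \<alpha>)"
      unfolding abs_mult using eb[of h] h w k by (intro mult_mono) auto
    moreover have "2 * H * \<tau> powr \<alpha> * (ker \<alpha> w h - ker \<alpha> w 0) \<le> 2 * H * \<tau> powr \<alpha> * ker \<alpha> w h"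
      using H k by (intro mult_left_mono) auto
    ultimately have "\<bar>I\<bar> \<le> ker \<alpha> w h * (2 * H * \<tau> powr \<alpha>) + 2 * H * \<tau> powr \<alpha> * ker \<alpha> w h"
      using I(2) by linarith
    also have "\<dots> = 4 * H * (\<tau> powr \<alpha> * ker \<alpha> w h)" by simp
    also have "ker \<alpha> w h \<le> (\<tau> / 4) powr (- \<alpha>)"
      unfolding ker_def using h \<tau> \<alpha> by (intro powr_mono2') auto
    also have "(\<tau> / 4) powr (- \<alpha>) = 4 powr \<alpha> * \<tau> powr (- \<alpha>)" using \<tau> by (intro powr_divide_neg) auto
    also have "4 * H * (\<tau> powr \<alpha> * (4 powr \<alpha> * \<tau> powr (- \<alpha>))) = 4 * H * 4 powr \<alpha>"
      using \<tau> by (simp add: powr_minus)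
    also have "\<dots> \<le> 4 * H * 4"
      using powr_mono[of \<alpha> 1 "4::real"] \<alpha> H by (intro mult_left_mono) auto
    finally show ?thesis using H by (simp add: mult_left_mono)
  qed
  have sub: "{h..w} \<subseteq> {0<..t M}" using h w \<tau> by auto
  have "(\<lambda>s. ker \<alpha> w s * (d - u1 s)) integrable_on {h..w}"
  proof (rule ker_mult_integrable[OF \<alpha> h(3)])
    show "continuous_on {h..w} (\<lambda>s. d - u1 s)" "continuous_on {h..w} (\<lambda>s. 0 - u2 s)"
      using sub by (intro continuous_intros continuous_on_subset[OF cont(2)] continuous_on_subset[OF cont(3)]; simp)+
    show "((\<lambda>s. d - u1 s) has_real_derivative 0 - u2 s) (at s)" if "s \<in> {h<..<w}" for s
      using that h w \<tau> by (intro derivative_intros d2) auto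
  qed
  then obtain J where J: "((\<lambda>s. ker \<alpha> w s * (d - u1 s)) has_integral J) {h..w}" by blast
  have Jb: "\<bar>J\<bar> \<le> 5 * H / (1 - \<alpha>)"
  proof -
    have "\<bar>J\<bar> \<le> 5 * H * \<tau> powr (\<alpha> - 1) * ((w - h) powr (1 - \<alpha>) / (1 - \<alpha>))"
    proof (rule ker_mult_integral_bound[OF \<alpha> h(3) J])
      fix s assume s: "s \<in> {h..w}"
      have "\<bar>u1 s\<bar> \<le> C1 * s powr (\<alpha> - 1)" using s h w \<tau> by (intro b1) auto
      also have "\<dots> \<le> H * (\<tau> / 4) powr (- (1 - \<alpha>))"
        using s h \<tau> \<alpha> H consts_nonneg by (intro mult_mono) (auto intro!: powr_mono2')
      also have "\<dots> = H * (4 powr (1 - \<alpha>) * \<tau> powr (\<alpha> - 1))"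
        using powr_divide_neg[of \<tau> 4 "1 - \<alpha>"] \<tau> by simp
      also have "\<dots> \<le> H * (4 * \<tau> powr (\<alpha> - 1))"
        using powr_mono[of "1 - \<alpha>" 1 "4::real"] \<alpha> H by (intro mult_left_mono mult_right_mono) auto
      finally have "\<bar>u1 s\<bar> \<le> H * (4 * \<tau> powr (\<alpha> - 1))" .
      moreover have "\<bar>d\<bar> \<le> H * \<tau> powr (\<alpha> - 1)" using d \<tau> by (simp add: powr_diff)
      ultimately show "\<bar>d - u1 s\<bar> \<le> 5 * H * \<tau> powr (\<alpha> - 1)" by (simp add: abs_le_iff)
    qed
    also have "\<dots> \<le> 5 * H * \<tau> powr (\<alpha> - 1) * (\<tau> powr (1 - \<alpha>) / (1 - \<alpha>))"
      using h w \<alpha> H by (intro mult_left_mono divide_right_mono powr_mono2) auto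
    also have "\<dots> = 5 * H / (1 - \<alpha>)" using \<tau> by (simp add: powr_diff)
    finally show ?thesis .
  qed
  have "((\<lambda>s. ker \<alpha> w s * (d - u1 s)) has_integral I + J) {0..w}"
    using h by (intro has_integral_combine[OF _ _ I(1) J]) auto
  moreover have "\<bar>I + J\<bar> \<le> H * (16 + 5 / (1 - \<alpha>))"
    using Ib Jb abs_triangle_ineq[of I J] by (simp add: algebra_simps)
  ultimately show ?thesis unfolding slope by (auto simp: w_def H_def)
qed

definition "truncation_const = 320 * K ^ 4 * (C1 / \<alpha>) + C3 * (1024 * K ^ 10 + 128 * K ^ 9 * far_const \<alpha> K r)
   + C3 * K ^ 6 / (1 - \<alpha>) + (C1 / \<alpha>) * (16 + 5 / (1 - \<alpha>))"

lemma u_truncation: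
  assumes m: "1 \<le> m" "m \<le> M"
  shows "\<exists>Z. ((\<lambda>s. ker \<alpha> (t_star \<alpha> t m) s * u1 s) has_integral Z) {0..t_star \<alpha> t m} \<and>
     \<bar>alik_sum \<alpha> t m (\<lambda>i. u (t i)) - Z\<bar> \<le> truncation_const * (t 1 / t m) powr trunc_order \<alpha> r"
proof -
  interpret A: alikhanov_mesh \<alpha> t m using alikhanov_mesh m by simp
  define w x q where "w = t_star \<alpha> t m" and "x = t 1 / t m" and "q = trunc_order \<alpha> r"
  have x: "0 < x" "x \<le> 1" using first_pos first_le[OF m] node_pos[OF m] m by (auto simp: x_def)
  have nn: "0 \<le> 320 * K ^ 4 * (C1 / \<alpha>)" "0 \<le> C3 * (1024 * K ^ 10 + 128 * K ^ 9 * far_const \<alpha> K r)"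
    "0 \<le> C3 * K ^ 6 / (1 - \<alpha>)" "0 \<le> (C1 / \<alpha>) * (16 + 5 / (1 - \<alpha>))"
    using consts_nonneg \<alpha> K2 far_const_nonneg by auto
  define bi where "bi j = C3 * (K ^ 3 * t j powr (\<alpha> - 3)) * (t (Suc j) - t (j - 1)) ^ 3
            * (ker \<alpha> w (t j) - ker \<alpha> w (t (j - 1)))" for j
  define b0 where "b0 = 320 * K ^ 4 * (C1 / \<alpha>) * x powr (\<alpha> + 1)"
  define bl where "bl = C3 * K ^ 6 / (1 - \<alpha>) * x powr ((3 - \<alpha>) / r)"
  have key: "\<exists>R. (\<forall>j. 1 \<le> j \<and> j \<le> m \<longrightarrow>
        ((\<lambda>s. ker \<alpha> w s * (newton_slope t m (\<lambda>i. u (t i)) j s - u1 s)) has_integral R j)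
          {t (j - 1)..if j < m then t j else w}) \<and>
        \<bar>\<Sum>j=1..m. R j\<bar> \<le> truncation_const * x powr q"
  proof (cases "m = 1")
    case True
    obtain R where R: "((\<lambda>s. ker \<alpha> w s * (newton_slope t m (\<lambda>i. u (t i)) 1 s - u1 s)) has_integral R) {0..w}"
      "\<bar>R\<bar> \<le> (C1 / \<alpha>) * (16 + 5 / (1 - \<alpha>))"
      using u_truncation_single True by (auto simp: w_def)
    \<comment> \<open>At level 1 the power of t_1/t_m is 1, so a constant bound is what is
      required.\<close>
    have "x = 1" using True first_pos M1 by (simp add: x_def)
    then have "\<bar>R\<bar> \<le> truncation_const * x powr q" using R(2) nn by (simp add: truncation_const_def)
    moreover have "\<forall>j. 1 \<le> j \<and> j \<le> m \<longrightarrow> j = 1" using True by auto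
    ultimately show ?thesis using R(1) True by (intro exI[of _ "\<lambda>j. R"]) (auto simp: t0)
  next
    case False
    then have m2: "2 \<le> m" using m by simp
    have "\<exists>R. 1 \<le> j \<and> j \<le> m \<longrightarrow>
      ((\<lambda>s. ker \<alpha> w s * (newton_slope t m (\<lambda>i. u (t i)) j s - u1 s)) has_integral R)
        {t (j - 1)..if j < m then t j else w} \<and> \<bar>R\<bar> \<le> (if j = 1 then b0 else if j < m then bi j else bl)" for j
    proof -
      consider "\<not> (1 \<le> j \<and> j \<le> m)" | "j = 1" | "2 \<le> j" "j < m" | "j = m" by linarith
      then show ?thesis
      proof cases
        case 2
        then show ?thesis using u_truncation_first[OF m2 m(2)] m2 by (auto simp: t0 w_def b0_def x_def)
      next
        case 3
        have tj: "0 < t (j - 1)" "t (Suc j) \<le> t M"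
          using node_pos[of "j - 1"] node_mono[of "Suc j" M] 3 m by auto
        have "\<exists>R. ((\<lambda>s. ker \<alpha> w s * (newton_slope t m (\<lambda>i. u (t i)) j s - u1 s)) has_integral R)
          {t (j - 1)..if j < m then t j else w} \<and> \<bar>R\<bar> \<le> bi j"
          unfolding bi_def w_def
        proof (rule A.truncation_inner[where ?f2.0 = u2 and ?f3.0 = u3])
          show "continuous_on {t (j - 1)..t (Suc j)} u"
            using tj by (intro continuous_on_subset[OF cont(1)]) auto
          fix s assume s: "s \<in> {t (j - 1)<..<t (Suc j)}"
          then have s': "s \<in> {0<..<t M}" using tj by auto
          show "(u has_real_derivative u1 s) (at s)" "(u1 has_real_derivative u2 s) (at s)"
            "(u2 has_real_derivative u3 s) (at s)" using d1 d2 d3 s' by auto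
          show "\<bar>u3 s\<bar> \<le> C3 * (K ^ 3 * t j powr (\<alpha> - 3))"
            using third_derivative_le[of j s] 3 m s s' by auto
        qed (use 3 in auto)
        then show ?thesis using 3 by auto
      next
        case 4
        then show ?thesis using u_truncation_last[OF m2 m(2)] m2 by (auto simp: w_def bl_def x_def)
      qed auto
    qed
    then obtain R where R: "\<And>j. 1 \<le> j \<Longrightarrow> j \<le> m \<Longrightarrow>
      ((\<lambda>s. ker \<alpha> w s * (newton_slope t m (\<lambda>i. u (t i)) j s - u1 s)) has_integral R j)
        {t (j - 1)..if j < m then t j else w}"
      and Rb: "\<And>j. 1 \<le> j \<Longrightarrow> j \<le> m \<Longrightarrow> \<bar>R j\<bar> \<le> (if j = 1 then b0 else if j < m then bi j else bl)"
      by metis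
    have "\<bar>\<Sum>j=1..m. R j\<bar> \<le> (\<Sum>j=1..m. \<bar>R j\<bar>)" by (rule sum_abs)
    also have "\<dots> \<le> (\<Sum>j=1..m. if j = 1 then b0 else if j < m then bi j else bl)" using Rb by (intro sum_mono) auto
    also have "\<dots> = b0 + (\<Sum>j\<in>{2..<m}. bi j) + bl"
    proof -
      have "{1..m} = insert 1 (insert m {2..<m})" using m2 by auto
      then show ?thesis using m2 by simp
    qed
    also have "\<dots> \<le> 320 * K ^ 4 * (C1 / \<alpha>) * x powr q + C3 * (1024 * K ^ 10 + 128 * K ^ 9 * far_const \<alpha> K r) * x powr q
        + C3 * K ^ 6 / (1 - \<alpha>) * x powr q"
    proof (intro add_mono)
      show "b0 \<le> 320 * K ^ 4 * (C1 / \<alpha>) * x powr q"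
        unfolding b0_def using nn x by (intro mult_left_mono powr_mono') (auto simp: q_def trunc_order_def)
      show "bl \<le> C3 * K ^ 6 / (1 - \<alpha>) * x powr q"
        unfolding bl_def using nn x by (intro mult_left_mono powr_mono') (auto simp: q_def trunc_order_def)
      show "(\<Sum>j\<in>{2..<m}. bi j) \<le> C3 * (1024 * K ^ 10 + 128 * K ^ 9 * far_const \<alpha> K r) * x powr q"
        unfolding bi_def w_def x_def q_def by (rule u_inner_sum[OF m2 m(2)])
    qed
    also have "\<dots> \<le> truncation_const * x powr q"
      using mult_nonneg_nonneg[OF nn(4) powr_ge_zero[of x q]]
      unfolding truncation_const_def distrib_right by linarith
    finally show ?thesis using R by (intro exI[of _ R] conjI allI impI) auto
  qed
  then obtain R where R: "\<And>j. 1 \<le> j \<Longrightarrow> j \<le> m \<Longrightarrow>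
        ((\<lambda>s. ker \<alpha> w s * (newton_slope t m (\<lambda>i. u (t i)) j s - u1 s)) has_integral R j)
          {t (j - 1)..if j < m then t j else w}"
    and Rs: "\<bar>\<Sum>j=1..m. R j\<bar> \<le> truncation_const * x powr q" by blast
  have "((\<lambda>s. ker \<alpha> w s * u1 s) has_integral
       alik_sum \<alpha> t m (\<lambda>i. u (t i)) - (\<Sum>j=1..m. R j)) {0..w}"
    unfolding w_def by (rule A.truncation_sum[OF R[unfolded w_def]])
  then show ?thesis using Rs
    by (intro exI[of _ "alik_sum \<alpha> t m (\<lambda>i. u (t i)) - (\<Sum>j=1..m. R j)"]) (simp add: w_def x_def q_def)
qed

end

section \<open>Stability\<close>

text \<open>
  The first ratio \<open>\<rho>\<^sub>1\<close> is not restricted by the second alternative of the mesh condition, so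
  the coefficient of \<open>U 2\<close> may have the wrong sign.  Lowering the second coefficient moves the
  excess to \<open>U 1\<close> and restores the sign pattern.
\<close>

definition adj_coef :: "real \<Rightarrow> (nat \<Rightarrow> real) \<Rightarrow> nat \<Rightarrow> nat \<Rightarrow> real" where
  "adj_coef \<alpha> t m j =
     (if j = 2 \<and> 3 \<le> m then min (alik_coef \<alpha> t m 2) (alik_coef \<alpha> t m 3) else alik_coef \<alpha> t m j)"

definition adj_sum :: "real \<Rightarrow> (nat \<Rightarrow> real) \<Rightarrow> nat \<Rightarrow> (nat \<Rightarrow> real) \<Rightarrow> real" where
  "adj_sum \<alpha> t m U = (\<Sum>j=1..m. adj_coef \<alpha> t m j * (U j - U (j - 1)))"

definition adj_excess :: "real \<Rightarrow> (nat \<Rightarrow> real) \<Rightarrow> nat \<Rightarrow> real" where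
  "adj_excess \<alpha> t m = (if 3 \<le> m then max 0 (alik_coef \<alpha> t m 2 - alik_coef \<alpha> t m 3) else 0)"

lemma adj_excess_nonneg: "0 \<le> adj_excess \<alpha> t m"
  by (simp add: adj_excess_def)

lemma adj_sum_eq: "adj_sum \<alpha> t m U = alik_sum \<alpha> t m U - adj_excess \<alpha> t m * (U 2 - U 1)"
proof (cases "3 \<le> m")
  case True
  have "adj_sum \<alpha> t m U = (\<Sum>j=1..m. alik_coef \<alpha> t m j * (U j - U (j - 1))
      - (if j = 2 then adj_excess \<alpha> t m * (U j - U (j - 1)) else 0))"
    unfolding adj_sum_def
    by (rule sum.cong[OF refl]) (use True in \<open>auto simp: adj_coef_def adj_excess_def min_def max_def algebra_simps\<close>)
  also have "\<dots> = alik_sum \<alpha> t m U - adj_excess \<alpha> t m * (U 2 - U 1)"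
    using True by (simp add: sum_subtractf alik_sum_def)
  finally show ?thesis .
qed (simp add: adj_sum_def adj_coef_def adj_excess_def alik_sum_def)

section \<open>Sums over dyadic scales\<close>

lemma exists_dyadic_ge:
  fixes y :: real
  assumes "1 \<le> y" "y \<le> 2 ^ N"
  shows "\<exists>k\<le>N. y \<le> 2 ^ k \<and> 2 ^ k \<le> 2 * y"
proof -
  define k where "k = (LEAST k. y \<le> 2 ^ k)"
  have k: "y \<le> 2 ^ k" "k \<le> N" unfolding k_def using assms by (auto intro: LeastI Least_le)
  have "(2::real) ^ k \<le> 2 * y"
  proof (cases k)
    case (Suc i)
    have "\<not> y \<le> 2 ^ i" using not_less_Least[of i "\<lambda>k. y \<le> 2 ^ k"] Suc by (simp add: k_def)
    then show ?thesis using Suc by simp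
  qed (use assms in simp)
  then show ?thesis using k by blast
qed

text \<open>This is \<open>error_bound\<close> with t_1 in place of M^(-r). For the truncation
  order, q > 1, q = 1 and q < 1 mean r < 3 - alpha, r = 3 - alpha and r > 3 - alpha.\<close>

definition growth :: "real \<Rightarrow> real \<Rightarrow> real \<Rightarrow> real \<Rightarrow> real" where
  "growth \<alpha> q \<tau> s =
     (if 1 < q then \<tau> * s powr (\<alpha> - 1)
      else if q = 1 then \<tau> * s powr (\<alpha> - 1) * (1 + ln (s / \<tau>))
      else \<tau> powr q * s powr (\<alpha> - q))"

definition geom_const :: "real \<Rightarrow> real" where
  "geom_const q =
     (if 1 < q then 1 / (1 - 2 powr (1 - q)) else if q = 1 then 2
      else 2 * 2 powr (1 - q) / (2 powr (1 - q) - 1))"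

text \<open>According to whether the ratio z = 2^(1 - q) is below, equal to or above 1, the sum is
  bounded, counts the scales between tau and s, or is dominated by its last term of order (s/tau)^(1
  - q).\<close>

lemma dyadic_sum_le:
  assumes q: "0 < q" and \<tau>: "0 < \<tau>" "\<tau> \<le> s" and N: "2 ^ N * \<tau> \<le> 2 * s"
  shows "\<tau> * s powr (\<alpha> - 1) * (\<Sum>k\<le>N. (2 powr (1 - q)) ^ k) \<le> geom_const q * growth \<alpha> q \<tau> s"
proof -
  define z where "z = (2::real) powr (1 - q)"
  have s: "0 < s" using \<tau> by simp
  have z0: "0 < z" by (simp add: z_def)
  consider "1 < q" | "q = 1" | "q < 1" by linarith
  then show ?thesis
  proof cases
    case 1
    have z1: "z < 1" using 1 powr_less_mono[of "1 - q" 0 "2::real"] by (simp add: z_def)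
    have "(\<Sum>k\<le>N. z ^ k) = (1 - z ^ Suc N) / (1 - z)"
      using z1 sum_gp0[of z N] by simp
    also have "\<dots> \<le> 1 / (1 - z)" using z0 z1 by (intro divide_right_mono) auto
    finally have "\<tau> * s powr (\<alpha> - 1) * (\<Sum>k\<le>N. z ^ k) \<le> \<tau> * s powr (\<alpha> - 1) * (1 / (1 - z))"
      using \<tau> by (intro mult_left_mono) auto
    then show ?thesis using 1 by (simp add: growth_def geom_const_def z_def mult.commute)
  next
    case 2
    have sum: "(\<Sum>k\<le>N. z ^ k) = real N + 1" using 2 by (simp add: z_def)
    have l: "0 \<le> ln (s / \<tau>)" using \<tau> s by simp
    have "2 ^ N \<le> 2 * (s / \<tau>)" using N \<tau> by (simp add: field_simps)
    then have "ln (2 ^ N) \<le> ln (2 * (s / \<tau>))" using \<tau> s by (subst ln_le_cancel_iff) auto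
    also have "\<dots> = ln 2 + ln (s / \<tau>)" using \<tau> s by (intro ln_mult_pos) auto
    finally have n: "real N * ln 2 \<le> ln 2 + ln (s / \<tau>)" by (simp add: ln_realpow)
    \<comment> \<open>This is ln (1 + x) <= x at x = -1/2.\<close>
    have "1 / 2 \<le> ln (2::real)"
      using ln_add_one_self_le_self2[of "- (1 / 2)"] by (simp add: ln_div)
    have "real N + 1 \<le> 2 * (1 + ln (s / \<tau>))"
    proof -
      have "(real N - 1) * ln 2 \<le> ln (s / \<tau>)" using n by (simp add: algebra_simps)
      moreover have "(real N - 1) * (1 / 2) \<le> (real N - 1) * ln 2" if "1 \<le> N"
        using that \<open>1 / 2 \<le> ln 2\<close> by (intro mult_left_mono) auto
      ultimately show ?thesis using l by (cases "1 \<le> N") (auto simp: field_simps)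
    qed
    then have "\<tau> * s powr (\<alpha> - 1) * (real N + 1) \<le> \<tau> * s powr (\<alpha> - 1) * (2 * (1 + ln (s / \<tau>)))"
      using \<tau> by (intro mult_left_mono) auto
    then show ?thesis using 2 sum by (simp add: growth_def geom_const_def z_def[symmetric] algebra_simps)
  next
    case 3
    have z1: "1 < z" using 3 powr_less_mono[of 0 "1 - q" "2::real"] by (simp add: z_def)
    have "(\<Sum>k\<le>N. z ^ k) = (z ^ Suc N - 1) / (z - 1)"
      using z1 sum_gp0[of z N] by (simp add: divide_simps) (simp add: algebra_simps)
    also have "\<dots> \<le> z * z ^ N / (z - 1)" using z1 by (intro divide_right_mono) auto
    also have "z ^ N = (2 ^ N) powr (1 - q)"
      unfolding z_def by (simp add: powr_power powr_realpow[symmetric] powr_powr mult.commute)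
    also have "z * (2 ^ N) powr (1 - q) / (z - 1) \<le> z * (2 * (s / \<tau>)) powr (1 - q) / (z - 1)"
      using N \<tau> s 3 z0 z1 by (intro divide_right_mono mult_left_mono powr_mono2) (auto simp: field_simps)
    also have "(2 * (s / \<tau>)) powr (1 - q) = z * (s / \<tau>) powr (1 - q)"
      using powr_mult[of 2 "s / \<tau>" "1 - q"] \<tau> s by (simp add: z_def)
    also have "z * (z * (s / \<tau>) powr (1 - q)) / (z - 1) = z * z / (z - 1) * (s / \<tau>) powr (1 - q)" by simp
    also have "\<dots> \<le> 2 * z / (z - 1) * (s / \<tau>) powr (1 - q)"
    proof (intro mult_right_mono divide_right_mono)
      show "z \<le> 2" using powr_mono[of "1 - q" 1 "2::real"] q by (simp add: z_def)
    qed (use z1 in auto)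
    finally have "\<tau> * s powr (\<alpha> - 1) * (\<Sum>k\<le>N. z ^ k) \<le>
        \<tau> * s powr (\<alpha> - 1) * (2 * z / (z - 1) * (s / \<tau>) powr (1 - q))"
      using \<tau> by (intro mult_left_mono) auto
    also have "\<dots> = 2 * z / (z - 1) * (\<tau> powr q * s powr (\<alpha> - q))"
    proof -
      have eq: "\<tau> * s powr (\<alpha> - 1) * (s / \<tau>) powr (1 - q) = \<tau> powr q * s powr (\<alpha> - q)"
        using \<tau> s by (simp add: powr_divide powr_diff)
      have "\<tau> * s powr (\<alpha> - 1) * (2 * z / (z - 1) * (s / \<tau>) powr (1 - q)) =
          2 * z / (z - 1) * (\<tau> * s powr (\<alpha> - 1) * (s / \<tau>) powr (1 - q))"
        by (simp only: mult_ac)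
      then show ?thesis unfolding eq .
    qed
    finally show ?thesis using 3 by (simp add: growth_def geom_const_def z_def)
  qed
qed

text \<open>\<open>coef_mono\<close> at \<open>j\<close> involves the ratio of index j - 1, and the
  mesh condition controls ratios from index 2 on; hence the range starts at 3.\<close>

locale monotone_graded_mesh = graded_mesh +
  assumes ratio: "\<And>j. \<lbrakk>3 \<le> j; j < M\<rbrakk> \<Longrightarrow>
     mesh_step t (j - 1) ^ 3 / (mesh_step t j * (mesh_step t (j - 1) + mesh_step t j))
       \<le> 3 * mesh_step t j + (mesh_step t j)\<^sup>2 / mesh_step t (Suc j)"
begin

text \<open>Index 1 is settled on every mesh by \<open>coef_first_le\<close>, index 2 by the
  minimum, and the higher indices by the ratio inequality.\<close>

lemma adj_coef_mono:
  assumes m: "m \<le> M" and j: "1 \<le> j" "j < m"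
  shows "adj_coef \<alpha> t m j \<le> adj_coef \<alpha> t m (Suc j)"
proof -
  interpret A: alikhanov_mesh \<alpha> t m using alikhanov_mesh m j by simp
  consider "j = 1" | "j = 2" | "3 \<le> j" using j by linarith
  then show ?thesis
  proof cases
    case 1
    then show ?thesis using A.coef_first_le[of 2] A.coef_first_le[of 3] j by (auto simp: adj_coef_def numeral_2_eq_2)
  next
    case 2
    then show ?thesis using j by (auto simp: adj_coef_def numeral_3_eq_3)
  next
    case 3
    then show ?thesis using A.coef_mono[of j] ratio[of j] m j by (auto simp: adj_coef_def)
  qed
qed

lemma adj_coef_first_ge:
  assumes m: "1 \<le> m" "m \<le> M"
  shows "t m powr (- \<alpha>) \<le> adj_coef \<alpha> t m 1"
proof -
  interpret A: alikhanov_mesh \<alpha> t m using alikhanov_mesh m by simp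
  have "t m powr (- \<alpha>) \<le> t_star \<alpha> t m powr (- \<alpha>)"
    using A.star_pos A.star_le \<alpha> by (intro powr_mono2') auto
  then show ?thesis using A.coef_first_ge by (simp add: adj_coef_def)
qed

lemma adj_coef_ge_first:
  assumes m: "m \<le> M" and j: "1 \<le> j" "j \<le> m"
  shows "adj_coef \<alpha> t m 1 \<le> adj_coef \<alpha> t m j"
  using j
proof (induction j rule: nat_induct_at_least)
  case (Suc n)
  then show ?case using adj_coef_mono[OF m, of n] by simp
qed simp

lemma comparison:
  assumes n: "n \<le> M" and V0: "0 \<le> V 0"
    and super: "\<And>m. m \<in> {1..n} \<Longrightarrow> 0 \<le> adj_sum \<alpha> t m V"
  shows "0 \<le> V n"
proof (rule discrete_comparison[where g = "adj_coef \<alpha> t" and n = n])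
  fix m j assume "m \<in> {1..n}" "1 \<le> j" "j < m"
  then show "adj_coef \<alpha> t m j \<le> adj_coef \<alpha> t m (Suc j)" using n by (intro adj_coef_mono) auto
next
  fix m assume m: "m \<in> {1..n}"
  then have "0 < t m powr (- \<alpha>)" using node_pos[of m] n by simp
  moreover have "t m powr (- \<alpha>) \<le> adj_coef \<alpha> t m 1"
    using m n by (intro adj_coef_first_ge) auto
  ultimately show "0 < adj_coef \<alpha> t m 1" by linarith
  show "0 \<le> (\<Sum>j=1..m. adj_coef \<alpha> t m j * (V j - V (j - 1)))"
    using super[OF m] by (simp add: adj_sum_def)
qed (use V0 in auto)

text \<open>Since t_1 <= K \<open>mesh_step t 2\<close>, the excess is of order t_1 t_m^(-alpha -
  1). Multiplied by a jump of order t_1^alpha it becomes (t_1/t_m)^(alpha + 1), which the truncation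
  order tolerates.\<close>

lemma adj_excess_le:
  assumes m: "1 \<le> m" "m \<le> M"
  shows "adj_excess \<alpha> t m \<le> 64 * K ^ 3 * t 1 * t m powr (- (\<alpha> + 1))"
proof (cases "3 \<le> m")
  case True
  interpret A: alikhanov_mesh \<alpha> t m using alikhanov_mesh m by simp
  define \<tau> h where "\<tau> = t 1" and "h = mesh_step t 2"
  have \<tau>: "0 < \<tau>" "\<tau> \<le> K * h" "0 < h"
    using first_pos first_le_grading[of 2] grading_le[of 2] step_pos[of 2] m True by (auto simp: \<tau>_def h_def)
  have s1: "mesh_step t 1 = \<tau>" by (simp add: mesh_step_def t0 \<tau>_def)
  have "alik_coef \<alpha> t m 2 - alik_coef \<alpha> t m 3 \<le>
      \<alpha> * (t_star \<alpha> t m - t 1) powr (- \<alpha> - 1) * (\<tau> ^ 3 / 6) / (\<tau> + h) / h"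
    using A.coef_second_third[OF True] unfolding s1 h_def by simp
  also have "\<dots> = \<alpha> * (t_star \<alpha> t m - t 1) powr (- \<alpha> - 1) * (\<tau> * (\<tau> / (\<tau> + h)) * (\<tau> / h) / 6)"
    by (simp add: power3_eq_cube)
  also have "\<dots> \<le> 1 * (64 * K\<^sup>2 * t m powr (- (\<alpha> + 1))) * (\<tau> * 1 * K)"
  proof (intro mult_mono)
    show "(t_star \<alpha> t m - t 1) powr (- \<alpha> - 1) \<le> 64 * K\<^sup>2 * t m powr (- (\<alpha> + 1))"
      using star_gap_powr m True by simp
    have "\<tau> * (\<tau> / (\<tau> + h)) * (\<tau> / h) \<le> \<tau> * 1 * K"
      using \<tau> K2 by (intro mult_mono) (auto simp: divide_le_eq mult.commute)
    moreover have "0 \<le> \<tau> * (\<tau> / (\<tau> + h)) * (\<tau> / h)" using \<tau> by simp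
    moreover have "a / 6 \<le> c" if "a \<le> c" "0 \<le> a" for a c :: real using that by simp
    ultimately show "\<tau> * (\<tau> / (\<tau> + h)) * (\<tau> / h) / 6 \<le> \<tau> * 1 * K" by blast
  qed (use \<alpha> \<tau> K2 in auto)
  also have "\<dots> = 64 * K ^ 3 * t 1 * t m powr (- (\<alpha> + 1))"
    by (simp add: \<tau>_def power2_eq_square power3_eq_cube)
  finally show ?thesis using True \<tau> K2 by (simp add: adj_excess_def \<tau>_def)
next
  case False
  then show ?thesis using first_pos m K2 by (simp add: adj_excess_def)
qed

text \<open>The equations at levels 1 and 2 form a triangular system for e_1 and e_2, whose
  coefficients are ordered and bounded below on every mesh. Solving it directly bounds the jump
  before the comparison principle is applied, which avoids circularity.\<close>

lemma initial_jump_le: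
  assumes e0: "e 0 = 0" and M: "2 \<le> M" and \<epsilon>: "0 \<le> \<epsilon>"
    and e: "\<And>m. m \<in> {1..M} \<Longrightarrow> \<bar>alik_sum \<alpha> t m e\<bar> \<le> \<epsilon>"
  shows "\<bar>e 2 - e 1\<bar> \<le> 2 * K * \<epsilon> * t 1 powr \<alpha>"
proof -
  define P where "P = \<epsilon> * t 1 powr \<alpha>"
  have \<tau>: "0 < t 1" using first_pos M by simp
  have P0: "0 \<le> P" using \<epsilon> by (simp add: P_def)
  have inv: "y / x \<le> y * s powr \<alpha>" if "0 < s" "s powr (- \<alpha>) \<le> x" "0 \<le> y" for s x y :: real
  proof -
    have "0 < s powr (- \<alpha>)" using that by simp
    then have "y / x \<le> y / (s powr (- \<alpha>))" using that by (intro divide_left_mono mult_pos_pos) linarith+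
    then show ?thesis by (simp add: powr_minus divide_inverse)
  qed
  have 1: "\<bar>e 1\<bar> \<le> P"
  proof -
    interpret A: alikhanov_mesh \<alpha> t 1 using alikhanov_mesh M by simp
    define c where "c = alik_coef \<alpha> t 1 1"
    have c1: "t 1 powr (- \<alpha>) \<le> c"
      using adj_coef_first_ge[of 1] M by (simp add: c_def adj_coef_def)
    moreover have "0 < t 1 powr (- \<alpha>)" using \<tau> by simp
    ultimately have c: "t 1 powr (- \<alpha>) \<le> c" "0 < c" by linarith+
    have "\<bar>c * e 1\<bar> \<le> \<epsilon>" using e[of 1] M by (simp add: alik_sum_def e0 c_def)
    then have "\<bar>e 1\<bar> \<le> \<epsilon> / c" using c by (simp add: abs_mult pos_le_divide_eq mult.commute)
    also have "\<dots> \<le> P" unfolding P_def by (rule inv[OF \<tau> c(1) \<epsilon>])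
    finally show ?thesis .
  qed
  have 2: "\<bar>e 2\<bar> \<le> K * P + P"
  proof -
    interpret A: alikhanov_mesh \<alpha> t 2 using alikhanov_mesh M by simp
    define c d where "c = alik_coef \<alpha> t 2 1" and "d = alik_coef \<alpha> t 2 2"
    have t2: "0 < t 2" "t 2 \<le> K * t 1" using node_pos node_ratio[of 2] M by auto
    have c: "t 2 powr (- \<alpha>) \<le> c" "c \<le> d"
      using adj_coef_first_ge[of 2] A.coef_first_le[of 2] M by (auto simp: c_def d_def adj_coef_def)
    have cd: "0 < c" "0 < d" using c powr_gt_zero[of "t 2" "- \<alpha>"] t2 by linarith+
    have "\<bar>c * e 1 + d * (e 2 - e 1)\<bar> \<le> \<epsilon>"
      using e[of 2] M by (simp add: alik_sum_def e0 c_def d_def numeral_2_eq_2)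
    \<comment> \<open>Solves the level-2 equation for e_2. The factor d - c lies between 0 and d, so
      dividing by d reproduces at most the bound for e_1.\<close>
    moreover have "d * e 2 = (c * e 1 + d * (e 2 - e 1)) + (d - c) * e 1" by (simp add: algebra_simps)
    moreover have "\<bar>(d - c) * e 1\<bar> \<le> d * P"
      unfolding abs_mult using c cd 1 by (intro mult_mono) auto
    ultimately have "\<bar>d * e 2\<bar> \<le> \<epsilon> + d * P" by linarith
    then have "\<bar>e 2\<bar> \<le> \<epsilon> / d + P" using cd by (simp add: abs_mult field_simps)
    also have "\<epsilon> / d \<le> \<epsilon> * t 2 powr \<alpha>" using c by (intro inv t2 \<epsilon>) auto
    also have "\<dots> \<le> \<epsilon> * (K * t 1 powr \<alpha>)"
    proof (rule mult_left_mono[OF _ \<epsilon>])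
      have "t 2 powr \<alpha> \<le> (K * t 1) powr \<alpha>" using t2 \<alpha> by (intro powr_mono2) auto
      also have "\<dots> = K powr \<alpha> * t 1 powr \<alpha>" using K2 \<tau> by (simp add: powr_mult)
      also have "\<dots> \<le> K * t 1 powr \<alpha>" using powr_mono[of \<alpha> 1 K] K2 \<alpha> by (intro mult_right_mono) auto
      finally show "t 2 powr \<alpha> \<le> K * t 1 powr \<alpha>" .
    qed
    finally show ?thesis by (simp add: P_def mult.left_commute)
  qed
  have "2 * P \<le> K * P" using K2 P0 by (intro mult_right_mono) auto
  then have "\<bar>e 2 - e 1\<bar> \<le> 2 * K * P" using 1 2 by linarith
  then show ?thesis by (simp add: P_def mult.assoc)
qed

text \<open>The term \<open>adj_excess \<alpha> t m * (e 2 - e 1)\<close> is treated as an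
  additional residual: 64 K^3 from \<open>adj_excess_le\<close> times 2 K from
  \<open>initial_jump_le\<close> gives 128 K^4. Comparison is then applied to both signs of
  \<open>e\<close>.\<close>

lemma error_le_barrier:
  assumes e0: "e 0 = 0" and c: "0 \<le> c" and q: "0 < q" "q \<le> \<alpha> + 1"
    and e: "\<And>m. m \<in> {1..M} \<Longrightarrow> \<bar>alik_sum \<alpha> t m e\<bar> \<le> c * (t 1 / t m) powr q"
    and n: "n \<in> {1..M}" and B0: "B 0 = 0"
    and B: "\<And>m. m \<in> {1..n} \<Longrightarrow> (t 1 / t m) powr q \<le> adj_sum \<alpha> t m B"
  shows "\<bar>e n\<bar> \<le> c * (1 + 128 * K ^ 4) * B n"
proof -
  define c' where "c' = c * (1 + 128 * K ^ 4)"
  have c': "0 \<le> c'" using c K2 by (simp add: c'_def)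
  have adj: "\<bar>adj_sum \<alpha> t m e\<bar> \<le> c' * (t 1 / t m) powr q" if m: "m \<in> {1..M}" for m
  proof -
    define x where "x = t 1 / t m"
    have tm: "0 < t 1" "0 < t m" "t 1 \<le> t m" using first_pos first_le[of m] node_pos[of m] m by auto
    have x: "0 < x" "x \<le> 1" using tm by (auto simp: x_def)
    have jump: "adj_excess \<alpha> t m * \<bar>e 2 - e 1\<bar> \<le> c * (128 * K ^ 4) * x powr q"
    proof (cases "2 \<le> M")
      case True
      have "\<bar>alik_sum \<alpha> t i e\<bar> \<le> c" if "i \<in> {1..M}" for i
      proof -
        have "(t 1 / t i) powr q \<le> 1 powr q"
          using first_pos first_le[of i] node_pos[of i] that q by (intro powr_mono2) auto
        then have "c * (t 1 / t i) powr q \<le> c * 1" using c by (intro mult_left_mono) auto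
        then show ?thesis using e[OF that] by linarith
      qed
      then have "\<bar>e 2 - e 1\<bar> \<le> 2 * K * c * t 1 powr \<alpha>"
        by (intro initial_jump_le e0 True c)
      then have "adj_excess \<alpha> t m * \<bar>e 2 - e 1\<bar> \<le>
          64 * K ^ 3 * t 1 * t m powr (- (\<alpha> + 1)) * (2 * K * c * t 1 powr \<alpha>)"
        using adj_excess_le[of m] m tm K2 by (intro mult_mono) auto
      also have "\<dots> = c * (128 * (K ^ 3 * K)) * ((t 1 * t 1 powr \<alpha>) * t m powr (- (\<alpha> + 1)))"
        by simp
      also have "t 1 * t 1 powr \<alpha> = t 1 powr (\<alpha> + 1)" using tm by (simp add: powr_add)
      also have "t 1 powr (\<alpha> + 1) * t m powr (- (\<alpha> + 1)) = x powr (\<alpha> + 1)"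
        unfolding x_def using tm by (intro powr_mult_neg_powr) auto
      also have "c * (128 * (K ^ 3 * K)) * x powr (\<alpha> + 1) \<le> c * (128 * (K ^ 3 * K)) * x powr q"
        using c K2 x q by (intro mult_left_mono powr_mono') auto
      finally show ?thesis by (simp add: power_Suc2[symmetric])
    next
      case False
      then show ?thesis using m c K2 by (simp add: adj_excess_def)
    qed
    have "\<bar>adj_sum \<alpha> t m e\<bar> \<le> \<bar>alik_sum \<alpha> t m e\<bar> + adj_excess \<alpha> t m * \<bar>e 2 - e 1\<bar>"
      unfolding adj_sum_eq using abs_triangle_ineq4[of "alik_sum \<alpha> t m e" "adj_excess \<alpha> t m * (e 2 - e 1)"]
        adj_excess_nonneg[of \<alpha> t m] by (simp add: abs_mult)
    then show ?thesis using e[OF m] jump by (simp add: c'_def x_def algebra_simps)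
  qed
  have lin: "adj_sum \<alpha> t m (\<lambda>i. c' * B i + \<sigma> * e i) = c' * adj_sum \<alpha> t m B + \<sigma> * adj_sum \<alpha> t m e" for m \<sigma>
    by (simp add: adj_sum_def sum_distrib_left sum.distrib[symmetric] algebra_simps)
  have "0 \<le> c' * B n + \<sigma> * e n" if \<sigma>: "\<sigma> = 1 \<or> \<sigma> = -1" for \<sigma>
  proof (rule comparison)
    fix m assume m: "m \<in> {1..n}"
    have "c' * (t 1 / t m) powr q \<le> c' * adj_sum \<alpha> t m B" using B[OF m] c' by (intro mult_left_mono)
    moreover have "\<bar>adj_sum \<alpha> t m e\<bar> \<le> c' * (t 1 / t m) powr q" using adj[of m] m n by auto
    ultimately show "0 \<le> adj_sum \<alpha> t m (\<lambda>i. c' * B i + \<sigma> * e i)"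
      unfolding lin using \<sigma> by (auto simp: abs_le_iff)
  qed (use n e0 B0 in auto)
  from this[of 1] this[of "-1"] show ?thesis by (simp add: c'_def abs_le_iff)
qed

text \<open>For an increasing \<open>B\<close> every coefficient may be lowered to the first one,
  which is at least t_m^(-alpha), and the increments telescope. \<open>B 0\<close> is 0 even if q =
  alpha, because \<open>powr\<close> sends 0 to 0 for every exponent.\<close>

lemma barrier_exists_increasing:
  assumes q: "0 < q" "q \<le> \<alpha>" and n: "n \<in> {1..M}"
  shows "\<exists>B. B 0 = 0 \<and> (\<forall>m\<in>{1..n}. (t 1 / t m) powr q \<le> adj_sum \<alpha> t m B) \<and> B n \<le> growth \<alpha> q (t 1) (t n)"
proof -
  define B where "B i = t 1 powr q * t i powr (\<alpha> - q)" for i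
  have "(t 1 / t m) powr q \<le> adj_sum \<alpha> t m B" if m: "m \<in> {1..n}" for m
  proof -
    have m': "1 \<le> m" "m \<le> M" using m n by auto
    have tm: "0 < t 1" "0 < t m" using first_pos node_pos m' by auto
    have B0: "B 0 = 0" by (simp add: B_def t0)
    have tel: "(\<Sum>j=1..i. B j - B (j - 1)) = B i" for i by (induction i) (auto simp: B0)
    have "(t 1 / t m) powr q = t m powr (- \<alpha>) * B m"
    proof -
      have "t m powr (- \<alpha>) * t m powr (\<alpha> - q) = t m powr (- q)" by (simp add: powr_add[symmetric])
      then have "t m powr (- \<alpha>) * B m = t 1 powr q * t m powr (- q)" by (simp add: B_def)
      then show ?thesis using powr_mult_neg_powr[of "t 1" "t m" q] tm by simp
    qed
    also have "\<dots> \<le> adj_coef \<alpha> t m 1 * B m"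
      using adj_coef_first_ge[OF m'] by (intro mult_right_mono) (auto simp: B_def)
    also have "\<dots> = (\<Sum>j=1..m. adj_coef \<alpha> t m 1 * (B j - B (j - 1)))"
      using tel[of m] by (simp add: sum_distrib_left[symmetric])
    also have "\<dots> \<le> adj_sum \<alpha> t m B"
      unfolding adj_sum_def
    proof (intro sum_mono mult_right_mono)
      fix j assume j: "j \<in> {1..m}"
      show "adj_coef \<alpha> t m 1 \<le> adj_coef \<alpha> t m j" using adj_coef_ge_first[OF m'(2)] j by auto
      have "t (j - 1) powr (\<alpha> - q) \<le> t j powr (\<alpha> - q)"
        using q j m' node_mono[of 0 "j - 1"] node_mono[of "j - 1" j] t0 by (intro powr_mono2) auto
      then show "0 \<le> B j - B (j - 1)" unfolding B_def by (simp add: mult_left_mono)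
    qed
    finally show ?thesis .
  qed
  then show ?thesis using q \<alpha> by (intro exI[of _ B]) (auto simp: B_def t0 growth_def)
qed

text \<open>Lowering the second coefficient helps this barrier, since V_p decreases from node 1 to
  node 2.\<close>

lemma adj_barrier_ge:
  assumes m: "1 \<le> m" "m \<le> M" and L: "1 \<le> L" and x: "\<alpha> < (3 - \<alpha>) / r"
    and Lc: "barrier_const \<alpha> K r * (1 / L) powr ((3 - \<alpha>) / r) \<le> 1 / 2" and p: "L * t 1 \<le> p"
  shows "barrier_rate \<alpha> p (t m) / 2 \<le> adj_sum \<alpha> t m (barrier \<alpha> t p)"
proof -
  define x where "x = (3 - \<alpha>) / r"
  have \<tau>: "0 < t 1" "t 1 \<le> L * t 1" using first_pos m L by auto
  then have p1: "t 1 \<le> p" "0 < p" using p by linarith+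
  have tm: "0 < t m" using node_pos m by simp
  have rate: "0 \<le> barrier_rate \<alpha> p (t m)" using p1 tm by (simp add: barrier_rate_def)
  have bc: "0 \<le> barrier_const \<alpha> K r"
  proof -
    have "(3 - \<alpha>) / r \<le> 3 / r" using \<alpha> r1 by (intro divide_right_mono) auto
    then have "0 < 3 / r - \<alpha>" using x by linarith
    then show ?thesis unfolding barrier_const_def using K2 \<alpha> by (intro add_nonneg_nonneg mult_nonneg_nonneg) auto
  qed
  have "t 1 / p \<le> 1 / L" using p p1 L by (simp add: field_simps)
  then have "(t 1 / p) powr x \<le> (1 / L) powr x"
    using p1 \<tau> \<alpha> r1 by (intro powr_mono2) (auto simp: x_def)
  then have "barrier_const \<alpha> K r * (t 1 / p) powr x \<le> 1 / 2"
    using Lc mult_left_mono[OF _ bc] unfolding x_def by (meson order_trans)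
  then have "(1 / 2) * barrier_rate \<alpha> p (t m) \<le> (1 - barrier_const \<alpha> K r * (t 1 / p) powr x) * barrier_rate \<alpha> p (t m)"
    using rate by (intro mult_right_mono) auto
  also have "\<dots> \<le> alik_sum \<alpha> t m (barrier \<alpha> t p)"
    unfolding x_def by (rule barrier_lower[OF m p1(1) x])
  also have "\<dots> \<le> adj_sum \<alpha> t m (barrier \<alpha> t p)"
  proof -
    have "adj_excess \<alpha> t m * (barrier \<alpha> t p 2 - barrier \<alpha> t p 1) \<le> 0"
    proof (cases "3 \<le> m")
      case True
      have "t 1 \<le> t 2" using node_mono[of 1 2] m True by simp
      then have "(t 2 + p) powr (\<alpha> - 1) \<le> (t 1 + p) powr (\<alpha> - 1)"
        using \<tau> p1 \<alpha> by (intro powr_mono2') auto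
      then have "barrier \<alpha> t p 2 - barrier \<alpha> t p 1 \<le> 0" using p1 by (simp add: barrier_def mult_left_mono)
      then show ?thesis using adj_excess_nonneg by (intro mult_nonneg_nonpos)
    qed (simp add: adj_excess_def)
    then show ?thesis by (simp add: adj_sum_eq)
  qed
  finally show ?thesis by simp
qed

text \<open>At each level m one scale p with t_m <= p <= 2 L t_m already gives the required lower
  bound, and the other scales contribute nonnegative terms.\<close>

lemma barrier_exists_dyadic:
  assumes q: "\<alpha> < q" "q \<le> (3 - \<alpha>) / r" and L: "1 \<le> L"
    and Lc: "barrier_const \<alpha> K r * (1 / L) powr ((3 - \<alpha>) / r) \<le> 1 / 2" and n: "n \<in> {1..M}"
  shows "\<exists>B. B 0 = 0 \<and> (\<forall>m\<in>{1..n}. (t 1 / t m) powr q \<le> adj_sum \<alpha> t m B) \<and>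
     B n \<le> 4 * (2 * L) powr q * L * geom_const q * growth \<alpha> q (t 1) (t n)"
proof -
  define \<tau> where "\<tau> = t 1"
  \<comment> \<open>The selected scale is at most 2 L t_m and contributes at least 1/4 of its
    weight; \<open>A\<close> compensates for both losses.\<close>
  define A where "A = 4 * (2 * L) powr q"
  define p where "p k = 2 ^ k * (L * \<tau>)" for k :: nat
  have \<tau>: "0 < \<tau>" "\<tau> \<le> t n" using first_pos first_le[of n] n by (auto simp: \<tau>_def)
  have q0: "0 < q" using q \<alpha> by simp
  have pp: "0 < p k" "L * \<tau> \<le> p k" for k
  proof -
    show "0 < p k" using \<tau> L by (simp add: p_def)
    have "1 * (L * \<tau>) \<le> 2 ^ k * (L * \<tau>)" using \<tau> L by (intro mult_right_mono) auto
    then show "L * \<tau> \<le> p k" by (simp add: p_def)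
  qed
  have A0: "0 \<le> A" by (simp add: A_def)
  obtain N0 where "t n / \<tau> < 2 ^ N0" using real_arch_pow[of 2 "t n / \<tau>"] by auto
  \<comment> \<open>The comparison runs only up to level \<open>n\<close>, so the scales may stop
    near t_n. This cutoff controls the geometric sum when q <= 1.\<close>
  then obtain N where N: "t n / \<tau> \<le> 2 ^ N" "2 ^ N \<le> 2 * (t n / \<tau>)"
    using exists_dyadic_ge[of "t n / \<tau>" N0] \<tau> by (auto simp: less_imp_le)
  define wt where "wt k = A * (\<tau> powr q * p k powr (- q))" for k
  have wt0: "0 \<le> wt k" for k using A0 by (simp add: wt_def)
  define B where "B i = (\<Sum>k\<le>N. wt k * barrier \<alpha> t (p k) i)" for i
  have lin: "adj_sum \<alpha> t m B = (\<Sum>k\<le>N. wt k * adj_sum \<alpha> t m (barrier \<alpha> t (p k)))" for m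
    unfolding adj_sum_def B_def sum_subtractf[symmetric] right_diff_distrib[symmetric] sum_distrib_left
    by (subst sum.swap) (simp add: mult.left_commute)
  have "(\<tau> / t m) powr q \<le> adj_sum \<alpha> t m B" if m: "m \<in> {1..n}" for m
  proof -
    have m': "1 \<le> m" "m \<le> M" using m n by auto
    have tm: "0 < t m" "\<tau> \<le> t m" "t m \<le> t n"
      using node_pos[OF m'] first_le[OF m'] node_mono[of m n] m n by (auto simp: \<tau>_def)
    have adj: "barrier_rate \<alpha> (p k) (t m) / 2 \<le> adj_sum \<alpha> t m (barrier \<alpha> t (p k))" for k
      using adj_barrier_ge[OF m' L _ Lc, of "p k"] pp q by (simp add: \<tau>_def)
    have rate0: "0 \<le> barrier_rate \<alpha> (p k) (t m)" for k using pp[of k] tm by (simp add: barrier_rate_def)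
    have "t m / \<tau> \<le> 2 ^ N" using N(1) tm \<tau> by (intro order_trans[OF divide_right_mono N(1)]) auto
    then obtain k where k: "k \<le> N" "t m / \<tau> \<le> 2 ^ k" "2 ^ k \<le> 2 * (t m / \<tau>)"
      using exists_dyadic_ge[of "t m / \<tau>" N] tm \<tau> by auto
    have k1: "t m \<le> 2 ^ k * \<tau>" "2 ^ k * \<tau> \<le> 2 * t m"
      using k \<tau> by (auto simp: field_simps)
    have pk: "t m \<le> p k" "p k \<le> 2 * L * t m"
    proof -
      have "1 * t m \<le> L * (2 ^ k * \<tau>)" using k1 L tm by (intro mult_mono) auto
      then show "t m \<le> p k" by (simp add: p_def mult.left_commute)
      have "L * (2 ^ k * \<tau>) \<le> L * (2 * t m)" using k1 L by (intro mult_left_mono) auto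
      then show "p k \<le> 2 * L * t m" by (simp add: p_def mult_ac)
    qed
    have r1: "1 / 2 \<le> barrier_rate \<alpha> (p k) (t m)"
    proof -
      have "t m powr \<alpha> * t m powr (- \<alpha>) = 1" using tm by (simp add: powr_add[symmetric])
      then have "1 / 2 = p k * (t m powr \<alpha> * t m powr (- \<alpha>)) / (p k + p k)"
        using pp[of k] by simp
      also have "\<dots> \<le> p k * (p k powr \<alpha> * t m powr (- \<alpha>)) / (t m + p k)"
        using pk tm \<alpha> pp[of k] by (intro frac_le mult_left_mono mult_right_mono powr_mono2) auto
      also have "\<dots> = barrier_rate \<alpha> (p k) (t m)"
        using pp[of k] by (simp add: barrier_rate_def powr_add)
      finally show ?thesis .
    qed
    have "(\<tau> / t m) powr q = A * (\<tau> powr q * (2 * L * t m) powr (- q)) * (1 / 4)"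
    proof -
      have "(2 * L * t m) powr (- q) = (2 * L) powr (- q) * t m powr (- q)"
        by (intro powr_mult)
      moreover have "(2 * L) powr q * (2 * L) powr (- q) = 1" using L by (simp add: powr_add[symmetric])
      moreover have "\<tau> powr q * t m powr (- q) = (\<tau> / t m) powr q"
        using \<tau> tm by (intro powr_mult_neg_powr) auto
      moreover have "A * (\<tau> powr q * ((2 * L) powr (- q) * t m powr (- q))) * (1 / 4) =
          ((2 * L) powr q * (2 * L) powr (- q)) * (\<tau> powr q * t m powr (- q))"
        by (simp add: A_def)
      ultimately show ?thesis by (simp only: mult_1)
    qed
    also have "\<dots> \<le> wt k * (1 / 4)"
      unfolding wt_def using pk pp[of k] q0 A0 by (intro mult_right_mono mult_left_mono powr_mono2') auto
    also have "\<dots> \<le> wt k * adj_sum \<alpha> t m (barrier \<alpha> t (p k))"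
      using adj[of k] r1 wt0 by (intro mult_left_mono) auto
    also have "\<dots> \<le> (\<Sum>k\<le>N. wt k * adj_sum \<alpha> t m (barrier \<alpha> t (p k)))"
    proof (rule member_le_sum)
      fix i
      have "0 \<le> adj_sum \<alpha> t m (barrier \<alpha> t (p i))" using adj[of i] rate0[of i] by linarith
      then show "0 \<le> wt i * adj_sum \<alpha> t m (barrier \<alpha> t (p i))" using wt0 by simp
    qed (use k in auto)
    finally show ?thesis using lin by simp
  qed
  moreover have "B n \<le> A * L * geom_const q * growth \<alpha> q \<tau> (t n)"
  proof -
    \<comment> \<open>V_p(t_n) is at most p t_n^(alpha - 1), so together with its weight each scale
      contributes p^(1 - q), a geometric progression in \<open>k\<close>.\<close>
    have term_le: "wt k * barrier \<alpha> t (p k) n \<le> A * L * (\<tau> * t n powr (\<alpha> - 1) * (2 powr (1 - q)) ^ k)" for k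
    proof -
      have "barrier \<alpha> t (p k) n \<le> p k * t n powr (\<alpha> - 1)"
        unfolding barrier_def using n \<tau> pp[of k] \<alpha> by (auto intro!: mult_left_mono powr_mono2')
      then have "wt k * barrier \<alpha> t (p k) n \<le> wt k * (p k * t n powr (\<alpha> - 1))"
        using wt0 by (intro mult_left_mono)
      also have "\<dots> = A * (\<tau> powr q * (p k powr (- q) * p k)) * t n powr (\<alpha> - 1)"
        by (simp add: wt_def mult_ac)
      also have "p k powr (- q) * p k = p k powr (1 - q)"
        using pp[of k] by (simp add: powr_diff powr_minus field_simps)
      also have "p k powr (1 - q) = (2 ^ k) powr (1 - q) * (L powr (1 - q) * \<tau> powr (1 - q))"
        using \<tau> L by (simp add: p_def powr_mult)
      also have "(2 ^ k) powr (1 - q) = (2 powr (1 - q)) ^ k"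
        by (simp add: powr_power powr_realpow[symmetric] powr_powr mult.commute)
      also have "A * (\<tau> powr q * ((2 powr (1 - q)) ^ k * (L powr (1 - q) * \<tau> powr (1 - q)))) * t n powr (\<alpha> - 1) =
          A * L powr (1 - q) * ((\<tau> powr q * \<tau> powr (1 - q)) * t n powr (\<alpha> - 1) * (2 powr (1 - q)) ^ k)"
        by (simp only: mult_ac)
      also have "\<tau> powr q * \<tau> powr (1 - q) = \<tau>" using \<tau> by (simp add: powr_add[symmetric])
      also have "A * L powr (1 - q) * (\<tau> * t n powr (\<alpha> - 1) * (2 powr (1 - q)) ^ k) \<le>
          A * L * (\<tau> * t n powr (\<alpha> - 1) * (2 powr (1 - q)) ^ k)"
        using powr_mono[of "1 - q" 1 L] L q0 A0 \<tau> by (intro mult_right_mono mult_left_mono) auto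
      finally show ?thesis .
    qed
    have "B n \<le> (\<Sum>k\<le>N. A * L * (\<tau> * t n powr (\<alpha> - 1) * (2 powr (1 - q)) ^ k))"
      unfolding B_def by (intro sum_mono term_le)
    also have "\<dots> = A * L * (\<tau> * t n powr (\<alpha> - 1) * (\<Sum>k\<le>N. (2 powr (1 - q)) ^ k))"
      by (simp add: sum_distrib_left)
    also have "\<dots> \<le> A * L * (geom_const q * growth \<alpha> q \<tau> (t n))"
      using N(2) \<tau> q0 A0 L by (intro mult_left_mono dyadic_sum_le) (auto simp: field_simps)
    finally show ?thesis by (simp add: mult.assoc)
  qed
  moreover have "B 0 = 0" by (simp add: B_def barrier_def)
  ultimately show ?thesis by (intro exI[of _ B]) (auto simp: A_def \<tau>_def)
qed

end

section \<open>The error bound\<close>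

lemma mesh_ratio_condition_imp:
  assumes cond: "mesh_ratio_condition M t" and j: "3 \<le> j" "j < M"
    and pos: "\<And>j. \<lbrakk>1 \<le> j; j \<le> M\<rbrakk> \<Longrightarrow> 0 < mesh_step t j"
  shows "mesh_step t (j - 1) ^ 3 / (mesh_step t j * (mesh_step t (j - 1) + mesh_step t j))
       \<le> 3 * mesh_step t j + (mesh_step t j)\<^sup>2 / mesh_step t (Suc j)"
proof -
  have p: "0 < mesh_step t (j - 1)" "0 < mesh_step t j" "0 < mesh_step t (Suc j)"
    using pos[of "j - 1"] pos[of j] pos[of "Suc j"] j by auto
  have rho: "mesh_ratio t (j - 1) = mesh_step t j / mesh_step t (j - 1)"
    "mesh_ratio t j = mesh_step t (Suc j) / mesh_step t j"
    using j by (auto simp: mesh_ratio_def)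
  have j': "j \<in> {2..<M}" "j - 1 \<in> {2..<M}" using j by auto
  from cond consider
      "0.4656 \<le> mesh_ratio t j" "mesh_ratio t j \<le> mesh_ratio t (j - 1)" | "4 / 7 \<le> mesh_ratio t (j - 1)"
    unfolding mesh_ratio_condition_def using j' by blast
  then show ?thesis
  proof cases
    case 1
    then show ?thesis using ratio_condition_decreasing[OF p] unfolding rho by simp
  next
    case 2
    then show ?thesis using ratio_condition_four_sevenths[OF p] unfolding rho by simp
  qed
qed

text \<open>\<open>K\<close> is at least 1 by the grading at index 1. The node ratio follows from j
  <= 2 (j - 1), with constant K^2 2^r; the extra factor 2 secures the lower bound 2 for the new
  constant.\<close>

lemma quasi_graded_imp_monotone_graded_mesh:
  assumes \<alpha>: "0 < \<alpha>" "\<alpha> < 1" and r: "1 \<le> r" and T: "0 < T"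
    and mesh: "temporal_mesh T M t" and ratio: "mesh_ratio_condition M t" and graded: "quasi_graded K r M t"
  shows "1 \<le> M \<and> 1 \<le> K \<and> monotone_graded_mesh \<alpha> (2 * K\<^sup>2 * 2 powr r) r M t"
proof -
  have t0: "t 0 = 0" and tM: "t M = T" and step: "\<And>j. \<lbrakk>1 \<le> j; j \<le> M\<rbrakk> \<Longrightarrow> t (j - 1) < t j"
    using mesh by (auto simp: temporal_mesh_def)
  have M: "1 \<le> M" using t0 tM T by (cases M) auto
  have t1: "0 < t 1" using step[of 1] M t0 by simp
  have gr: "t j \<le> K * (t 1 * real j powr r)" "t 1 * real j powr r \<le> K * t j"
    "mesh_step t j \<le> K * grading r t j" "grading r t j \<le> K * mesh_step t j" if "1 \<le> j" "j \<le> M" for j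
    using graded that by (auto simp: quasi_graded_def equiv_upto_def grading_def)
  have K: "1 \<le> K"
  proof -
    have "1 * t 1 \<le> K * t 1" using gr(1)[of 1] M by simp
    then show ?thesis using t1 by (subst (asm) mult_le_cancel_right_pos) auto
  qed
  define K' where "K' = 2 * K\<^sup>2 * 2 powr r"
  have K': "K \<le> K'" "2 \<le> K'" "K * 2 powr r * K \<le> K'"
  proof -
    have a: "1 \<le> 2 powr r" using r by (intro ge_one_powr_ge_zero) auto
    have b: "K * 1 \<le> K * K" using K by (intro mult_left_mono) auto
    have "K\<^sup>2 * 1 \<le> K\<^sup>2 * 2 powr r" using a by (intro mult_left_mono) auto
    then have c: "K\<^sup>2 \<le> K\<^sup>2 * 2 powr r" by simp
    show "K \<le> K'" "2 \<le> K'" using b c K unfolding K'_def power2_eq_square by linarith+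
    show "K * 2 powr r * K \<le> K'" using K by (simp add: K'_def power2_eq_square)
  qed
  have gpos: "0 \<le> grading r t j" for j by (simp add: grading_def)
  have spos: "0 < mesh_step t j" if "1 \<le> j" "j \<le> M" for j using step[OF that] by (simp add: mesh_step_def)
  have nonneg: "0 \<le> t i" if "i \<le> M" for i
    using that
  proof (induction i)
    case (Suc i)
    then show ?case using step[of "Suc i"] by simp
  qed (simp add: t0)
  have "monotone_graded_mesh \<alpha> K' r M t"
  proof unfold_locales
    fix j assume j: "1 \<le> j" "j \<le> M"
    show "mesh_step t j \<le> K' * grading r t j"
      using gr(3)[OF j] mult_right_mono[OF K'(1) gpos[of j]] by linarith
    show "grading r t j \<le> K' * mesh_step t j"
      using gr(4)[OF j] mult_right_mono[OF K'(1) less_imp_le[OF spos[OF j]]] by linarith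
  next
    fix j assume j: "2 \<le> j" "j \<le> M"
    have tj: "0 \<le> t (j - 1)" using nonneg j by simp
    have "t j \<le> K * (t 1 * real j powr r)" using gr(1)[of j] j by simp
    also have "\<dots> \<le> K * (t 1 * (2 * real (j - 1)) powr r)"
      using j K t1 r by (intro mult_left_mono powr_mono2) auto
    also have "\<dots> = K * 2 powr r * (t 1 * real (j - 1) powr r)" by (simp add: powr_mult)
    also have "\<dots> \<le> K * 2 powr r * (K * t (j - 1))"
      using gr(2)[of "j - 1"] j K by (intro mult_left_mono) auto
    also have "\<dots> = K * 2 powr r * K * t (j - 1)" by simp
    also have "\<dots> \<le> K' * t (j - 1)" using K'(3) tj by (intro mult_right_mono)
    finally show "t j \<le> K' * t (j - 1)" .
  next
    fix j assume "3 \<le> j" "j < M"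
    then show "mesh_step t (j - 1) ^ 3 / (mesh_step t j * (mesh_step t (j - 1) + mesh_step t j))
       \<le> 3 * mesh_step t j + (mesh_step t j)\<^sup>2 / mesh_step t (Suc j)"
      using mesh_ratio_condition_imp[OF ratio] spos by simp
  qed (use \<alpha> r K' t0 step in auto)
  then show ?thesis using M K by (simp add: K'_def)
qed

text \<open>Inserts t_1 <= K M^(-r), in the third case raised to the power \<open>q\<close> with r q
  = 3 - alpha. The constant K^3 dominates both K and K^q.\<close>

lemma growth_le_error_bound:
  assumes \<alpha>: "0 < \<alpha>" "\<alpha> < 1" and r: "1 \<le> r" and K: "1 \<le> K" and M: "1 \<le> M"
    and t: "0 < t 1" "t 1 \<le> t m" and graded: "t 1 \<le> K * real M powr (- r)"
  shows "growth \<alpha> (trunc_order \<alpha> r) (t 1) (t m) \<le> K powr 3 * error_bound \<alpha> r M t m"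
proof -
  define q where "q = trunc_order \<alpha> r"
  have tm: "0 < t m" using t by simp
  have K3: "K \<le> K powr 3" using powr_mono[of 1 3 K] K by simp
  have graded': "t 1 \<le> K powr 3 * real M powr (- r)"
    using graded mult_right_mono[OF K3, of "real M powr (- r)"] by simp
  consider "r < 3 - \<alpha>" | "r = 3 - \<alpha>" | "3 - \<alpha> < r" by linarith
  then show ?thesis
  proof cases
    case 1
    then have "1 < q" using \<alpha> r by (simp add: q_def trunc_order_def less_divide_eq)
    then have "growth \<alpha> q (t 1) (t m) = t 1 * t m powr (\<alpha> - 1)" by (simp add: growth_def)
    also have "\<dots> \<le> K powr 3 * real M powr (- r) * t m powr (\<alpha> - 1)"
      using graded' by (intro mult_right_mono) auto
    finally show ?thesis using 1 by (simp add: error_bound_def q_def mult.assoc)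
  next
    case 2
    then have "q = 1" using \<alpha> by (simp add: q_def trunc_order_def)
    then have "growth \<alpha> q (t 1) (t m) = t 1 * (t m powr (\<alpha> - 1) * (1 + ln (t m / t 1)))"
      by (simp add: growth_def)
    also have "\<dots> \<le> K powr 3 * real M powr (- r) * (t m powr (\<alpha> - 1) * (1 + ln (t m / t 1)))"
      using graded' t tm by (intro mult_right_mono mult_nonneg_nonneg add_nonneg_nonneg) auto
    finally show ?thesis using 2 by (simp add: error_bound_def q_def mult.assoc)
  next
    case 3
    have q1: "(3 - \<alpha>) / r < 1" using 3 r by (simp add: divide_less_eq)
    then have q: "q = (3 - \<alpha>) / r" using \<alpha> by (simp add: q_def trunc_order_def)
    have q0: "0 < q" "q < 1" using q1 q \<alpha> r by auto
    then have "growth \<alpha> q (t 1) (t m) = t 1 powr q * t m powr (\<alpha> - q)" by (simp add: growth_def)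
    also have "\<dots> \<le> (K * real M powr (- r)) powr q * t m powr (\<alpha> - q)"
      using graded t q0 by (intro mult_right_mono powr_mono2) auto
    also have "(K * real M powr (- r)) powr q = K powr q * real M powr (\<alpha> - 3)"
    proof -
      have "r * q = 3 - \<alpha>" using q r by simp
      then show ?thesis using K by (simp add: powr_mult powr_powr)
    qed
    also have "K powr q * real M powr (\<alpha> - 3) * t m powr (\<alpha> - q) \<le>
        K powr 3 * real M powr (\<alpha> - 3) * t m powr (\<alpha> - q)"
      using q0 K by (intro mult_right_mono powr_mono) auto
    finally show ?thesis using 3 q by (simp add: error_bound_def q_def mult.assoc)
  qed
qed

text \<open>On (0, T] the constant 1 is at most T^(l - alpha) x^(alpha - l), so the singular power
  alone remains, with a constant depending on \<open>T\<close>.\<close>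

lemma powr_bound_absorb:
  fixes g :: "real \<Rightarrow> real" and x T B \<alpha> l :: real
  assumes bd: "\<forall>x\<in>{0<..T}. \<bar>g x\<bar> \<le> B * (1 + x powr (\<alpha> - l))" and l: "\<alpha> \<le> l"
    and x: "x \<in> {0<..T}"
  shows "\<bar>g x\<bar> \<le> \<bar>B\<bar> * (T powr (l - \<alpha>) + 1) * x powr (\<alpha> - l)"
proof -
  have p: "0 \<le> x powr (\<alpha> - l)" by simp
  have "\<bar>g x\<bar> \<le> B * (1 + x powr (\<alpha> - l))" using bd x by blast
  also have "\<dots> \<le> \<bar>B\<bar> * (1 + x powr (\<alpha> - l))" using p by (intro mult_right_mono) auto
  also have "\<dots> \<le> \<bar>B\<bar> * (T powr (l - \<alpha>) * x powr (\<alpha> - l) + x powr (\<alpha> - l))"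
  proof (intro mult_left_mono add_right_mono)
    have "x powr (l - \<alpha>) * x powr (\<alpha> - l) \<le> T powr (l - \<alpha>) * x powr (\<alpha> - l)"
      using x l by (intro mult_right_mono powr_mono2) auto
    moreover have "x powr (l - \<alpha>) * x powr (\<alpha> - l) = 1" using x by (simp add: powr_add[symmetric])
    ultimately show "1 \<le> T powr (l - \<alpha>) * x powr (\<alpha> - l)" by simp
  qed simp
  finally show ?thesis by (simp add: algebra_simps)
qed

text \<open>The generic constant is expressed by the order of quantifiers: \<open>C\<close> is fixed
  by the data, the solution and the grading constant \<open>K\<close> before the mesh and the
  discrete solution are chosen. Derivatives within the half-open interval are one-sided at
  \<open>T\<close>.\<close>

theorem theorem4p4:
  fixes \<alpha> T r K u0 :: real
    and u f :: "real \<Rightarrow> real"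
    and D :: "nat \<Rightarrow> real \<Rightarrow> real"
  assumes "0 < \<alpha>" "\<alpha> < 1" "0 < T" "1 \<le> r"
    and "continuous_on {0..T} u"
    and "D 0 = u"
    and "\<And>l x. l < 3 \<Longrightarrow> x \<in> {0<..T} \<Longrightarrow>
           (D l has_real_derivative D (Suc l) x) (at x within {0<..T})"
    and "continuous_on {0<..T} (D 3)"
    and "\<And>l. l \<in> {1, 3} \<Longrightarrow>
           \<exists>B. \<forall>x\<in>{0<..T}. \<bar>D l x\<bar> \<le> B * (1 + x powr (\<alpha> - real l))"
    and "\<And>x. x \<in> {0<..T} \<Longrightarrow> caputo \<alpha> u x = f x"
    and "u 0 = u0"
  shows "\<exists>C>0. \<forall>(M::nat) (t::nat \<Rightarrow> real) (U::nat \<Rightarrow> real).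
           temporal_mesh T M t \<longrightarrow> mesh_ratio_condition M t \<longrightarrow> quasi_graded K r M t \<longrightarrow>
           (\<forall>m\<in>{1..M}. alikhanov \<alpha> t U m = f (t_star \<alpha> t m)) \<longrightarrow> U 0 = u0 \<longrightarrow>
           (\<forall>m\<in>{1..M}. \<bar>u (t m) - U m\<bar> \<le> C * error_bound \<alpha> r M t m)"
proof -
  define K' q where "K' = 2 * K\<^sup>2 * 2 powr r" and "q = trunc_order \<alpha> r"
  obtain B1 where "\<forall>x\<in>{0<..T}. \<bar>D 1 x\<bar> \<le> B1 * (1 + x powr (\<alpha> - 1))"
    using assms(9)[of 1] by auto
  from powr_bound_absorb[OF this]
  obtain C1 where C1: "\<And>x. x \<in> {0<..T} \<Longrightarrow> \<bar>D 1 x\<bar> \<le> C1 * x powr (\<alpha> - 1)" using assms(2) by force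
  obtain B3 where "\<forall>x\<in>{0<..T}. \<bar>D 3 x\<bar> \<le> B3 * (1 + x powr (\<alpha> - 3))"
    using assms(9)[of 3] by auto
  from powr_bound_absorb[OF this]
  obtain C3 where C3: "\<And>x. x \<in> {0<..T} \<Longrightarrow> \<bar>D 3 x\<bar> \<le> C3 * x powr (\<alpha> - 3)" using assms(2) by force
  have der: "(D l has_real_derivative D (Suc l) x) (at x)" if "l < 3" "x \<in> {0<..<T}" for l x
  proof -
    have x: "x \<in> {0<..T}" using that(2) by simp
    have sub: "{0<..<T} \<subseteq> {0<..T}" by auto
    have "(D l has_real_derivative D (Suc l) x) (at x within {0<..<T})"
      by (rule DERIV_subset[OF assms(7)[OF that(1) x] sub])
    then show ?thesis using at_within_open[OF that(2) open_greaterThanLessThan] by simp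
  qed
  have cont: "continuous_on {0<..T} (D l)" if "l < 3" for l
    using assms(7)[OF that] by (rule DERIV_continuous_on)
  have q0: "0 < q" "q \<le> \<alpha> + 1" "q \<le> (3 - \<alpha>) / r" using assms(1,2,4) by (auto simp: q_def trunc_order_def)
  have sol: "graded_solution \<alpha> K' r M t u (D 1) (D 2) (D 3) C1 C3"
    if mesh: "temporal_mesh T M t" "mesh_ratio_condition M t" "quasi_graded K r M t" for M t
  proof -
    have g: "1 \<le> M" "monotone_graded_mesh \<alpha> K' r M t"
      using quasi_graded_imp_monotone_graded_mesh[OF assms(1,2,4,3) mesh] by (auto simp: K'_def)
    interpret monotone_graded_mesh \<alpha> K' r M t by (rule g(2))
    have tM: "t M = T" using mesh(1) by (simp add: temporal_mesh_def)
    show ?thesis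
    proof (unfold_locales; (unfold tM)?)
      fix s assume s: "s \<in> {0<..<T}"
      show "(u has_real_derivative D 1 s) (at s)" "(D 1 has_real_derivative D 2 s) (at s)"
        "(D 2 has_real_derivative D 3 s) (at s)"
        using der[of 0 s] der[of 1 s] der[of 2 s] s assms(6) by (auto simp: numeral_2_eq_2 numeral_3_eq_3)
      show "\<bar>D 1 s\<bar> \<le> C1 * s powr (\<alpha> - 1)" "\<bar>D 3 s\<bar> \<le> C3 * s powr (\<alpha> - 3)"
        using C1[of s] C3[of s] s by auto
    qed (use g assms(5) cont[of 1] cont[of 2] in auto)
  qed
  \<comment> \<open>Outside its locale this constant depends on alpha, \<open>K'\<close>,
    \<open>r\<close>, \<open>C1\<close> and \<open>C3\<close> only, so it can be fixed before any
    mesh is given.\<close>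
  define c where "c = \<bar>graded_solution.truncation_const \<alpha> K' r C1 C3\<bar>"
  obtain L where L: "1 \<le> L" "\<alpha> < q \<Longrightarrow> barrier_const \<alpha> K' r * (1 / L) powr ((3 - \<alpha>) / r) \<le> 1 / 2"
  proof -
    have "((\<lambda>L. barrier_const \<alpha> K' r * (1 / L) powr ((3 - \<alpha>) / r)) \<longlongrightarrow> barrier_const \<alpha> K' r * 0) at_top"
    proof (intro tendsto_mult tendsto_const)
      have "((\<lambda>L::real. L powr (- ((3 - \<alpha>) / r))) \<longlongrightarrow> 0) at_top"
        using assms(1,2,4) by (intro tendsto_neg_powr filterlim_ident) auto
      then show "((\<lambda>L::real. (1 / L) powr ((3 - \<alpha>) / r)) \<longlongrightarrow> 0) at_top"
        by (rule Lim_transform_eventually)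
          (use eventually_gt_at_top[of 0] in eventually_elim, simp add: powr_divide powr_minus_divide)
    qed
    then have "eventually (\<lambda>L. barrier_const \<alpha> K' r * (1 / L) powr ((3 - \<alpha>) / r) < 1 / 2) at_top"
      by (rule order_tendstoD) simp
    then have "eventually (\<lambda>L. barrier_const \<alpha> K' r * (1 / L) powr ((3 - \<alpha>) / r) < 1 / 2 \<and> 1 \<le> L) at_top"
      using eventually_ge_at_top[of 1] by eventually_elim auto
    then obtain L where "barrier_const \<alpha> K' r * (1 / L) powr ((3 - \<alpha>) / r) < 1 / 2" "1 \<le> L"
      using eventually_happens'[OF trivial_limit_at_top_linorder] by blast
    then show thesis by (intro that[of L]) auto
  qed
  \<comment> \<open>The maximum with 1 lets one factor serve the increasing barrier as well, whose
    constant is 1.\<close>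
  define G where "G = max 1 (4 * (2 * L) powr q * L * geom_const q)"
  define c' where "c' = c * (1 + 128 * K' ^ 4)"
  \<comment> \<open>The added 1 makes \<open>C\<close> strictly positive.\<close>
  define C where "C = c' * G * K powr 3 + 1"
  have c0: "0 \<le> c" "0 \<le> c'" by (auto simp: c_def c'_def)
  have G1: "1 \<le> G" by (simp add: G_def)
  have C0: "0 < C" using c0 G1 by (simp add: C_def add_nonneg_pos)
  have "\<bar>u (t m) - U m\<bar> \<le> C * error_bound \<alpha> r M t m"
    if mesh: "temporal_mesh T M t" "mesh_ratio_condition M t" "quasi_graded K r M t"
      and scheme: "\<forall>m\<in>{1..M}. alikhanov \<alpha> t U m = f (t_star \<alpha> t m)" and U0: "U 0 = u0" and m: "m \<in> {1..M}"
    for M t U m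
  proof -
    have g: "1 \<le> M" "1 \<le> K" "monotone_graded_mesh \<alpha> K' r M t"
      using quasi_graded_imp_monotone_graded_mesh[OF assms(1,2,4,3) mesh] by (auto simp: K'_def)
    interpret monotone_graded_mesh \<alpha> K' r M t by (rule g(3))
    interpret S: graded_solution \<alpha> K' r M t u "D 1" "D 2" "D 3" C1 C3 by (rule sol[OF mesh])
    have tM: "t M = T" using mesh(1) by (simp add: temporal_mesh_def)
    define e where "e i = u (t i) - U i" for i
    have e0: "e 0 = 0" using U0 assms(11) t0 by (simp add: e_def)
    have tr: "\<bar>alik_sum \<alpha> t i e\<bar> \<le> c * (t 1 / t i) powr q" if i: "i \<in> {1..M}" for i
    proof -
      interpret A: alikhanov_mesh \<alpha> t i using alikhanov_mesh i by simp
      define w where "w = t_star \<alpha> t i"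
      have w: "0 < w" "w \<le> T" using A.star_pos A.star_le node_mono[of i M] i tM by (auto simp: w_def)
      obtain Z where Z: "((\<lambda>s. ker \<alpha> w s * D 1 s) has_integral Z) {0..w}"
        "\<bar>alik_sum \<alpha> t i (\<lambda>j. u (t j)) - Z\<bar> \<le> S.truncation_const * (t 1 / t i) powr q"
        using S.u_truncation[of i] i by (auto simp: w_def q_def)
      \<comment> \<open>\<open>D 1\<close> and \<open>deriv u\<close> are identified in the interior
        only, which is enough for the integral.\<close>
      have "((\<lambda>s. (w - s) powr (- \<alpha>) * deriv u s) has_integral Z) (cbox 0 w)"
      proof (rule has_integral_spike_interior)
        show "((\<lambda>s. ker \<alpha> w s * D 1 s) has_integral Z) (cbox 0 w)" using Z(1) by simp
        fix s assume "s \<in> box 0 w"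
        then have "deriv u s = D 1 s" using der[of 0 s] w assms(6) by (intro DERIV_imp_deriv) auto
        then show "(w - s) powr (- \<alpha>) * deriv u s = ker \<alpha> w s * D 1 s" by (simp add: ker_def)
      qed
      then have cap: "caputo \<alpha> u w = 1 / Gamma (1 - \<alpha>) * Z" by (simp add: caputo_def integral_unique)
      have "alikhanov \<alpha> t U i = f w" using scheme i by (simp add: w_def)
      also have "f w = caputo \<alpha> u w" using assms(10)[of w] w by simp
      finally have "1 / Gamma (1 - \<alpha>) * alik_sum \<alpha> t i U = 1 / Gamma (1 - \<alpha>) * Z"
        unfolding A.alikhanov_eq_sum cap .
      moreover have "0 < Gamma (1 - \<alpha>)" using assms(2) by (intro Gamma_real_pos) auto
      ultimately have "alik_sum \<alpha> t i U = Z" by simp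
      moreover have "alik_sum \<alpha> t i e = alik_sum \<alpha> t i (\<lambda>j. u (t j)) - alik_sum \<alpha> t i U"
        by (simp add: alik_sum_def e_def sum_subtractf[symmetric] algebra_simps)
      ultimately have "\<bar>alik_sum \<alpha> t i e\<bar> \<le> S.truncation_const * (t 1 / t i) powr q" using Z(2) by simp
      also have "\<dots> \<le> c * (t 1 / t i) powr q" unfolding c_def by (intro mult_right_mono) auto
      finally show ?thesis .
    qed
    have t: "0 < t 1" "t 1 \<le> t m" "0 < t m" using first_pos first_le[of m] node_pos[of m] m by auto
    have gr0: "0 \<le> growth \<alpha> q (t 1) (t m)" using t by (auto simp: growth_def)
    obtain B where B: "B 0 = 0" "\<And>i. i \<in> {1..m} \<Longrightarrow> (t 1 / t i) powr q \<le> adj_sum \<alpha> t i B"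
       "B m \<le> G * growth \<alpha> q (t 1) (t m)"
    proof (cases "q \<le> \<alpha>")
      case True
      obtain B where "B 0 = 0" "\<forall>i\<in>{1..m}. (t 1 / t i) powr q \<le> adj_sum \<alpha> t i B"
        "B m \<le> growth \<alpha> q (t 1) (t m)"
        using barrier_exists_increasing[OF q0(1) True m] by blast
      moreover have "growth \<alpha> q (t 1) (t m) \<le> G * growth \<alpha> q (t 1) (t m)"
        using mult_right_mono[OF G1 gr0] by simp
      ultimately show thesis by (intro that[of B]) auto
    next
      case False
      then have qa: "\<alpha> < q" by simp
      obtain B where "B 0 = 0" "\<forall>i\<in>{1..m}. (t 1 / t i) powr q \<le> adj_sum \<alpha> t i B"
        "B m \<le> 4 * (2 * L) powr q * L * geom_const q * growth \<alpha> q (t 1) (t m)"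
        using barrier_exists_dyadic[OF qa q0(3) L(1) L(2)[OF qa] m] by blast
      moreover have "4 * (2 * L) powr q * L * geom_const q * growth \<alpha> q (t 1) (t m) \<le> G * growth \<alpha> q (t 1) (t m)"
        using gr0 by (intro mult_right_mono) (auto simp: G_def)
      ultimately show thesis by (intro that[of B]) auto
    qed
    have "\<bar>e m\<bar> \<le> c' * B m"
      unfolding c'_def using error_le_barrier[OF e0 c0(1) q0(1,2) tr m B(1,2)] by simp
    also have "\<dots> \<le> c' * (G * growth \<alpha> q (t 1) (t m))" using B(3) c0 by (intro mult_left_mono)
    also have "\<dots> \<le> c' * (G * (K powr 3 * error_bound \<alpha> r M t m))"
    proof (intro mult_left_mono)
      show "growth \<alpha> q (t 1) (t m) \<le> K powr 3 * error_bound \<alpha> r M t m"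
        unfolding q_def using mesh(3) g t assms(1,2,4)
        by (intro growth_le_error_bound) (auto simp: quasi_graded_def equiv_upto_def)
    qed (use c0 G1 in auto)
    also have "\<dots> \<le> C * error_bound \<alpha> r M t m"
    proof -
      have "0 \<le> error_bound \<alpha> r M t m" using t by (auto simp: error_bound_def)
      then show ?thesis by (simp add: C_def algebra_simps)
    qed
    finally show ?thesis by (simp add: e_def)
  qed
  then show ?thesis using C0 by blast
qed


end
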